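(* Let $G=(V,E)$ be a connected, locally finite, quasi-transitive graph such that $p_c(G)<p_{2\to 2}(G)$, and write $p_c=p_c(G)$. Then there exist positive constants $\delta, c_1, c_2, C_1, C_2$ depending only on $G$ such that $$c_1 n^{-1/2}\exp\left[-C_1|p-p_c|^2 n\right] \leq \mathbf{P}_p\bigl(n\leq |K_v|<\infty\bigr)\leq C_2 n^{-1/2}\exp\left[-c_2|p-p_c|^2 n\right]$$ for every $n\geq 1$, every $v\in V$, and every $p\in(p_c-\delta,p_c+\delta)$.
   Context: A graph is quasi-transitive if the action of its automorphism group on its vertex set has at most finitely many orbits. In Bernoulli-$p$ bond percolation on $G$, with law $\mathbf{P}_p$, each edge is independently open with probability $p$ and closed otherwise; clusters are the connected components of the random subgraph of open edges (with all vertices). $K_v$ is the cluster of $v$ and $|K_v|$ its number of vertices. The critical probability is $p_c(G)=\sup\{p\in[0,1]:\text{every cluster is finite } \mathbf{P}_p\text{-a.s.}\}$. The two-point matrix is $T_p(u,v)=\mathbf{P}_p(u\leftrightarrow v)$ (the probability that $u,v$ lie in the same cluster), $\|T_p\|_{2\to2}=\sup\{\|T_pf\|_2: f\in L^2(V),\|f\|_2=1\}\in[0,\infty]$ is its $L^2(V)\to L^2(V)$ operator norm, and $p_{2\to2}(G)=\sup\{p\in[0,1]:\|T_p\|_{2\to2}<\infty\}$. *)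

theory Defs
  imports "HOL-Probability.Probability"
begin

text \<open>
  Graphs are simple and undirected, given by a vertex set \<open>V\<close> and a set \<open>E\<close> of two-element subsets
  of \<open>V\<close>. Both may be infinite.
\<close>

definition simple_graph :: "'a set \<Rightarrow> 'a set set \<Rightarrow> bool" where
  "simple_graph V E \<longleftrightarrow> (\<forall>e\<in>E. e \<subseteq> V \<and> card e = 2)"

definition linked :: "'a set set \<Rightarrow> 'a \<Rightarrow> 'a \<Rightarrow> bool" where
  "linked F u v \<longleftrightarrow> (u, v) \<in> {(x, y). {x, y} \<in> F}\<^sup>*"

definition connected_graph :: "'a set \<Rightarrow> 'a set set \<Rightarrow> bool" where
  "connected_graph V E \<longleftrightarrow> (\<forall>u\<in>V. \<forall>v\<in>V. linked E u v)"

definition locally_finite_graph :: "'a set \<Rightarrow> 'a set set \<Rightarrow> bool" where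
  "locally_finite_graph V E \<longleftrightarrow> (\<forall>v\<in>V. finite {e\<in>E. v \<in> e})"

text \<open>Values of an automorphism outside \<open>V\<close> are unconstrained; they do not affect orbits in \<open>V\<close>.\<close>

definition automorphisms :: "'a set \<Rightarrow> 'a set set \<Rightarrow> ('a \<Rightarrow> 'a) set" where
  "automorphisms V E =
     {\<phi>. bij_betw \<phi> V V \<and> (\<forall>u\<in>V. \<forall>v\<in>V. {\<phi> u, \<phi> v} \<in> E \<longleftrightarrow> {u, v} \<in> E)}"

definition quasi_transitive :: "'a set \<Rightarrow> 'a set set \<Rightarrow> bool" where
  "quasi_transitive V E \<longleftrightarrow> finite {{\<phi> v | \<phi>. \<phi> \<in> automorphisms V E} | v. v \<in> V}"

text \<open>
  A configuration \<open>\<omega>\<close> says of each edge whether it is open. Outside \<open>[0,1]\<close> the parameter of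
  \<^const>\<open>bernoulli_pmf\<close> is clamped to \<open>[0,1]\<close>.
\<close>

definition percolation :: "'a set set \<Rightarrow> real \<Rightarrow> ('a set \<Rightarrow> bool) measure" where
  "percolation E p = (\<Pi>\<^sub>M e\<in>E. measure_pmf (bernoulli_pmf p))"

definition open_edges :: "'a set set \<Rightarrow> ('a set \<Rightarrow> bool) \<Rightarrow> 'a set set" where
  "open_edges E \<omega> = {e\<in>E. \<omega> e}"

definition cluster :: "'a set set \<Rightarrow> ('a set \<Rightarrow> bool) \<Rightarrow> 'a \<Rightarrow> 'a set" where
  "cluster E \<omega> v = {u. linked (open_edges E \<omega>) v u}"

definition p_crit :: "'a set \<Rightarrow> 'a set set \<Rightarrow> real" where
  "p_crit V E = Sup {p\<in>{0..1}. AE \<omega> in percolation E p. \<forall>v\<in>V. finite (cluster E \<omega> v)}"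

definition two_point :: "'a set set \<Rightarrow> real \<Rightarrow> 'a \<Rightarrow> 'a \<Rightarrow> real" where
  "two_point E p u v =
     measure (percolation E p) {\<omega> \<in> space (percolation E p). v \<in> cluster E \<omega> u}"

definition l2norm :: "'a set \<Rightarrow> ('a \<Rightarrow> real) \<Rightarrow> ennreal" where
  "l2norm V f =
     (if (\<lambda>v. (f v)\<^sup>2) summable_on V then ennreal (sqrt (\<Sum>\<^sub>\<infinity>v\<in>V. (f v)\<^sup>2)) else \<infinity>)"

text \<open>
  \<open>f \<in> L\<^sup>2(V)\<close> with norm 1 is expressed by \<open>l2norm V f = 1\<close>. If some entry of \<open>T f\<close> is given by a
  divergent series, then \<open>T\<close> does not map \<open>L\<^sup>2(V)\<close> to itself, and the operator norm is \<open>\<infinity>\<close>.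
\<close>

definition l2_op_norm :: "'a set \<Rightarrow> ('a \<Rightarrow> 'a \<Rightarrow> real) \<Rightarrow> ennreal" where
  "l2_op_norm V T =
     (SUP f\<in>{f. l2norm V f = 1}.
        if \<forall>u\<in>V. (\<lambda>v. T u v * f v) summable_on V
        then l2norm V (\<lambda>u. \<Sum>\<^sub>\<infinity>v\<in>V. T u v * f v)
        else \<infinity>)"

definition p_2_2 :: "'a set \<Rightarrow> 'a set set \<Rightarrow> real" where
  "p_2_2 V E = Sup {p\<in>{0..1}. l2_op_norm V (two_point E p) < \<infinity>}"

end

theory Submission
  imports Defs
begin

text \<open>
  Everything is derived from one-edge explorations of clusters in finite graphs. Put \<open>\<epsilon> = |p - p_c|\<close>.

  The \<open>L\<^sup>2\<close> bound gives a boundary estimate. If \<open>S\<close> is finite, split an infinite path from \<open>x \<in> S\<close> at its last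
  visit \<open>y\<close> to \<open>S\<close>: with \<open>Q\<^sub>S(y)\<close> the probability that \<open>y\<close> is connected to infinity off \<open>S\<close>,
  \<open>\<theta>(x) \<le> \<Sum>\<^sub>y T(x,y) Q\<^sub>S(y)\<close>. Since \<open>T\<close> is bounded on \<open>L\<^sup>2\<close> and \<open>Q\<^sub>S \<le> C \<theta>\<close>, Cauchy--Schwarz yields
  \<open>\<Sum>\<^sub>y Q\<^sub>S(y) \<ge> c \<theta> |S|\<close>. The same argument for expected cluster sizes shows \<open>\<chi>' \<ge> c \<chi>\<^sup>2\<close>, hence
  \<open>\<chi> \<le> C / \<epsilon>\<close> below \<open>p_c\<close>.

  Changing \<open>p\<close> by \<open>O(1 / sqrt n)\<close> changes the law of the cluster explored up to \<open>n\<close> vertices in a controlled way,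
  because the score is a martingale with variance of order \<open>E min(n,|K|)\<close>. Together with
  \<open>\<chi> \<le> C / \<epsilon>\<close> and the mean-field bound \<open>\<theta> \<ge> c \<epsilon>\<close> this gives \<open>P(|K| \<ge> n) \<approx> 1 / sqrt n\<close> in the window
  \<open>\<epsilon> \<le> C / sqrt n\<close>, the bound \<open>\<theta> \<le> C \<epsilon>\<close>, and, by Jensen's inequality for the likelihood ratio with respect to
  \<open>p_c\<close>, the lower bound of the theorem.

  Below \<open>p_c\<close> the upper bound follows from the martingale \<open>E(|K| | F)\<close>, whose increments are at most \<open>\<chi>\<close>. Above
  \<open>p_c\<close>, explore the cluster at \<open>p\<close> through clusters at \<open>p_c + \<epsilon>/2\<close>, checking afterwards whether edges closed at
  that level are open at level \<open>p\<close>. Each check leads to infinity with probability of order \<open>\<epsilon> Q\<^sub>S(y)\<close>, and by the boundary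
  estimate these probabilities add up to at least \<open>c \<epsilon>\<^sup>2 n\<close> before a finite cluster of size \<open>n\<close> is completed.
\<close>

section \<open>Finite Bernoulli percolation\<close>

text \<open>The difficulty is the prefactor. With \<epsilon> the distance to p_c, an exponential
  moment or a survival estimate alone gives exp (- c \<epsilon>^2 n) times a constant. Both tails
  are therefore arranged to carry a further factor \<epsilon>: below p_c by subtracting 1 from the
  exponential moment before Markov's inequality is applied, above p_c by first paying the
  probability that the cluster reaches a size of order 1 / \<epsilon>^2. Then \<epsilon> exp (- k
  \<epsilon>^2 n) is turned into n^(-1/2) at half the rate (\<open>gaussian_absorb\<close>).

  The hypothesis enters through one parameter \<open>ph\<close> > p_c with finite operator norm: the
  two-point function at \<open>ph\<close> dominates those at all smaller parameters, so that one
  constant \<open>M\<close> serves the whole window. The inputs about p_c itself, finite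
  susceptibility below and a linear lower bound on \<theta> above, come from the functional
  \<open>phi\<close>.

  Until the last two sections probabilities are finite sums, polynomial in p, and infinite-volume
  quantities are suprema over finite edge sets.\<close>

definition pexp :: "'e set \<Rightarrow> ('e \<Rightarrow> real) \<Rightarrow> ('e set \<Rightarrow> real) \<Rightarrow> real" where
  "pexp F w f = (\<Sum>A\<in>Pow F. (\<Prod>e\<in>A. w e) * (\<Prod>e\<in>F - A. 1 - w e) * f A)"

lemma pexp_empty [simp]: "pexp {} w f = f {}"
  by (simp add: pexp_def)

lemma pexp_insert:
  assumes "finite F" "e \<notin> F"
  shows "pexp (insert e F) w f = w e * pexp F w (\<lambda>A. f (insert e A)) + (1 - w e) * pexp F w f"
proof -
  have disj: "Pow F \<inter> insert e ` Pow F = {}" using assms by auto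
  have inj: "inj_on (insert e) (Pow F)"
    using assms by (intro inj_onI) (metis Pow_iff insert_ident subsetD)
  have 1: "(\<Prod>x\<in>insert e F - A. 1 - w x) = (1 - w e) * (\<Prod>x\<in>F - A. 1 - w x)" if "A \<in> Pow F" for A
  proof -
    have "insert e F - A = insert e (F - A)" using that assms by auto
    then show ?thesis using assms by simp
  qed
  have 2: "(\<Prod>x\<in>insert e A. w x) = w e * (\<Prod>x\<in>A. w x)" if "A \<in> Pow F" for A
    using that assms by (subst prod.insert) (auto dest: finite_subset)
  have 3: "insert e F - insert e A = F - A" if "A \<in> Pow F" for A
    using assms that by auto
  have "pexp (insert e F) w f =
     (\<Sum>A\<in>Pow F. (\<Prod>x\<in>A. w x) * (\<Prod>x\<in>insert e F - A. 1 - w x) * f A) +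
     (\<Sum>A\<in>insert e ` Pow F. (\<Prod>x\<in>A. w x) * (\<Prod>x\<in>insert e F - A. 1 - w x) * f A)"
    unfolding pexp_def Pow_insert using assms disj by (intro sum.union_disjoint) auto
  also have "(\<Sum>A\<in>insert e ` Pow F. (\<Prod>x\<in>A. w x) * (\<Prod>x\<in>insert e F - A. 1 - w x) * f A)
     = (\<Sum>A\<in>Pow F. w e * ((\<Prod>x\<in>A. w x) * (\<Prod>x\<in>F - A. 1 - w x) * f (insert e A)))"
    using 2 3 by (subst sum.reindex[OF inj]) (auto intro!: sum.cong simp: mult_ac)
  also have "(\<Sum>A\<in>Pow F. (\<Prod>x\<in>A. w x) * (\<Prod>x\<in>insert e F - A. 1 - w x) * f A)
     = (\<Sum>A\<in>Pow F. (1 - w e) * ((\<Prod>x\<in>A. w x) * (\<Prod>x\<in>F - A. 1 - w x) * f A))"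
    using 1 by (auto intro!: sum.cong simp: mult_ac)
  finally show ?thesis by (simp add: pexp_def sum_distrib_left)
qed

lemma pexp_remove:
  assumes "finite F" "e \<in> F"
  shows "pexp F w f = w e * pexp (F - {e}) w (\<lambda>A. f (insert e A)) + (1 - w e) * pexp (F - {e}) w f"
  using pexp_insert[of "F - {e}" e w f] assms by (simp add: insert_absorb)

lemma pexp_cong:
  assumes "\<And>A. A \<subseteq> F \<Longrightarrow> f A = g A" "\<And>e. e \<in> F \<Longrightarrow> w e = w' e"
  shows "pexp F w f = pexp F w' g"
  unfolding pexp_def
proof (intro sum.cong refl)
  fix A assume "A \<in> Pow F"
  then have A: "A \<subseteq> F" by auto
  have "(\<Prod>e\<in>A. w e) = (\<Prod>e\<in>A. w' e)" using A assms(2) by (intro prod.cong) auto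
  moreover have "(\<Prod>e\<in>F - A. 1 - w e) = (\<Prod>e\<in>F - A. 1 - w' e)" using assms(2) by (intro prod.cong) auto
  ultimately show "(\<Prod>e\<in>A. w e) * (\<Prod>e\<in>F - A. 1 - w e) * f A = (\<Prod>e\<in>A. w' e) * (\<Prod>e\<in>F - A. 1 - w' e) * g A"
    using A assms(1) by simp
qed

lemma pexp_add: "pexp F w (\<lambda>A. f A + g A) = pexp F w f + pexp F w g"
  by (simp add: pexp_def sum.distrib distrib_left)

lemma pexp_diff: "pexp F w (\<lambda>A. f A - g A) = pexp F w f - pexp F w g"
  by (simp add: pexp_def sum_subtractf right_diff_distrib)

lemma pexp_cmult: "pexp F w (\<lambda>A. c * f A) = c * pexp F w f"
  by (simp add: pexp_def sum_distrib_left mult_ac)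

lemma pexp_sum: "pexp F w (\<lambda>A. \<Sum>i\<in>I. f i A) = (\<Sum>i\<in>I. pexp F w (f i))"
proof -
  have "pexp F w (\<lambda>A. \<Sum>i\<in>I. f i A) = (\<Sum>A\<in>Pow F. \<Sum>i\<in>I. (\<Prod>e\<in>A. w e) * (\<Prod>e\<in>F - A. 1 - w e) * f i A)"
    by (simp add: pexp_def sum_distrib_left)
  also have "\<dots> = (\<Sum>i\<in>I. pexp F w (f i))" unfolding pexp_def by (rule sum.swap)
  finally show ?thesis .
qed

lemma pexp_const [simp]: "finite F \<Longrightarrow> pexp F w (\<lambda>_. c) = c"
proof (induction F rule: finite_induct)
  case (insert e F)
  then show ?case by (simp add: pexp_insert algebra_simps)
qed simp

lemma pexp_mono:
  assumes "finite F" "\<And>e. e \<in> F \<Longrightarrow> 0 \<le> w e \<and> w e \<le> 1" "\<And>A. A \<subseteq> F \<Longrightarrow> f A \<le> g A"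
  shows "pexp F w f \<le> pexp F w g"
  unfolding pexp_def
proof (intro sum_mono mult_left_mono)
  fix A assume A: "A \<in> Pow F"
  then show "f A \<le> g A" using assms(3) by auto
  have "0 \<le> (\<Prod>e\<in>A. w e)" "0 \<le> (\<Prod>e\<in>F - A. 1 - w e)"
    using A assms(2) by (auto intro!: prod_nonneg)
  then show "0 \<le> (\<Prod>e\<in>A. w e) * (\<Prod>e\<in>F - A. 1 - w e)" by simp
qed

lemma pexp_nonneg:
  assumes "finite F" "\<And>e. e \<in> F \<Longrightarrow> 0 \<le> w e \<and> w e \<le> 1" "\<And>A. A \<subseteq> F \<Longrightarrow> 0 \<le> f A"
  shows "0 \<le> pexp F w f"
  using pexp_mono[of F w "\<lambda>_. 0" f] assms by simp

lemma pexp_le_const: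
  assumes "finite F" "\<And>e. e \<in> F \<Longrightarrow> 0 \<le> w e \<and> w e \<le> 1" "\<And>A. A \<subseteq> F \<Longrightarrow> f A \<le> c"
  shows "pexp F w f \<le> c"
  using pexp_mono[of F w f "\<lambda>_. c"] assms by simp

text \<open>The expectation is affine in the weight of each single edge, and its slope is the mean
  gain of \<open>f\<close> from opening that edge, which is nonnegative.\<close>

lemma pexp_mono_weight:
  assumes "finite F" "\<And>e. e \<in> F \<Longrightarrow> 0 \<le> w e \<and> w e \<le> w' e \<and> w' e \<le> 1"
    and "\<And>A B. A \<subseteq> B \<Longrightarrow> B \<subseteq> F \<Longrightarrow> f A \<le> f B"
  shows "pexp F w f \<le> pexp F w' f"
  using assms
proof (induction F arbitrary: f rule: finite_induct)
  case (insert e F)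
  let ?g = "\<lambda>A. f (insert e A)"
  have a: "pexp F w ?g \<le> pexp F w' ?g"
    using insert.prems insert.hyps by (intro insert.IH) (auto intro!: insert.prems(2))
  have b: "pexp F w f \<le> pexp F w' f"
    using insert.prems insert.hyps by (intro insert.IH) (auto intro!: insert.prems(2))
  have c: "pexp F w f \<le> pexp F w ?g"
  proof (rule pexp_mono)
    show "0 \<le> w d \<and> w d \<le> 1" if "d \<in> F" for d
      using insert.prems(1)[of d] that by auto
  qed (use insert.hyps in \<open>auto intro!: insert.prems(2)\<close>)
  have w: "0 \<le> w e" "w e \<le> w' e" "w' e \<le> 1" using insert.prems(1)[of e] by auto
  have "pexp (insert e F) w f = pexp F w f + w e * (pexp F w ?g - pexp F w f)"
    using insert.hyps by (simp add: pexp_insert algebra_simps)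
  also have "\<dots> \<le> pexp F w f + w' e * (pexp F w ?g - pexp F w f)"
    using w c by (intro add_mono mult_right_mono) auto
  also have "\<dots> = w' e * pexp F w ?g + (1 - w' e) * pexp F w f" by (simp add: algebra_simps)
  also have "\<dots> \<le> w' e * pexp F w' ?g + (1 - w' e) * pexp F w' f"
    using w a b by (intro add_mono mult_left_mono) auto
  finally show ?case using insert.hyps by (simp add: pexp_insert)
qed simp

lemma pexp_restrict:
  assumes "finite F" "F0 \<subseteq> F"
  shows "pexp F w (\<lambda>A. f (A \<inter> F0)) = pexp F0 w f"
proof -
  have "finite (F - F0)" using assms by auto
  have "finite F0" using assms finite_subset by blast
  have "pexp (G \<union> F0) w (\<lambda>A. f (A \<inter> F0)) = pexp F0 w f" if "G \<subseteq> F - F0" "finite G" for G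
    using that(2,1)
  proof (induction G rule: finite_induct)
    case empty
    then show ?case by (auto intro!: pexp_cong arg_cong[of _ _ f])
  next
    case (insert e G)
    have 1: "insert e A \<inter> F0 = A \<inter> F0" for A using insert.prems by auto
    have "finite (G \<union> F0)" "e \<notin> G \<union> F0" using insert \<open>finite F0\<close> by auto
    then show ?case using insert 1 by (simp add: pexp_insert algebra_simps)
  qed
  from this[of "F - F0"] assms \<open>finite (F - F0)\<close> show ?thesis by (simp add: Un_absorb2)
qed

lemma pexp_mono_set:
  assumes "finite F'" "F \<subseteq> F'" "\<And>e. e \<in> F' \<Longrightarrow> 0 \<le> w e \<and> w e \<le> 1"
    and "\<And>A B. A \<subseteq> B \<Longrightarrow> B \<subseteq> F' \<Longrightarrow> f A \<le> f B"
  shows "pexp F w f \<le> pexp F' w f"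
proof -
  have "pexp F w f = pexp F' w (\<lambda>A. f (A \<inter> F))" using pexp_restrict[OF assms(1,2)] by simp
  also have "\<dots> \<le> pexp F' w f" using assms by (intro pexp_mono) auto
  finally show ?thesis .
qed

lemma pexp_image:
  assumes "finite F" "inj_on \<phi> F"
  shows "pexp (\<phi> ` F) (\<lambda>_. p) f = pexp F (\<lambda>_. p) (\<lambda>A. f (\<phi> ` A))"
  using assms
proof (induction F arbitrary: f rule: finite_induct)
  case (insert e F)
  then have "\<phi> e \<notin> \<phi> ` F" by auto
  with insert show ?case by (simp add: pexp_insert)
qed simp

section \<open>Connectivity and clusters inside a given set of open edges\<close>

definition reach :: "'a set set \<Rightarrow> 'a set \<Rightarrow> 'a set" where
  "reach A S = {u. \<exists>s\<in>S. linked A s u}"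

lemma linked_refl [simp]: "linked A u u"
  by (simp add: linked_def)

lemma linked_trans: "linked A u v \<Longrightarrow> linked A v w \<Longrightarrow> linked A u w"
  unfolding linked_def by (rule rtrancl_trans)

lemma linked_edge: "{u, v} \<in> A \<Longrightarrow> linked A u v"
  unfolding linked_def by auto

lemma linked_sym: "linked A u v \<Longrightarrow> linked A v u"
proof -
  have "sym {(x, y). {x, y} \<in> A}" by (auto simp: sym_def insert_commute)
  then show "linked A u v \<Longrightarrow> linked A v u"
    unfolding linked_def by (meson sym_rtrancl symD)
qed

lemma linked_mono: "A \<subseteq> B \<Longrightarrow> linked A u v \<Longrightarrow> linked B u v"
  unfolding linked_def using rtrancl_mono[of "{(x, y). {x, y} \<in> A}" "{(x, y). {x, y} \<in> B}"] by auto

lemma linked_induct [consumes 1, case_names refl step]: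
  assumes "linked A u v" "P u" "\<And>x y. linked A u x \<Longrightarrow> P x \<Longrightarrow> {x, y} \<in> A \<Longrightarrow> P y"
  shows "P v"
  using assms(1) unfolding linked_def
proof (induction rule: rtrancl_induct)
  case base then show ?case by (rule assms(2))
next
  case (step y z) then show ?case using assms(3)[of y z] by (auto simp: linked_def)
qed

lemma reach_superset: "S \<subseteq> reach A S"
proof
  fix x assume "x \<in> S"
  then show "x \<in> reach A S" unfolding reach_def mem_Collect_eq by (rule bexI[rotated]) (rule linked_refl)
qed

lemma reach_self [simp, intro]: "v \<in> reach A {v}"
  by (simp add: reach_def)

lemma reach_mono: "A \<subseteq> B \<Longrightarrow> S \<subseteq> T \<Longrightarrow> reach A S \<subseteq> reach B T"
  unfolding reach_def by (auto dest: linked_mono)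

lemma reach_closed: "x \<in> reach A S \<Longrightarrow> {x, y} \<in> A \<Longrightarrow> y \<in> reach A S"
  unfolding reach_def mem_Collect_eq by (erule bexE, rule bexI, rule linked_trans, assumption, erule linked_edge)

lemma reach_least:
  assumes "S \<subseteq> T" "\<And>x y. x \<in> T \<Longrightarrow> {x, y} \<in> A \<Longrightarrow> y \<in> T"
  shows "reach A S \<subseteq> T"
proof
  fix u assume "u \<in> reach A S"
  then obtain s where "s \<in> S" "linked A s u" by (auto simp: reach_def)
  from this(2) show "u \<in> T"
    by (induction rule: linked_induct) (use \<open>s \<in> S\<close> assms in auto)
qed

lemma reach_eq_self:
  assumes "\<And>x y. x \<in> S \<Longrightarrow> {x, y} \<in> A \<Longrightarrow> y \<in> S"
  shows "reach A S = S"
  using reach_least[of S S A] reach_superset[of S A] assms by blast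

text \<open>An open edge from \<open>S\<close> to \<open>y\<close> can be traded for
  \<open>y\<close> as a further starting point. This makes the exploration a recursion on the pair
  of unknown edges and explored vertices.\<close>

lemma reach_insert_edge:
  assumes "x \<in> S"
  shows "reach (insert {x, y} A) S = reach A (insert y S)"
proof
  show "reach (insert {x, y} A) S \<subseteq> reach A (insert y S)"
  proof (rule reach_least)
    show "S \<subseteq> reach A (insert y S)" using reach_superset[of "insert y S" A] by blast
    have *: "x \<in> reach A (insert y S)" "y \<in> reach A (insert y S)"
      using assms reach_superset[of "insert y S" A] by auto
    show "b \<in> reach A (insert y S)" if "a \<in> reach A (insert y S)" "{a, b} \<in> insert {x, y} A" for a b
      using that * by (auto simp: doubleton_eq_iff dest: reach_closed)
  qed
  show "reach A (insert y S) \<subseteq> reach (insert {x, y} A) S"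
  proof (rule reach_least)
    have "x \<in> reach (insert {x, y} A) S" using assms reach_superset[of S "insert {x, y} A"] by blast
    then have "y \<in> reach (insert {x, y} A) S" by (rule reach_closed) simp
    then show "insert y S \<subseteq> reach (insert {x, y} A) S" using reach_superset[of S "insert {x, y} A"] by blast
    show "b \<in> reach (insert {x, y} A) S" if "a \<in> reach (insert {x, y} A) S" "{a, b} \<in> A" for a b
      using that reach_closed[of a] by blast
  qed
qed

lemma reach_insert: "reach A (insert y S) = reach A {y} \<union> reach A S"
  by (auto simp: reach_def)

lemma reach_sym: "u \<in> reach A {v} \<longleftrightarrow> v \<in> reach A {u}"
  unfolding reach_def by (simp, metis linked_sym)

lemma reach_subset_Union: "reach A S \<subseteq> S \<union> \<Union>A"
  by (rule reach_least) auto

lemma cluster_eq_reach: "cluster E \<omega> v = reach (open_edges E \<omega>) {v}"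
  by (simp add: cluster_def reach_def)

text \<open>The start is a set because the explored vertices of a partly revealed cluster act as the
  start for the remaining edges. It may be infinite: connections to the complement of a finite set
  are explored from that complement.\<close>

definition rexp :: "'a set set \<Rightarrow> real \<Rightarrow> 'a set \<Rightarrow> ('a set \<Rightarrow> real) \<Rightarrow> real" where
  "rexp F p S f = pexp F (\<lambda>_. p) (\<lambda>A. f (reach A S))"

lemma pexp_reach_step:
  assumes "finite F" "{x, y} \<in> F" "x \<in> S"
  shows "pexp F w (\<lambda>A. f (reach A S)) =
    w {x, y} * pexp (F - {{x, y}}) w (\<lambda>A. f (reach A (insert y S))) +
    (1 - w {x, y}) * pexp (F - {{x, y}}) w (\<lambda>A. f (reach A S))"
  using pexp_remove[OF assms(1,2), of w "\<lambda>A. f (reach A S)"] reach_insert_edge[OF assms(3)] by simp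

lemma rexp_step:
  assumes "finite F" "{x, y} \<in> F" "x \<in> S"
  shows "rexp F p S f =
    p * rexp (F - {{x, y}}) p (insert y S) f + (1 - p) * rexp (F - {{x, y}}) p S f"
  unfolding rexp_def by (rule pexp_reach_step[OF assms])

lemma pexp_reach_terminal:
  assumes "finite F" "\<And>x y. x \<in> S \<Longrightarrow> {x, y} \<in> F \<Longrightarrow> y \<in> S"
  shows "pexp F w (\<lambda>A. f (reach A S)) = f S"
proof -
  have "pexp F w (\<lambda>A. f (reach A S)) = pexp F w (\<lambda>A. f S)"
  proof (rule pexp_cong)
    fix A assume "A \<subseteq> F"
    then have "reach A S = S" using assms(2) by (intro reach_eq_self) blast
    then show "f (reach A S) = f S" by simp
  qed simp
  then show ?thesis using assms by simp
qed

lemma rexp_terminal: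
  assumes "finite F" "\<And>x y. x \<in> S \<Longrightarrow> {x, y} \<in> F \<Longrightarrow> y \<in> S"
  shows "rexp F p S f = f S"
  unfolding rexp_def by (rule pexp_reach_terminal[OF assms])

lemma rexp_mono:
  assumes "finite F" "0 \<le> p" "p \<le> 1" "\<And>A. A \<subseteq> F \<Longrightarrow> f (reach A S) \<le> g (reach A S)"
  shows "rexp F p S f \<le> rexp F p S g"
  unfolding rexp_def using assms by (intro pexp_mono) auto

lemma rexp_nonneg:
  assumes "finite F" "0 \<le> p" "p \<le> 1" "\<And>A. A \<subseteq> F \<Longrightarrow> 0 \<le> f (reach A S)"
  shows "0 \<le> rexp F p S f"
  unfolding rexp_def using assms by (intro pexp_nonneg) auto

lemma rexp_le_const:
  assumes "finite F" "0 \<le> p" "p \<le> 1" "\<And>A. A \<subseteq> F \<Longrightarrow> f (reach A S) \<le> c"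
  shows "rexp F p S f \<le> c"
  unfolding rexp_def using assms by (intro pexp_le_const) auto

lemma rexp_const [simp]: "finite F \<Longrightarrow> rexp F p S (\<lambda>_. c) = c"
  by (simp add: rexp_def)

lemma rexp_add: "rexp F p S (\<lambda>K. f K + g K) = rexp F p S f + rexp F p S g"
  by (simp add: rexp_def pexp_add)

lemma rexp_diff: "rexp F p S (\<lambda>K. f K - g K) = rexp F p S f - rexp F p S g"
  by (simp add: rexp_def pexp_diff)

lemma rexp_cmult: "rexp F p S (\<lambda>K. c * f K) = c * rexp F p S f"
  by (simp add: rexp_def pexp_cmult)

lemma rexp_sum: "rexp F p S (\<lambda>K. \<Sum>i\<in>I. f i K) = (\<Sum>i\<in>I. rexp F p S (f i))"
  by (simp add: rexp_def pexp_sum)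

section \<open>Tilting the percolation parameter\<close>

text \<open>
  The cluster of \<open>S\<close> is explored one edge at a time; \<open>F\<close> is the set of edges whose state is still
  unknown. If an edge from \<open>S\<close> to \<open>y\<close> is open, then \<open>y\<close> joins \<open>S\<close>; in either case it leaves \<open>F\<close>.
\<close>

lemma explore_induct [consumes 1, case_names terminal step]:
  assumes "finite F"
    and terminal: "\<And>F S. finite F \<Longrightarrow> (\<And>x y. x \<in> S \<Longrightarrow> {x, y} \<in> F \<Longrightarrow> y \<in> S) \<Longrightarrow> P F S"
    and step: "\<And>F S x y. finite F \<Longrightarrow> {x, y} \<in> F \<Longrightarrow> x \<in> S \<Longrightarrow> y \<notin> S \<Longrightarrow>
      P (F - {{x, y}}) (insert y S) \<Longrightarrow> P (F - {{x, y}}) S \<Longrightarrow> P F S"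
  shows "P F S"
  using assms(1)
proof (induction "card F" arbitrary: F S rule: less_induct)
  case (less F S)
  show ?case
  proof (cases "\<exists>x y. x \<in> S \<and> {x, y} \<in> F \<and> y \<notin> S")
    case True
    then obtain x y where xy: "x \<in> S" "{x, y} \<in> F" "y \<notin> S" by blast
    have "card (F - {{x, y}}) < card F" using less.prems xy by (intro card_Diff1_less)
    with less xy show ?thesis by (intro step[of F x y S]) auto
  next
    case False
    with less.prems show ?thesis by (intro terminal) auto
  qed
qed

text \<open>One step of \<open>tilt\<close>: \<open>a0\<close>, \<open>b0\<close> at
  \<open>p0\<close> and \<open>a\<close>, \<open>b\<close> at \<open>p\<close> are the probabilities
  of the event after the current edge is found open or closed, and \<open>d\<close> is the product
  rule for the derivative at \<open>p0\<close>. An open edge adds \<open>1 / p0\<close> to the score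
  and a closed one \<open>- 1 / (1 - p0)\<close>, whence the shifted values of \<open>c\<close> in
  \<open>X\<close> and \<open>Y\<close>. \<open>L\<close> is the second-order loss of the later
  edges and \<open>k\<close> that of this edge.\<close>

lemma tilt_step:
  fixes a0 b0 a b da db \<alpha> \<beta> p0 p k L :: real
  defines "\<epsilon> \<equiv> p - p0"
  defines "d \<equiv> a0 - b0 + p0 * da + (1 - p0) * db" and "g0 \<equiv> p0 * a0 + (1 - p0) * b0"
  assumes p: "0 < p0" "p0 < 1" "0 < p" "p < 1" and nn: "0 \<le> a0" "0 \<le> b0" and ab: "0 \<le> \<alpha>" "0 \<le> \<beta>"
    and HA: "\<And>c. (da + c * a0)\<^sup>2 \<le> (\<alpha> + c\<^sup>2) * a0" and HB: "\<And>c. (db + c * b0)\<^sup>2 \<le> (\<beta> + c\<^sup>2) * b0"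
    and LA: "a \<ge> a0 * exp (\<epsilon> * da / a0 - L)" and LB: "b \<ge> b0 * exp (\<epsilon> * db / b0 - L)"
    and kp: "p \<ge> p0 * exp (\<epsilon> / p0 - k)" and kq: "1 - p \<ge> (1 - p0) * exp (- \<epsilon> / (1 - p0) - k)"
  shows "(d + c * g0)\<^sup>2 \<le> (p0 * \<alpha> + (1 - p0) * \<beta> + 1 / (p0 * (1 - p0)) + c\<^sup>2) * g0"
    and "p * a + (1 - p) * b \<ge> g0 * exp (\<epsilon> * d / g0 - (L + k))"
proof -
  define X where "X = da + (c + 1 / p0) * a0"
  define Y where "Y = db + (c - 1 / (1 - p0)) * b0"
  define P where "P = \<alpha> + (c + 1 / p0)\<^sup>2"
  define Q where "Q = \<beta> + (c - 1 / (1 - p0))\<^sup>2"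
  have q: "1 - p0 > 0" using p by simp
  have XP: "X\<^sup>2 \<le> P * a0" unfolding X_def P_def by (rule HA)
  have YQ: "Y\<^sup>2 \<le> Q * b0" unfolding Y_def Q_def by (rule HB)
  have dX: "d + c * g0 = p0 * X + (1 - p0) * Y"
    using p q unfolding d_def g0_def X_def Y_def by (simp add: field_simps)
  have PQ: "0 \<le> P" "0 \<le> Q" using ab by (auto simp: P_def Q_def)
  \<comment> \<open>Cross term of Cauchy--Schwarz in a form without division:
    \<open>(X * Y)\<^sup>2\<close> is at most the product of \<open>P * b0\<close> and
    \<open>Q * a0\<close>, and twice the geometric mean is at most the sum.\<close>
  have XY: "2 * X * Y \<le> P * b0 + Q * a0"
  proof -
    have "(X * Y)\<^sup>2 \<le> (P * a0) * (Q * b0)"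
      unfolding power_mult_distrib using XP YQ by (intro mult_mono) (auto intro: order_trans[OF zero_le_power2])
    also have "\<dots> = (P * b0) * (Q * a0)" by simp
    finally have 1: "4 * (X * Y)\<^sup>2 \<le> 4 * ((P * b0) * (Q * a0))" by simp
    have "4 * (u * v) \<le> (u + v)\<^sup>2" for u v :: real
      using sum_squares_bound[of u v] by (simp add: power2_sum)
    from this[of "P * b0" "Q * a0"]
    have "4 * ((P * b0) * (Q * a0)) \<le> (P * b0 + Q * a0)\<^sup>2" .
    with 1 have "(2 * X * Y)\<^sup>2 \<le> (P * b0 + Q * a0)\<^sup>2" by (simp add: power_mult_distrib)
    moreover have "0 \<le> P * b0 + Q * a0" using PQ nn by simp
    ultimately show ?thesis by (rule power2_le_imp_le)
  qed
  \<comment> \<open>The terms linear in \<open>c\<close> cancel because the score of an edge is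
    centred; what remains is its variance \<open>1 / (p0 * (1 - p0))\<close>.\<close>
  have PQsum: "p0 * P + (1 - p0) * Q = p0 * \<alpha> + (1 - p0) * \<beta> + 1 / (p0 * (1 - p0)) + c\<^sup>2"
    using p q unfolding P_def Q_def by (simp add: divide_simps) (simp add: algebra_simps power2_eq_square)
  have "(d + c * g0)\<^sup>2 = p0\<^sup>2 * X\<^sup>2 + (p0 * (1 - p0)) * (2 * X * Y) + (1 - p0)\<^sup>2 * Y\<^sup>2"
    unfolding dX by (simp add: power2_eq_square algebra_simps)
  also have "\<dots> \<le> p0\<^sup>2 * (P * a0) + (p0 * (1 - p0)) * (P * b0 + Q * a0) + (1 - p0)\<^sup>2 * (Q * b0)"
    using p q XP YQ XY by (intro add_mono mult_left_mono) auto
  also have "\<dots> = (p0 * P + (1 - p0) * Q) * g0"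
    unfolding g0_def by (simp add: power2_eq_square algebra_simps)
  finally show "(d + c * g0)\<^sup>2 \<le> (p0 * \<alpha> + (1 - p0) * \<beta> + 1 / (p0 * (1 - p0)) + c\<^sup>2) * g0"
    unfolding PQsum .
  show "p * a + (1 - p) * b \<ge> g0 * exp (\<epsilon> * d / g0 - (L + k))"
  proof (cases "g0 = 0")
    case True
    have "a \<ge> 0" "b \<ge> 0" using LA LB nn by (auto intro: order_trans[rotated])
    with True p show ?thesis by simp
  next
    case False
    have "g0 \<ge> 0" using nn p unfolding g0_def by simp
    with False have g0: "g0 > 0" by simp
    define x where "x = \<epsilon> * da / a0 + \<epsilon> / p0"
    define y where "y = \<epsilon> * db / b0 - \<epsilon> / (1 - p0)"
    define z where "z = \<epsilon> * d / g0"
    have "da\<^sup>2 \<le> \<alpha> * a0" "db\<^sup>2 \<le> \<beta> * b0" using HA[of 0] HB[of 0] by auto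
    \<comment> \<open>Division by zero gives 0, so \<open>x\<close> and \<open>y\<close> have the
      intended meaning only if the derivative vanishes together with the probability; the bound with
      \<open>c = 0\<close> ensures this.\<close>
    then have zero: "a0 = 0 \<Longrightarrow> da = 0" "b0 = 0 \<Longrightarrow> db = 0" by auto
    have x: "a0 * x = \<epsilon> * da + \<epsilon> * a0 / p0" and y: "b0 * y = \<epsilon> * db - \<epsilon> * b0 / (1 - p0)"
      using zero unfolding x_def y_def by (auto simp: field_simps)
    have z: "g0 * z = \<epsilon> * d" using g0 by (simp add: z_def)
    have "p0 * (a0 * x) + (1 - p0) * (b0 * y) = \<epsilon> * d"
      unfolding x y d_def using p q by (simp add: field_simps)
    \<comment> \<open>\<open>z\<close> is the average of \<open>x\<close> and \<open>y\<close> with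
      weights \<open>p0 * a0\<close> and \<open>(1 - p0) * b0\<close>, so the tangent to exp at
      \<open>z\<close> gives Jensen's inequality for two points.\<close>
    then have mean: "p0 * a0 * (x - z) + (1 - p0) * b0 * (y - z) = 0"
      using z unfolding g0_def by (simp add: algebra_simps)
    have tangent: "exp z * (1 + (t - z)) \<le> exp t" for t :: real
    proof -
      have "exp z * (1 + (t - z)) \<le> exp z * exp (t - z)"
        using exp_ge_add_one_self[of "t - z"] by (intro mult_left_mono) auto
      then show ?thesis by (simp add: exp_diff)
    qed
    have "g0 * exp z = exp z * (p0 * a0 + (1 - p0) * b0 + (p0 * a0 * (x - z) + (1 - p0) * b0 * (y - z)))"
      unfolding mean g0_def by simp
    also have "\<dots> = p0 * a0 * (exp z * (1 + (x - z))) + (1 - p0) * b0 * (exp z * (1 + (y - z)))"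
      by (simp add: algebra_simps)
    also have "\<dots> \<le> p0 * a0 * exp x + (1 - p0) * b0 * exp y"
      using p q nn by (intro add_mono mult_left_mono tangent) auto
    finally have conv: "g0 * exp z \<le> p0 * a0 * exp x + (1 - p0) * b0 * exp y" .
    have "g0 * exp (z - (L + k)) = (g0 * exp z) * exp (- L) * exp (- k)"
      by (simp add: exp_diff exp_add exp_minus field_simps)
    also have "\<dots> \<le> (p0 * a0 * exp x + (1 - p0) * b0 * exp y) * exp (- L) * exp (- k)"
      using conv by (intro mult_right_mono) auto
    also have "\<dots> = (p0 * exp (\<epsilon> / p0 - k)) * (a0 * exp (\<epsilon> * da / a0 - L)) +
        ((1 - p0) * exp (- \<epsilon> / (1 - p0) - k)) * (b0 * exp (\<epsilon> * db / b0 - L))"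
      unfolding x_def y_def by (simp add: exp_diff exp_add exp_minus field_simps)
    also have "\<dots> \<le> p * a + (1 - p) * b"
      using p q nn kp kq LA LB by (intro add_mono mult_mono) (auto intro: mult_nonneg_nonneg)
    finally show ?thesis by (simp add: z_def)
  qed
qed

text \<open>An element of the type that lies on no edge counts as an isolated vertex, so statements
  can be made for every element of the type.\<close>

locale bounded_degree =
  fixes E :: "'a set set" and D :: nat
  assumes edge_card: "e \<in> E \<Longrightarrow> card e = 2"
    and finite_incident: "finite {e \<in> E. v \<in> e}"
    and degree_le: "card {e \<in> E. v \<in> e} \<le> D"
begin

lemma edge_finite: "e \<in> E \<Longrightarrow> finite e"
  using edge_card card.infinite by fastforce

lemma edgeE:
  assumes "e \<in> E"
  obtains x y where "e = {x, y}" "x \<noteq> y"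
  using edge_card[OF assms] by (meson card_2_iff)

lemma finite_touching: "finite S \<Longrightarrow> finite {e \<in> E. e \<inter> S \<noteq> {}}"
proof -
  assume "finite S"
  have "{e \<in> E. e \<inter> S \<noteq> {}} = (\<Union>x\<in>S. {e \<in> E. x \<in> e})" by auto
  with \<open>finite S\<close> finite_incident show ?thesis by simp
qed

text \<open>Bounds the length of an exploration: every revealed edge meets the explored set.\<close>

lemma card_touching_le:
  assumes "finite S" "B \<subseteq> E" "\<And>e. e \<in> B \<Longrightarrow> e \<inter> S \<noteq> {}"
  shows "finite B" "card B \<le> D * card S"
proof -
  have sub: "B \<subseteq> (\<Union>x\<in>S. {e \<in> E. x \<in> e})" using assms by blast
  have fin: "finite (\<Union>x\<in>S. {e \<in> E. x \<in> e})" using assms finite_incident by auto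
  show "finite B" using sub fin finite_subset by blast
  have "card B \<le> card (\<Union>x\<in>S. {e \<in> E. x \<in> e})" by (intro card_mono fin sub)
  also have "\<dots> \<le> (\<Sum>x\<in>S. card {e \<in> E. x \<in> e})" by (intro card_UN_le assms)
  also have "\<dots> \<le> (\<Sum>x\<in>S. D)" by (intro sum_mono degree_le)
  finally show "card B \<le> D * card S" by (simp add: mult.commute)
qed

lemma finite_reach:
  assumes "finite F" "F \<subseteq> E" "finite S" "A \<subseteq> F"
  shows "finite (reach A S)"
proof -
  have "finite (S \<union> \<Union>A)" using assms edge_finite finite_subset[of A F] by auto
  then show ?thesis using reach_subset_Union[of A S] finite_subset by blast
qed

lemma card_reach_ge:
  assumes "finite F" "F \<subseteq> E" "finite S" "A \<subseteq> F"
  shows "card S \<le> card (reach A S)"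
  by (intro card_mono finite_reach[OF assms] reach_superset)

lemma card_reach_mono:
  assumes "finite F" "F \<subseteq> E" "finite T" "B \<subseteq> F" "A \<subseteq> B" "S \<subseteq> T"
  shows "card (reach A S) \<le> card (reach B T)"
  using assms by (intro card_mono finite_reach[of F] reach_mono)

text \<open>
  Here \<open>B\<close> is the set of explored edges and \<open>d\<close> is the derivative of the probability in \<open>p0\<close>, that is, the
  mean of the score on the event. The first bound is Cauchy--Schwarz for the score, a martingale with
  increments of variance \<open>1 / (p0 (1 - p0))\<close>; it is stated with a shift \<open>c\<close> because an explored edge
  shifts the score. The second one is Jensen's inequality for the logarithm of the likelihood ratio.
\<close>

lemma tilt:
  fixes f :: "'a set \<Rightarrow> real"
  assumes "finite F" "F \<subseteq> E" "finite S" "card S \<le> N"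
    and "B \<subseteq> E" "F \<inter> B = {}" "\<And>e. e \<in> B \<Longrightarrow> e \<inter> S \<noteq> {}"
    and p: "0 < p0" "p0 < 1" "0 < p" "p < 1" "0 \<le> K"
    and kp: "p \<ge> p0 * exp ((p - p0) / p0 - K * (p - p0)\<^sup>2)"
    and kq: "1 - p \<ge> (1 - p0) * exp (- (p - p0) / (1 - p0) - K * (p - p0)\<^sup>2)"
    and f01: "\<And>T. 0 \<le> f T \<and> f T \<le> 1"
    and fN: "\<And>T T'. finite T' \<Longrightarrow> T \<subseteq> T' \<Longrightarrow> N \<le> card T \<Longrightarrow> f T' = f T"
  shows "\<exists>d. (\<forall>c. (d + c * rexp F p0 S f)\<^sup>2 \<le>
        ((D * rexp F p0 S (\<lambda>K. real (min N (card K))) - card B) / (p0 * (1 - p0)) + c\<^sup>2) * rexp F p0 S f) \<and>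
      rexp F p S f \<ge> rexp F p0 S f * exp ((p - p0) * d / rexp F p0 S f - K * (p - p0)\<^sup>2 * (D * N - real (card B)))"
  using assms(1-7)
proof (induction F S arbitrary: B rule: explore_induct)
  case (terminal F S)
  have [simp]: "rexp F q S g = g S" for q and g :: "'a set \<Rightarrow> real"
    using terminal by (intro rexp_terminal) auto
  have "card B \<le> D * card S" using terminal by (intro card_touching_le) auto
  then have B: "real (card B) \<le> D * real (card S)" by (metis of_nat_le_iff of_nat_mult)
  have m: "min N (card S) = card S" using terminal by simp
  have "f S * (f S * c\<^sup>2) \<le> f S * c\<^sup>2" for c
    using f01[of S] by (intro mult_left_mono mult_left_le_one_le) auto
  moreover have "0 \<le> (D * real (card S) - card B) / (p0 * (1 - p0)) * f S"
    using B p f01[of S] by simp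
  ultimately have 1: "(0 + c * f S)\<^sup>2 \<le> ((D * real (min N (card S)) - card B) / (p0 * (1 - p0)) + c\<^sup>2) * f S" for c
    unfolding m by (simp add: power_mult_distrib power2_eq_square algebra_simps) (smt (verit))
  have "D * real (card S) \<le> D * real N" using terminal by (intro mult_left_mono) auto
  with B have "0 \<le> K * (p - p0)\<^sup>2 * (D * real N - card B)" using p by simp
  then have "f S * exp (- (K * (p - p0)\<^sup>2 * (D * real N - card B))) \<le> f S"
    using f01[of S] by (intro mult_right_le_one_le) auto
  with 1 show ?case by (intro exI[of _ 0]) simp
next
  case (step F S x y)
  show ?case
  \<comment> \<open>The exploration is stopped at \<open>N\<close> vertices although unknown edges
    remain: \<open>f\<close> no longer changes, so the derivative is 0, and the truncated size
    equals \<open>N\<close>. This is why \<open>min N (card K)\<close> controls the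
    variance.\<close>
  proof (cases "card S = N")
    case True
    have [simp]: "rexp F q S f = f S" for q
    proof -
      have "rexp F q S f = rexp F q S (\<lambda>_. f S)"
        unfolding rexp_def
      proof (rule pexp_cong)
        fix A assume "A \<subseteq> F"
        then show "f (reach A S) = f S"
          using step.hyps step.prems True by (intro fN finite_reach[of F] reach_superset) auto
      qed simp
      then show ?thesis using step by simp
    qed
    have m: "rexp F p0 S (\<lambda>K. real (min N (card K))) = N"
    proof -
      have "rexp F p0 S (\<lambda>K. real (min N (card K))) = rexp F p0 S (\<lambda>_. real N)"
        unfolding rexp_def
      proof (rule pexp_cong)
        fix A assume "A \<subseteq> F"
        then have "N \<le> card (reach A S)" using card_reach_ge[of F S A] step True by auto
        then show "real (min N (card (reach A S))) = real N" by simp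
      qed simp
      then show ?thesis using step by simp
    qed
    have "card B \<le> D * card S" using step.prems by (intro card_touching_le) auto
    then have B: "real (card B) \<le> D * real N" using True by (metis of_nat_le_iff of_nat_mult)
    have "f S * (f S * c\<^sup>2) \<le> f S * c\<^sup>2" for c
      using f01[of S] by (intro mult_left_mono mult_left_le_one_le) auto
    moreover have "0 \<le> (D * real N - card B) / (p0 * (1 - p0)) * f S"
      using B p f01[of S] by simp
    ultimately have 1: "(0 + c * f S)\<^sup>2 \<le> ((D * real N - card B) / (p0 * (1 - p0)) + c\<^sup>2) * f S" for c
      by (simp add: power_mult_distrib power2_eq_square algebra_simps) (smt (verit))
    have "0 \<le> K * (p - p0)\<^sup>2 * (D * real N - card B)" using p B by simp
    then have "f S * exp (- (K * (p - p0)\<^sup>2 * (D * real N - card B))) \<le> f S"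
      using f01[of S] by (intro mult_right_le_one_le) auto
    with 1 show ?thesis unfolding m by (intro exI[of _ 0]) simp
  next
    case False
    define e where "e = {x, y}"
    define F' where "F' = F - {e}"
    have F': "finite F'" "F' \<subseteq> E" using step F'_def by auto
    have SN: "card (insert y S) \<le> N" "card S \<le> N" using False step by auto
    have fin: "finite S" "finite (insert y S)" using step by auto
    have eB: "e \<notin> B" using step e_def by auto
    have cB: "card (insert e B) = card B + 1"
      using card_touching_le(1)[of S B] step.prems eB by simp
    have prem: "insert e B \<subseteq> E" "F' \<inter> insert e B = {}"
      "\<And>d. d \<in> insert e B \<Longrightarrow> d \<inter> insert y S \<noteq> {}" "\<And>d. d \<in> insert e B \<Longrightarrow> d \<inter> S \<noteq> {}"
      using step e_def F'_def by auto
    let ?m = "\<lambda>K :: 'a set. real (min N (card K))"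
    define a0 where "a0 = rexp F' p0 (insert y S) f"
    define b0 where "b0 = rexp F' p0 S f"
    define a where "a = rexp F' p (insert y S) f"
    define b where "b = rexp F' p S f"
    define ma where "ma = rexp F' p0 (insert y S) ?m"
    define mb where "mb = rexp F' p0 S ?m"
    define \<alpha> where "\<alpha> = (D * ma - real (card B + 1)) / (p0 * (1 - p0))"
    define \<beta> where "\<beta> = (D * mb - real (card B + 1)) / (p0 * (1 - p0))"
    define L where "L = K * (p - p0)\<^sup>2 * (D * N - real (card B + 1))"
    obtain da where da: "\<And>c. (da + c * a0)\<^sup>2 \<le> (\<alpha> + c\<^sup>2) * a0" "a \<ge> a0 * exp ((p - p0) * da / a0 - L)"
      using step.IH(1)[folded e_def, folded F'_def, OF F'(2) fin(2) SN(1) prem(1,2) prem(3), folded a0_def a_def ma_def, unfolded cB, folded \<alpha>_def L_def]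
      by auto
    obtain db where db: "\<And>c. (db + c * b0)\<^sup>2 \<le> (\<beta> + c\<^sup>2) * b0" "b \<ge> b0 * exp ((p - p0) * db / b0 - L)"
      using step.IH(2)[folded e_def, folded F'_def, OF F'(2) fin(1) SN(2) prem(1,2) prem(4), folded b0_def b_def mb_def, unfolded cB, folded \<beta>_def L_def]
      by auto
    have nn: "0 \<le> a0" "0 \<le> b0" unfolding a0_def b0_def using F' p f01 by (auto intro!: rexp_nonneg)
    have mge: "real (card B) + 1 \<le> D * rexp F' p0 T ?m" if T: "T = S \<or> T = insert y S" for T
    proof -
      have fT: "finite T" "card T \<le> N" using T step.prems SN by auto
      have "card (insert e B) \<le> D * card T"
        using prem T fT by (intro card_touching_le) auto
      then have "real (card B) + 1 \<le> D * real (card T)" unfolding cB by (metis of_nat_1 of_nat_add of_nat_le_iff of_nat_mult)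
      also have "real (card T) \<le> rexp F' p0 T ?m"
      proof -
        have "rexp F' p0 T (\<lambda>_. real (card T)) \<le> rexp F' p0 T ?m"
        proof (rule rexp_mono)
          fix A assume "A \<subseteq> F'"
          then show "real (card T) \<le> ?m (reach A T)"
            using card_reach_ge[of F' T A] F' fT by simp
        qed (use F' p in auto)
        then show ?thesis using F' by simp
      qed
      finally show ?thesis by (simp add: mult_left_mono)
    qed
    have ab: "0 \<le> \<alpha>" "0 \<le> \<beta>" 
      using mge[of S] mge[of "insert y S"] p unfolding \<alpha>_def \<beta>_def ma_def mb_def by auto
    have g0: "rexp F p0 S f = p0 * a0 + (1 - p0) * b0" and g: "rexp F p S f = p * a + (1 - p) * b"
      and m: "rexp F p0 S ?m = p0 * ma + (1 - p0) * mb"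
      unfolding a0_def b0_def a_def b_def ma_def mb_def F'_def e_def 
      by (rule rexp_step[OF step.hyps(1,2,3)])+
    have sum: "p0 * \<alpha> + (1 - p0) * \<beta> + 1 / (p0 * (1 - p0)) = (D * rexp F p0 S ?m - card B) / (p0 * (1 - p0))"
      unfolding m \<alpha>_def \<beta>_def using p by (simp add: divide_simps) (simp add: algebra_simps)
    have Lk: "L + K * (p - p0)\<^sup>2 = K * (p - p0)\<^sup>2 * (D * N - real (card B))"
      by (simp add: L_def algebra_simps)
    note ts = tilt_step[of p0 p a0 b0 \<alpha> \<beta> da db, OF p(1-4) nn ab da(1) db(1) da(2) db(2) kp kq, unfolded Lk]
    show ?thesis
      unfolding g0 g sum[symmetric]
      by (rule exI[of _ "a0 - b0 + p0 * da + (1 - p0) * db"]) (use ts in auto)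
  qed
qed

end

section \<open>Exploration inequalities\<close>

text \<open>Moment generating function of one martingale increment. Centring removes the linear
  term, and \<open>exp t \<le> 1 + t + t\<^sup>2\<close> for \<bar>t\<bar> \<le> 1 leaves
  \<open>p * (1 - p) * u\<^sup>2\<close>, at most \<open>(l * X)\<^sup>2\<close>.\<close>

lemma exp_two_point:
  fixes p l a b X :: real
  assumes "0 \<le> p" "p \<le> 1" "0 \<le> l" "0 \<le> a - b" "a - b \<le> X" "l * X \<le> 1"
  shows "p * exp (l * a) + (1 - p) * exp (l * b) \<le> exp (l * (p * a + (1 - p) * b) + l\<^sup>2 * X\<^sup>2)"
proof -
  define u where "u = l * (a - b)"
  have u: "0 \<le> u" "u \<le> l * X" "u \<le> 1" using assms unfolding u_def
    by (auto simp: mult_left_mono intro: order_trans[OF mult_left_mono])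
  have quad: "exp t \<le> 1 + t + t\<^sup>2" if "\<bar>t\<bar> \<le> 1" for t :: real
  proof (cases "t \<ge> 0")
    case True
    then show ?thesis using exp_bound[of t] that by simp
  next
    case False
    define s where "s = - t"
    have s: "0 \<le> s" "s \<le> 1" using False that by (auto simp: s_def)
    have "1 \<le> (1 + s + s\<^sup>2 / 2) * (1 - s + s\<^sup>2)"
    proof -
      have "(1 + s + s\<^sup>2 / 2) * (1 - s + s\<^sup>2) = 1 + s\<^sup>2 / 2 + s ^ 3 / 2 + s ^ 4 / 2"
        by (simp add: power2_eq_square power3_eq_cube power4_eq_xxxx field_simps)
      then show ?thesis using s by simp
    qed
    also have "\<dots> \<le> exp s * (1 - s + s\<^sup>2)"
      using s exp_lower_Taylor_quadratic[of s] by (intro mult_right_mono) (auto simp: add_nonneg_nonneg)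
    finally have "exp (- s) \<le> 1 - s + s\<^sup>2" by (simp add: exp_minus field_simps)
    then show ?thesis by (simp add: s_def)
  qed
  have "(1 - p) * u \<le> 1" "p * u \<le> 1" using assms u by (auto intro: mult_le_one)
  then have b: "\<bar>(1 - p) * u\<bar> \<le> 1" "\<bar>- p * u\<bar> \<le> 1" using assms u by (auto simp: abs_mult)
  have "p * exp ((1 - p) * u) + (1 - p) * exp (- p * u) \<le>
     p * (1 + (1 - p) * u + ((1 - p) * u)\<^sup>2) + (1 - p) * (1 + - p * u + (- p * u)\<^sup>2)"
    using assms b by (intro add_mono mult_left_mono quad) auto
  also have "\<dots> = 1 + p * (1 - p) * u\<^sup>2" by (simp add: power2_eq_square algebra_simps)
  also have "\<dots> \<le> 1 + 1 * u\<^sup>2" using assms by (intro add_left_mono mult_right_mono) (auto intro: mult_le_one)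
  also have "\<dots> \<le> 1 + (l * X)\<^sup>2" using u by (simp add: power_mono)
  also have "\<dots> \<le> exp ((l * X)\<^sup>2)" by (rule exp_ge_add_one_self)
  finally have "(p * exp ((1 - p) * u) + (1 - p) * exp (- p * u)) * exp (l * (p * a + (1 - p) * b))
      \<le> exp ((l * X)\<^sup>2) * exp (l * (p * a + (1 - p) * b))" by (rule mult_right_mono) simp
  also have "exp ((l * X)\<^sup>2) * exp (l * (p * a + (1 - p) * b)) = exp (l * (p * a + (1 - p) * b) + l\<^sup>2 * X\<^sup>2)"
    by (simp add: exp_add power_mult_distrib)
  also have "(p * exp ((1 - p) * u) + (1 - p) * exp (- p * u)) * exp (l * (p * a + (1 - p) * b))
    = p * (exp ((1 - p) * u) * exp (l * (p * a + (1 - p) * b))) + (1 - p) * (exp (- p * u) * exp (l * (p * a + (1 - p) * b)))"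
    by (simp add: algebra_simps)
  also have "exp ((1 - p) * u) * exp (l * (p * a + (1 - p) * b)) = exp (l * a)"
    unfolding exp_add[symmetric] u_def by (simp add: algebra_simps)
  also have "exp (- p * u) * exp (l * (p * a + (1 - p) * b)) = exp (l * b)"
    unfolding exp_add[symmetric] u_def by (simp add: algebra_simps)
  finally show ?thesis .
qed

text \<open>
  Exploring from \<open>Z\<close> outside \<open>S\<close> first leaves the edges that connect \<open>x\<close> to the boundary of \<open>S\<close> fresh, so
  the BK inequality is not needed.
\<close>

lemma last_exit:
  assumes "finite F" "S \<inter> Z = {}" "x \<in> S" "0 \<le> p" "p \<le> 1"
    and "\<And>y. y \<in> S \<Longrightarrow> rexp F p {x} (\<lambda>K. of_bool (y \<in> K)) \<le> \<tau> y"
  shows "rexp F p Z (\<lambda>K. of_bool (x \<in> K)) \<le>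
    (\<Sum>(y, y')\<in>{(y, y'). y \<in> S \<and> y' \<notin> S \<and> {y, y'} \<in> F}.
       p * \<tau> y * rexp {e \<in> F. e \<inter> S = {}} p Z (\<lambda>K. of_bool (y' \<in> K)))"
  using assms(1,2,6)
proof (induction F Z rule: explore_induct)
  case (terminal F Z)
  note 1 = terminal
  have "rexp F p Z (\<lambda>K. of_bool (x \<in> K)) = of_bool (x \<in> Z)"
    using 1 by (intro rexp_terminal) auto
  also have "\<dots> = 0" using assms 1 by auto
  also have "0 \<le> (\<Sum>(y, y')\<in>{(y, y'). y \<in> S \<and> y' \<notin> S \<and> {y, y'} \<in> F}.
       p * \<tau> y * rexp {e \<in> F. e \<inter> S = {}} p Z (\<lambda>K. of_bool (y' \<in> K)))"
  proof (rule sum_nonneg, clarify)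
    fix y y' assume "y \<in> S"
    then have "rexp F p {x} (\<lambda>K. of_bool (y \<in> K)) \<le> \<tau> y" using 1 by auto
    moreover have "0 \<le> rexp F p {x} (\<lambda>K. of_bool (y \<in> K))" using 1 assms by (intro rexp_nonneg) auto
    ultimately have "0 \<le> \<tau> y" by simp
    then show "0 \<le> p * \<tau> y * rexp {e \<in> F. e \<inter> S = {}} p Z (\<lambda>K. of_bool (y' \<in> K))"
      using 1 assms by (intro mult_nonneg_nonneg rexp_nonneg) auto
  qed
  finally show ?case .
next
  case (step F Z z w)
  note 2 = step
  define e where "e = {z, w}"
  define F' where "F' = F - {e}"
  have F': "finite F'" "F = insert e F'" "e \<notin> F'" using 2 by (auto simp: F'_def e_def)
  have zS: "z \<notin> S" using 2 by auto
  have \<tau>F': "rexp F' p {x} (\<lambda>K. of_bool (y \<in> K)) \<le> \<tau> y" if "y \<in> S" for y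
  proof -
    have "rexp F' p {x} (\<lambda>K. of_bool (y \<in> K)) \<le> rexp F p {x} (\<lambda>K. of_bool (y \<in> K))"
      unfolding rexp_def using 2 assms F'
      by (intro pexp_mono_set) (auto dest!: reach_mono[of _ _ "{x}" "{x}"])
    also have "\<dots> \<le> \<tau> y" using 2 that by auto
    finally show ?thesis .
  qed
  define I where "I = (\<lambda>F. {(y, y'). y \<in> S \<and> y' \<notin> S \<and> {y, y'} \<in> F})"
  have finI: "finite (I F'')" if "finite F''" for F''
  proof (rule finite_imageD)
    show "inj_on (\<lambda>(y, y'). {y, y'}) (I F'')" unfolding I_def inj_on_def by (auto simp: doubleton_eq_iff)
    have "(\<lambda>(y, y'). {y, y'}) ` I F'' \<subseteq> F''" by (auto simp: I_def)
    then show "finite ((\<lambda>(y, y'). {y, y'}) ` I F'')" using that finite_subset by blast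
  qed
  have step: "rexp F p Z f = p * rexp F' p (insert w Z) f + (1 - p) * rexp F' p Z f" for f
    unfolding F'_def e_def by (rule rexp_step[OF 2(1,2,3)])
  show ?case
  proof (cases "w \<in> S")
    case False
    \<comment> \<open>The edge stays outside \<open>S\<close>, so it is among the edges that the
      right-hand side explores as well; both sides split in the same way.\<close>
    define H where "H = {e \<in> F. e \<inter> S = {}}"
    have H: "finite H" "{z, w} \<in> H" "H - {{z, w}} = {e \<in> F'. e \<inter> S = {}}"
      using 2 False zS unfolding H_def F'_def e_def by auto
    have "{y, y'} \<noteq> e" if "y \<in> S" for y y' using that False zS by (auto simp: e_def doubleton_eq_iff)
    then have IF: "I F = I F'" using F' by (auto simp: I_def)
    have ih1: "rexp F' p (insert w Z) (\<lambda>K. of_bool (x \<in> K)) \<le>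
      (\<Sum>(y, y')\<in>I F'. p * \<tau> y * rexp (H - {{z, w}}) p (insert w Z) (\<lambda>K. of_bool (y' \<in> K)))"
      unfolding H(3) I_def using 2(5)[folded e_def, folded F'_def] 2(7) False \<tau>F' by auto
    have ih2: "rexp F' p Z (\<lambda>K. of_bool (x \<in> K)) \<le>
      (\<Sum>(y, y')\<in>I F'. p * \<tau> y * rexp (H - {{z, w}}) p Z (\<lambda>K. of_bool (y' \<in> K)))"
      unfolding H(3) I_def using 2(6)[folded e_def, folded F'_def] 2(7) False \<tau>F' by auto
    have "rexp F p Z (\<lambda>K. of_bool (x \<in> K)) \<le>
       p * (\<Sum>(y, y')\<in>I F'. p * \<tau> y * rexp (H - {{z, w}}) p (insert w Z) (\<lambda>K. of_bool (y' \<in> K))) +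
       (1 - p) * (\<Sum>(y, y')\<in>I F'. p * \<tau> y * rexp (H - {{z, w}}) p Z (\<lambda>K. of_bool (y' \<in> K)))"
      unfolding step using ih1 ih2 assms by (intro add_mono mult_left_mono) auto
    also have "\<dots> = (\<Sum>(y, y')\<in>I F'. p * \<tau> y * rexp H p Z (\<lambda>K. of_bool (y' \<in> K)))"
      unfolding rexp_step[OF H(1,2) 2(3)] sum_distrib_left sum.distrib[symmetric]
      by (intro sum.cong) (auto simp: algebra_simps)
    finally show ?thesis unfolding IF[symmetric] unfolding I_def H_def .
  next
    case True
    \<comment> \<open>The edge enters \<open>S\<close> at \<open>w\<close>. If it is open, a
      connection from \<open>x\<close> to \<open>w\<close> through the remaining edges is charged to
      the new pair \<open>(w, z)\<close>, whose last factor is 1 because \<open>z\<close> is already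
      explored.\<close>
    have IF: "I F = insert (w, z) (I F')" using F' True zS
      by (auto simp: I_def e_def doubleton_eq_iff insert_commute)
    have notin: "(w, z) \<notin> I F'" using F' by (auto simp: I_def e_def insert_commute)
    have HF: "{e \<in> F. e \<inter> S = {}} = {e \<in> F'. e \<inter> S = {}}" using F' True by (auto simp: e_def)
    have \<tau>: "0 \<le> \<tau> w" 
    proof -
      have "0 \<le> rexp F' p {x} (\<lambda>K. of_bool (w \<in> K))" using F' assms by (intro rexp_nonneg) auto
      with \<tau>F'[OF True] show ?thesis by simp
    qed
    have one: "rexp {e \<in> F'. e \<inter> S = {}} p Z (\<lambda>K. of_bool (z \<in> K)) = 1"
    proof -
      have "rexp {e \<in> F'. e \<inter> S = {}} p Z (\<lambda>K. of_bool (z \<in> K)) = rexp {e \<in> F'. e \<inter> S = {}} p Z (\<lambda>K. 1)"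
        unfolding rexp_def
      proof (rule pexp_cong)
        fix A show "of_bool (z \<in> reach A Z) = (1::real)" using 2(3) reach_superset[of Z A] by auto
      qed simp
      then show ?thesis using F' by simp
    qed
    have ih2: "rexp F' p Z (\<lambda>K. of_bool (x \<in> K)) \<le>
      (\<Sum>(y, y')\<in>I F'. p * \<tau> y * rexp {e \<in> F'. e \<inter> S = {}} p Z (\<lambda>K. of_bool (y' \<in> K)))"
      unfolding I_def using 2(6)[folded e_def, folded F'_def] 2(7) \<tau>F' by auto
    have "rexp F' p (insert w Z) (\<lambda>K. of_bool (x \<in> K)) \<le>
        rexp F' p {w} (\<lambda>K. of_bool (x \<in> K)) + rexp F' p Z (\<lambda>K. of_bool (x \<in> K))"
      unfolding rexp_def pexp_add[symmetric] using F' assms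
      by (intro pexp_mono) (auto simp: reach_insert[of _ w Z])
    also have "rexp F' p {w} (\<lambda>K. of_bool (x \<in> K)) = rexp F' p {x} (\<lambda>K. of_bool (w \<in> K))"
      unfolding rexp_def by (intro pexp_cong) (auto simp: reach_sym)
    also have "\<dots> \<le> \<tau> w" by (rule \<tau>F'[OF True])
    finally have "rexp F p Z (\<lambda>K. of_bool (x \<in> K)) \<le>
       p * (\<tau> w + rexp F' p Z (\<lambda>K. of_bool (x \<in> K))) + (1 - p) * rexp F' p Z (\<lambda>K. of_bool (x \<in> K))"
      unfolding step using assms by (intro add_mono mult_left_mono) auto
    also have "\<dots> = p * \<tau> w + rexp F' p Z (\<lambda>K. of_bool (x \<in> K))" by (simp add: algebra_simps)
    also have "\<dots> \<le> p * \<tau> w * rexp {e \<in> F'. e \<inter> S = {}} p Z (\<lambda>K. of_bool (z \<in> K)) +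
        (\<Sum>(y, y')\<in>I F'. p * \<tau> y * rexp {e \<in> F'. e \<inter> S = {}} p Z (\<lambda>K. of_bool (y' \<in> K)))"
      unfolding one using ih2 by simp
    also have "\<dots> = (\<Sum>(y, y')\<in>I F. p * \<tau> y * rexp {e \<in> F'. e \<inter> S = {}} p Z (\<lambda>K. of_bool (y' \<in> K)))"
      unfolding IF using notin finI F' by simp
    finally show ?thesis unfolding I_def HF .
  qed
qed

text \<open>
  In the proof \<open>B\<close> collects the edges that were found closed. Adding to the derivative the conditional
  expected gain from opening the edges of \<open>B\<close>, divided by \<open>1 - p\<close>, gives a martingale of the exploration,
  so only terminal states have to be compared with \<open>h\<close>.
\<close>

lemma russo_lower:
  assumes "finite EN" "0 < p" "p < 1"
    and terminal: "\<And>F S. F \<subseteq> EN \<Longrightarrow> (\<And>x y. x \<in> S \<Longrightarrow> {x, y} \<in> F \<Longrightarrow> y \<in> S) \<Longrightarrow>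
      (\<And>e. e \<in> EN \<Longrightarrow> e \<inter> S = {} \<Longrightarrow> e \<in> F) \<Longrightarrow> (\<exists>A\<subseteq>EN. S = reach A S0) \<Longrightarrow>
      (1 - p) * h S \<le> (\<Sum>(x, y)\<in>{(x, y). x \<in> S \<and> y \<notin> S \<and> {x, y} \<in> EN}. rexp F p (insert y S) f - f S)"
  shows "\<exists>d. ((\<lambda>t. rexp EN t S0 f) has_real_derivative d) (at p) \<and> rexp EN p S0 h \<le> d"
proof -
  \<comment> \<open>\<open>B\<close> may keep pairs whose second vertex has joined \<open>S\<close>
    in the meantime; for them the two expectations agree and the summand is 0. The last conjunct
    records that \<open>S\<close> is reached through edges inside it, which yields the reachability
    hypothesis on terminal states.\<close>
  define inv where "inv = (\<lambda>F S B. F \<subseteq> EN \<and> finite B \<and> (\<forall>(x, y)\<in>B. x \<in> S \<and> {x, y} \<in> EN \<and> {x, y} \<notin> F) \<and>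
     (\<forall>e\<in>EN - F. e \<inter> S \<noteq> {}) \<and> (\<forall>x\<in>S. \<forall>y. y \<notin> S \<longrightarrow> {x, y} \<in> EN - F \<longrightarrow> (x, y) \<in> B) \<and>
     (\<exists>A\<subseteq>EN. A \<subseteq> Pow S \<and> S = reach A S0))"
  have "\<exists>d. ((\<lambda>t. rexp F t S f) has_real_derivative d) (at p) \<and>
      rexp F p S h \<le> d + (\<Sum>(x, y)\<in>B. rexp F p (insert y S) f - rexp F p S f) / (1 - p)"
    if "finite F" "inv F S B" for F S B
    using that
  proof (induction F S arbitrary: B rule: explore_induct)
    case (terminal F S)
    have r: "rexp F t S g = g S" for t and g :: "'a set \<Rightarrow> real"
      using terminal by (intro rexp_terminal) auto
    define J where "J = {(x, y). x \<in> S \<and> y \<notin> S \<and> {x, y} \<in> EN}"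
    have i: "F \<subseteq> EN" "\<forall>e\<in>EN - F. e \<inter> S \<noteq> {}" "\<exists>A\<subseteq>EN. S = reach A S0" "finite B"
      "\<forall>x\<in>S. \<forall>y. y \<notin> S \<longrightarrow> {x, y} \<in> EN - F \<longrightarrow> (x, y) \<in> B" "\<forall>(x, y)\<in>B. x \<in> S \<and> {x, y} \<in> EN"
      using terminal.prems unfolding inv_def by blast+
    have "J \<subseteq> B" using i(5) terminal.hyps(2) unfolding J_def by blast
    have "(1 - p) * h S \<le> (\<Sum>(x, y)\<in>J. rexp F p (insert y S) f - f S)"
      unfolding J_def by (rule assms(4)[OF i(1) terminal.hyps(2)]) (use i in auto)
    also have "\<dots> = (\<Sum>(x, y)\<in>B. rexp F p (insert y S) f - f S)"
    proof (rule sum.mono_neutral_left)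
      show "finite B" "J \<subseteq> B" by (rule i(4), rule \<open>J \<subseteq> B\<close>)
      show "\<forall>i\<in>B - J. (case i of (x, y) \<Rightarrow> rexp F p (insert y S) f - f S) = 0"
        using i(6) r by (auto simp: J_def insert_absorb)
    qed
    finally have "h S \<le> (\<Sum>(x, y)\<in>B. rexp F p (insert y S) f - f S) / (1 - p)"
      using assms by (simp add: field_simps)
    then show ?case unfolding r by (intro exI[of _ 0]) auto
  next
    case (step F S x0 y0)
    define e where "e = {x0, y0}"
    define F' where "F' = F - {e}"
    have F': "finite F'" "F = insert e F'" "e \<notin> F'" using step by (auto simp: F'_def e_def)
        have i: "F \<subseteq> EN" "\<forall>e\<in>EN - F. e \<inter> S \<noteq> {}" "\<exists>A\<subseteq>EN. A \<subseteq> Pow S \<and> S = reach A S0" "finite B"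
      "\<forall>x\<in>S. \<forall>y. y \<notin> S \<longrightarrow> {x, y} \<in> EN - F \<longrightarrow> (x, y) \<in> B"
      "\<forall>(x, y)\<in>B. x \<in> S \<and> {x, y} \<in> EN \<and> {x, y} \<notin> F"
      using step.prems unfolding inv_def by blast+
    obtain A where A: "A \<subseteq> EN" "A \<subseteq> Pow S" "S = reach A S0" using i(3) by blast
    have stepF: "rexp F t T g = t * rexp F' t (insert y0 T) g + (1 - t) * rexp F' t T g"
      if "x0 \<in> T" for t T and g :: "'a set \<Rightarrow> real"
      unfolding F'_def e_def using step that by (intro rexp_step) auto
    have nB: "(x0, y0) \<notin> B" using i(6) step.hyps by auto
    have inv1: "inv F' (insert y0 S) B"
    proof -
      have "insert y0 S = reach (insert e A) S0"
      proof
        have x0: "x0 \<in> reach (insert e A) S0"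
          using A(3) step.hyps reach_mono[of A "insert e A" S0 S0] by auto
        then have "y0 \<in> reach (insert e A) S0" by (rule reach_closed) (simp add: e_def)
        then show "insert y0 S \<subseteq> reach (insert e A) S0"
          using A(3) reach_mono[of A "insert e A" S0 S0] by auto
        show "reach (insert e A) S0 \<subseteq> insert y0 S"
        proof (rule reach_least)
          show "S0 \<subseteq> insert y0 S" using A(3) reach_superset[of S0 A] by auto
          show "y \<in> insert y0 S" if "x \<in> insert y0 S" "{x, y} \<in> insert e A" for x y
            using that A(2) step.hyps(3) by (auto simp: e_def doubleton_eq_iff)
        qed
      qed
      moreover have "insert e A \<subseteq> EN" "insert e A \<subseteq> Pow (insert y0 S)"
        using A step.hyps i(1) by (auto simp: e_def)
      ultimately have ex: "\<exists>A\<subseteq>EN. A \<subseteq> Pow (insert y0 S) \<and> insert y0 S = reach A S0" by blast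
      have "(x, y) \<in> B" if "x \<in> insert y0 S" "y \<notin> insert y0 S" "{x, y} \<in> EN - F'" for x y
      proof -
        have "{x, y} \<noteq> e" using that step.hyps(3,4) by (auto simp: e_def doubleton_eq_iff)
        then have nF: "{x, y} \<in> EN - F" using that F' by auto
        have "{x, y} \<inter> S \<noteq> {}" using nF i(2) by blast
        then have "x \<in> S" using that by auto
        then show ?thesis using nF that i(5) by auto
      qed
      moreover have "d \<inter> insert y0 S \<noteq> {}" if "d \<in> EN - F'" for d
        using that F' i(2) by (auto simp: e_def)
      moreover have "\<forall>(x, y)\<in>B. x \<in> insert y0 S \<and> {x, y} \<in> EN \<and> {x, y} \<notin> F'" using i(6) F' by auto
      moreover have "F' \<subseteq> EN" using i(1) F' by auto
      ultimately show ?thesis using i(4) ex unfolding inv_def by simp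
    qed
    have inv2: "inv F' S (insert (x0, y0) B)"
    proof -
      have "(x, y) \<in> insert (x0, y0) B" if "x \<in> S" "y \<notin> S" "{x, y} \<in> EN - F'" for x y
      proof (cases "{x, y} = e")
        case True
        then show ?thesis using that step.hyps by (auto simp: e_def doubleton_eq_iff)
      next
        case False
        then have nF: "{x, y} \<in> EN - F" using that F' by auto
        then show ?thesis using that i(5) by auto
      qed
      moreover have "d \<inter> S \<noteq> {}" if "d \<in> EN - F'" for d
        using that F' i(2) step.hyps by (auto simp: e_def)
      moreover have "\<forall>(x, y)\<in>insert (x0, y0) B. x \<in> S \<and> {x, y} \<in> EN \<and> {x, y} \<notin> F'"
        using i(1,6) F' step.hyps by (auto simp: e_def)
      moreover have "F' \<subseteq> EN" using i(1) F' by auto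
      ultimately show ?thesis using i(3,4) unfolding inv_def by simp
    qed
    obtain d1 where d1: "((\<lambda>t. rexp F' t (insert y0 S) f) has_real_derivative d1) (at p)"
      "rexp F' p (insert y0 S) h \<le> d1 + (\<Sum>(x, y)\<in>B. rexp F' p (insert y (insert y0 S)) f - rexp F' p (insert y0 S) f) / (1 - p)"
      using step.IH(1)[folded e_def, folded F'_def, OF inv1] by blast
    obtain d2 where d2: "((\<lambda>t. rexp F' t S f) has_real_derivative d2) (at p)"
      "rexp F' p S h \<le> d2 + (\<Sum>(x, y)\<in>insert (x0, y0) B. rexp F' p (insert y S) f - rexp F' p S f) / (1 - p)"
      using step.IH(2)[folded e_def, folded F'_def, OF inv2] by blast
    define g where "g = rexp F' p (insert y0 S) f - rexp F' p S f"
    define s1 where "s1 = (\<Sum>(x, y)\<in>B. rexp F' p (insert y (insert y0 S)) f - rexp F' p (insert y0 S) f)"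
    define s2 where "s2 = (\<Sum>(x, y)\<in>B. rexp F' p (insert y S) f - rexp F' p S f)"
    have "(\<Sum>(x, y)\<in>B. rexp F p (insert y S) f - rexp F p S f) = p * s1 + (1 - p) * s2"
      unfolding s1_def s2_def sum_distrib_left sum.distrib[symmetric]
      using step.hyps by (intro sum.cong refl) (auto simp: stepF insert_commute algebra_simps)
    moreover have "(\<Sum>(x, y)\<in>insert (x0, y0) B. rexp F' p (insert y S) f - rexp F' p S f) = g + s2"
      using nB i(4) by (simp add: g_def s2_def)
    moreover have "((\<lambda>t. rexp F t S f) has_real_derivative (g + p * d1 + (1 - p) * d2)) (at p)"
      unfolding stepF[OF step.hyps(3)] g_def
      by (auto intro!: derivative_eq_intros d1(1) d2(1) simp: algebra_simps)
    \<comment> \<open>The factor \<open>1 / (1 - p)\<close> balances here: the derivative gains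
      \<open>g\<close> once, and the pair added in the closed branch, of probability
      \<open>1 - p\<close>, contributes \<open>g / (1 - p)\<close>.\<close>
    moreover have "rexp F p S h \<le> (g + p * d1 + (1 - p) * d2) + (p * s1 + (1 - p) * s2) / (1 - p)"
    proof -
      have "rexp F p S h \<le> p * (d1 + s1 / (1 - p)) + (1 - p) * (d2 + (g + s2) / (1 - p))"
        unfolding stepF[OF step.hyps(3)] using d1(2) d2(2) assms calculation(2)
        by (intro add_mono mult_left_mono) (auto simp: s1_def)
      also have "\<dots> = (g + p * d1 + (1 - p) * d2) + (p * s1 + (1 - p) * s2) / (1 - p)"
      proof -
        define r where "r = 1 - p"
        have "r \<noteq> 0" using assms(3) by (simp add: r_def)
        then show ?thesis unfolding r_def[symmetric] by (simp add: field_simps)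
      qed
      finally show ?thesis .
    qed
    ultimately show ?case by auto
  qed
  from this[of EN S0 "{}"] have "\<exists>d. ((\<lambda>t. rexp EN t S0 f) has_real_derivative d) (at p) \<and> rexp EN p S0 h \<le> d"
    using assms(1) by (auto simp: inv_def intro!: exI[of _ "{}"] reach_eq_self[symmetric])
  then show ?thesis .
qed

context bounded_degree
begin

text \<open>
  The conditional expectation of \<open>|K|\<close> is a martingale of the exploration with increments at most \<open>X\<close>,
  and at most \<open>D |K|\<close> edges are explored.
\<close>

lemma exp_moment_explore:
  assumes "finite F" "F \<subseteq> E" "finite S"
    and "B \<subseteq> E" "F \<inter> B = {}" "\<And>e. e \<in> B \<Longrightarrow> e \<inter> S \<noteq> {}"
    and p: "0 \<le> p" "p \<le> 1" and l: "0 \<le> l" "l * X \<le> 1"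
    and X: "\<And>y. rexp F p {y} (\<lambda>K. real (card K)) \<le> X"
  shows "rexp F p S (\<lambda>K. exp ((l - l\<^sup>2 * X\<^sup>2 * D) * card K)) \<le>
    exp (l * rexp F p S (\<lambda>K. real (card K)) - l\<^sup>2 * X\<^sup>2 * card B)"
  using assms(1-6,11)
proof (induction F S arbitrary: B rule: explore_induct)
  case (terminal F S)
  have [simp]: "rexp F p S g = g S" for g :: "'a set \<Rightarrow> real"
    using terminal by (intro rexp_terminal) auto
  \<comment> \<open>Each revealed edge has cost \<open>l\<^sup>2 * X\<^sup>2\<close>; there are at
    most \<open>D * card S\<close> of them, hence the reduced exponent in the claim.\<close>
  have "card B \<le> D * card S" using terminal by (intro card_touching_le) auto
  then have "real (card B) \<le> D * real (card S)" by (metis of_nat_le_iff of_nat_mult)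
  then have "l\<^sup>2 * X\<^sup>2 * card B \<le> l\<^sup>2 * X\<^sup>2 * (D * real (card S))" by (intro mult_left_mono) auto
  then show ?case by (simp add: algebra_simps)
next
  case (step F S x y)
  define e where "e = {x, y}"
  define F' where "F' = F - {e}"
  have F': "finite F'" "F' \<subseteq> E" "F' \<subseteq> F" using step.hyps step.prems F'_def by auto
  have fin: "finite S" "finite (insert y S)" using step.prems by auto
  have eB: "e \<notin> B" using step.hyps step.prems e_def by auto
  have cB: "card (insert e B) = card B + 1"
    using card_touching_le(1)[of S B] step.prems eB by simp
  have prem: "insert e B \<subseteq> E" "F' \<inter> insert e B = {}"
    "\<And>d. d \<in> insert e B \<Longrightarrow> d \<inter> insert y S \<noteq> {}" "\<And>d. d \<in> insert e B \<Longrightarrow> d \<inter> S \<noteq> {}"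
    using step.hyps step.prems e_def F'_def by auto
  let ?c = "\<lambda>K :: 'a set. real (card K)"
  have X': "rexp F' p {z} ?c \<le> X" for z
  proof -
    have "rexp F' p {z} ?c \<le> rexp F p {z} ?c"
      unfolding rexp_def
    proof (rule pexp_mono_set)
      fix A B assume "A \<subseteq> B" "B \<subseteq> F"
      then show "?c (reach A {z}) \<le> ?c (reach B {z})"
        using card_reach_mono[of F "{z}" B A "{z}"] step.hyps step.prems by auto
    qed (use step.hyps F' p in auto)
    also have "\<dots> \<le> X" using step.prems by auto
    finally show ?thesis .
  qed
  define a where "a = rexp F' p (insert y S) ?c"
  define b where "b = rexp F' p S ?c"
  let ?g = "\<lambda>K :: 'a set. exp ((l - l\<^sup>2 * X\<^sup>2 * D) * card K)"
  have ih1: "rexp F' p (insert y S) ?g \<le> exp (l * a - l\<^sup>2 * X\<^sup>2 * real (card B + 1))"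
    using step.IH(1)[folded e_def, folded F'_def, OF F'(2) fin(2) prem(1,2) prem(3) X', folded a_def, unfolded cB] .
  have ih2: "rexp F' p S ?g \<le> exp (l * b - l\<^sup>2 * X\<^sup>2 * real (card B + 1))"
    using step.IH(2)[folded e_def, folded F'_def, OF F'(2) fin(1) prem(1,2) prem(4) X', folded b_def, unfolded cB] .
  have "b \<le> a" unfolding a_def b_def rexp_def using F' p fin
    by (intro pexp_mono) (auto intro!: card_reach_mono[of F'])
  \<comment> \<open>A new vertex adds at most its own cluster in the unknown edges, so the increment
    \<open>a - b\<close> is at most \<open>X\<close>.\<close>
  have "a \<le> b + rexp F' p {y} ?c"
    unfolding a_def b_def rexp_def pexp_add[symmetric]
  proof (rule pexp_mono)
    fix A assume "A \<subseteq> F'"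
    have "card (reach A (insert y S)) \<le> card (reach A {y}) + card (reach A S)"
      unfolding reach_insert[of A y S] by (rule card_Un_le)
    then show "?c (reach A (insert y S)) \<le> ?c (reach A S) + ?c (reach A {y})" by simp
  qed (use F' p in auto)
  then have "a - b \<le> X" using X'[of y] by simp
  have stepF: "rexp F p S g = p * rexp F' p (insert y S) g + (1 - p) * rexp F' p S g" for g
    unfolding F'_def e_def by (rule rexp_step[OF step.hyps(1,2,3)])
  have "rexp F p S ?g \<le> p * exp (l * a - l\<^sup>2 * X\<^sup>2 * real (card B + 1)) + (1 - p) * exp (l * b - l\<^sup>2 * X\<^sup>2 * real (card B + 1))"
    unfolding stepF using ih1 ih2 p by (intro add_mono mult_left_mono) auto
  also have "\<dots> = (p * exp (l * a) + (1 - p) * exp (l * b)) * exp (- (l\<^sup>2 * X\<^sup>2 * real (card B + 1)))"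
    by (simp only: exp_diff exp_minus divide_inverse distrib_right mult.assoc)
  also have "\<dots> \<le> exp (l * (p * a + (1 - p) * b) + l\<^sup>2 * X\<^sup>2) * exp (- (l\<^sup>2 * X\<^sup>2 * real (card B + 1)))"
    using p l \<open>b \<le> a\<close> \<open>a - b \<le> X\<close> by (intro mult_right_mono exp_two_point) auto
  also have "\<dots> = exp (l * rexp F p S ?c - l\<^sup>2 * X\<^sup>2 * card B)"
    unfolding stepF[of ?c] a_def b_def exp_add[symmetric] by (simp add: algebra_simps)
  finally show ?case .
qed

end

section \<open>The survival estimate above criticality\<close>

lemma finite_crossing_pairs:
  assumes "finite C"
  shows "finite {(x, y). x \<in> S \<and> y \<notin> S \<and> {x, y} \<in> C}"
    and "card {(x, y). x \<in> S \<and> y \<notin> S \<and> {x, y} \<in> C} \<le> card C"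
proof -
  let ?I = "{(x, y). x \<in> S \<and> y \<notin> S \<and> {x, y} \<in> C}"
  have inj: "inj_on (\<lambda>(y, y'). {y, y'}) ?I" unfolding inj_on_def by (auto simp: doubleton_eq_iff)
  have sub: "(\<lambda>(y, y'). {y, y'}) ` ?I \<subseteq> C" by auto
  show "finite ?I" using inj sub assms by (meson finite_imageD finite_subset)
  show "card ?I \<le> card C" using inj sub assms by (metis (no_types, lifting) card_image card_mono)
qed

context bounded_degree
begin

text \<open>
  The cluster at \<open>p2\<close> is explored as follows: as long as possible, reveal edges at level \<open>p1\<close>; those that
  are closed at \<open>p1\<close> wait in \<open>R\<close> and are open at \<open>p2\<close> with conditional probability \<open>r\<close>. Once the \<open>p1\<close> phase
  stops, an edge of \<open>R\<close> leading to \<open>y\<close> is checked, and with probability at least \<open>r Q S y\<close> it lets the cluster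
  escape from \<open>W\<close>. \<open>C\<close> contains the finished edges and \<open>X\<close> the untouched ones. When the exploration stops
  at \<open>S\<close>, every boundary edge has been checked while the explored set was smaller, so the risks add up to
  at least \<open>r \<mu> |S|\<close>.
\<close>

lemma hazard:
  fixes Q :: "'a set \<Rightarrow> 'a \<Rightarrow> real" and p1 p2 r \<mu> :: real
  defines "G \<equiv> (\<lambda>S C. \<Sum>(x, y)\<in>{(x, y). x \<in> S \<and> y \<notin> S \<and> {x, y} \<in> C}. Q S y)"
  assumes W: "finite W" and par: "0 \<le> p1" "p1 \<le> 1" "0 \<le> r" "r \<le> 1" "p2 = p1 + (1 - p1) * r" "0 \<le> \<mu>"
    and Q01: "\<And>S y. 0 \<le> Q S y \<and> Q S y \<le> 1"
    and Qanti: "\<And>S T y. finite T \<Longrightarrow> S \<subseteq> T \<Longrightarrow> Q T y \<le> Q S y"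
    and Qexit: "\<And>S y. finite S \<Longrightarrow> y \<notin> S \<Longrightarrow>
      Q S y \<le> rexp {e \<in> E. e \<inter> W \<noteq> {} \<and> e \<inter> S = {}} p1 {y} (\<lambda>K. of_bool (\<not> K \<subseteq> W))"
    and Qsum: "\<And>S. finite S \<Longrightarrow> S \<subseteq> W \<Longrightarrow> S \<noteq> {} \<Longrightarrow>
      \<mu> * card S \<le> (\<Sum>(x, y)\<in>{(x, y). x \<in> S \<and> y \<notin> S \<and> {x, y} \<in> E}. Q S y)"
    and "finite S" "S \<noteq> {}" "X \<union> R \<union> C = {e \<in> E. e \<inter> W \<noteq> {}}" "X \<inter> R = {}" "(X \<union> R) \<inter> C = {}"
    and "\<And>e. e \<in> R \<union> C \<Longrightarrow> e \<inter> S \<noteq> {}"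
  shows "pexp (X \<union> R) (\<lambda>e. if e \<in> R then r else p2) (\<lambda>A. of_bool (reach A S \<subseteq> W \<and> n \<le> card (reach A S))) \<le>
    exp (r * G S C - r * \<mu> * n) * rexp X p1 S (\<lambda>K. of_bool (K \<subseteq> W))"
  using assms(13-18)
\<comment> \<open>An untouched edge may move to \<open>R\<close>, where it is revealed a second
  time; the factor 2 makes this move decrease the measure.\<close>
proof (induction "2 * card X + card R" arbitrary: X R C S rule: less_induct)
  case (less X R C S)
  define FW where "FW = {e \<in> E. e \<inter> W \<noteq> {}}"
  note XRC = less.prems(3)[folded FW_def]
  have finFW: "finite FW" unfolding FW_def by (rule finite_touching[OF W])
  have "X \<subseteq> FW" "R \<subseteq> FW" "C \<subseteq> FW" using XRC by blast+
  then have fin: "finite X" "finite R" "finite C" "finite (X \<union> R)"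
    using finite_subset[OF _ finFW] by auto
  have subE: "X \<subseteq> E" "R \<subseteq> E" "C \<subseteq> E" using XRC unfolding FW_def by blast+
  have p2: "0 \<le> p2" "p2 \<le> 1" using par mult_left_le[of r "1 - p1"] by auto
  let ?f = "\<lambda>K. of_bool (K \<subseteq> W \<and> n \<le> card K) :: real"
  define L where "L = (\<lambda>X R S. pexp (X \<union> R) (\<lambda>e. if e \<in> R then r else p2) (\<lambda>A. ?f (reach A S)))"
  \<comment> \<open>When \<open>y\<close> joins \<open>S\<close>, the pairs ending in
    \<open>y\<close> disappear and \<open>Q\<close> decreases with the set, so the accumulated risk
    cannot grow.\<close>
  have Gmono: "G (insert y S) (insert {x, y} C) \<le> G S C" if "x \<in> S" for x y
  proof -
    have sub: "{(a, b). a \<in> insert y S \<and> b \<notin> insert y S \<and> {a, b} \<in> insert {x, y} C} \<subseteq> {(a, b). a \<in> S \<and> b \<notin> S \<and> {a, b} \<in> C}"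
    proof (rule subsetI)
      fix z assume "z \<in> {(a, b). a \<in> insert y S \<and> b \<notin> insert y S \<and> {a, b} \<in> insert {x, y} C}"
      then obtain a b where z: "z = (a, b)" and ab: "a \<in> insert y S" "b \<notin> insert y S" "{a, b} \<in> insert {x, y} C" by blast
      then have "{a, b} \<in> C" using that by (auto simp: doubleton_eq_iff)
      moreover from this have "{a, b} \<inter> S \<noteq> {}" using less.prems(6) by blast
      ultimately show "z \<in> {(a, b). a \<in> S \<and> b \<notin> S \<and> {a, b} \<in> C}" using ab z by auto
    qed
    have "G (insert y S) (insert {x, y} C) \<le>
      (\<Sum>(a, b)\<in>{(a, b). a \<in> insert y S \<and> b \<notin> insert y S \<and> {a, b} \<in> insert {x, y} C}. Q S b)"
    proof -
      have "Q (insert y S) b \<le> Q S b" for b using less.prems(1) by (intro Qanti) auto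
      then show ?thesis unfolding G_def by (intro sum_mono) auto
    qed
    also have "\<dots> \<le> G S C"
      unfolding G_def by (intro sum_mono2 sub finite_crossing_pairs fin) (use Q01 in auto)
    finally show ?thesis .
  qed
  show ?case
  proof (cases "\<exists>x y. x \<in> S \<and> y \<notin> S \<and> {x, y} \<in> X")
    case True
    then obtain x y where xy: "x \<in> S" "y \<notin> S" "{x, y} \<in> X" by blast
    define e where "e = {x, y}"
    have e: "e \<in> X" "e \<notin> R" "e \<notin> C" using xy less.prems by (auto simp: e_def)
    have cX: "card X = Suc (card (X - {e}))" using e fin by (metis card_Suc_Diff1)
    have cR: "card (insert e R) = Suc (card R)" using e fin by simp
    have ih1: "L (X - {e}) R (insert y S) \<le> exp (r * G (insert y S) (insert e C) - r * \<mu> * n) *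
        rexp (X - {e}) p1 (insert y S) (\<lambda>K. of_bool (K \<subseteq> W))"
      unfolding L_def
    proof (rule less.hyps)
      show "d \<inter> insert y S \<noteq> {}" if "d \<in> R \<union> insert e C" for d
        using that less.prems(6)[of d] by (auto simp: e_def)
      show "X - {e} \<union> R \<union> insert e C = {e \<in> E. e \<inter> W \<noteq> {}}" using less.prems(3) e by auto
      show "2 * card (X - {e}) + card R < 2 * card X + card R" using cX by simp
    qed (use less.prems e in auto)
    have ih2: "L (X - {e}) (insert e R) S \<le> exp (r * G S C - r * \<mu> * n) *
        rexp (X - {e}) p1 S (\<lambda>K. of_bool (K \<subseteq> W))"
      unfolding L_def
    proof (rule less.hyps)
      show "d \<inter> S \<noteq> {}" if "d \<in> insert e R \<union> C" for d
        using that less.prems(6)[of d] xy by (auto simp: e_def)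
      show "X - {e} \<union> insert e R \<union> C = {e \<in> E. e \<inter> W \<noteq> {}}" using less.prems(3) e by auto
      show "2 * card (X - {e}) + card (insert e R) < 2 * card X + card R" using cX cR by simp
    qed (use less.prems e in auto)
    have XR: "X \<union> R - {e} = X - {e} \<union> R" "(X - {e}) \<union> insert e R - {e} = X - {e} \<union> R" "e \<in> X \<union> R"
      using e by auto
    have l1: "L X R S = p2 * L (X - {e}) R (insert y S) + (1 - p2) * L (X - {e}) R S"
      unfolding L_def using pexp_reach_step[of "X \<union> R" x y S "\<lambda>e. if e \<in> R then r else p2" ?f] fin xy e XR
      unfolding e_def by simp
    have cong: "pexp (X - {e} \<union> R) (\<lambda>d. if d \<in> insert e R then r else p2) g = pexp (X - {e} \<union> R) (\<lambda>d. if d \<in> R then r else p2) g" for g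
      using e by (intro pexp_cong) auto
    have l2: "L (X - {e}) (insert e R) S = r * L (X - {e}) R (insert y S) + (1 - r) * L (X - {e}) R S"
      unfolding L_def cong[symmetric]
      using pexp_reach_step[of "(X - {e}) \<union> insert e R" x y S "\<lambda>d. if d \<in> insert e R then r else p2" ?f] fin xy e XR
      unfolding e_def by simp
    \<comment> \<open>Two-stage sampling: since \<open>p2 = p1 + (1 - p1) * r\<close>, an edge is
      open at \<open>p2\<close> if it is open at \<open>p1\<close> or, failing that, in the later
      check.\<close>
    have "L X R S = p1 * L (X - {e}) R (insert y S) + (1 - p1) * L (X - {e}) (insert e R) S"
      unfolding l1 l2 par(5) by (simp add: algebra_simps)
    also have "\<dots> \<le> p1 * (exp (r * G (insert y S) (insert e C) - r * \<mu> * n) *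
        rexp (X - {e}) p1 (insert y S) (\<lambda>K. of_bool (K \<subseteq> W))) + (1 - p1) * (exp (r * G S C - r * \<mu> * n) *
        rexp (X - {e}) p1 S (\<lambda>K. of_bool (K \<subseteq> W)))"
      using ih1 ih2 par by (intro add_mono mult_left_mono) auto
    also have "\<dots> \<le> p1 * (exp (r * G S C - r * \<mu> * n) *
        rexp (X - {e}) p1 (insert y S) (\<lambda>K. of_bool (K \<subseteq> W))) + (1 - p1) * (exp (r * G S C - r * \<mu> * n) *
        rexp (X - {e}) p1 S (\<lambda>K. of_bool (K \<subseteq> W)))"
      using par fin Gmono[OF xy(1), of y] unfolding e_def
      by (intro add_mono mult_left_mono mult_right_mono rexp_nonneg) (auto intro!: mult_left_mono)
    also have "\<dots> = exp (r * G S C - r * \<mu> * n) * rexp X p1 S (\<lambda>K. of_bool (K \<subseteq> W))"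
      unfolding rexp_step[OF fin(1) xy(3,1)] e_def by (simp add: algebra_simps)
    finally show ?thesis unfolding L_def .
  next
    case noX: False
    show ?thesis
    proof (cases "S \<subseteq> W")
      case False
      have "pexp (X \<union> R) (\<lambda>e. if e \<in> R then r else p2) (\<lambda>A. ?f (reach A S)) = pexp (X \<union> R) (\<lambda>e. if e \<in> R then r else p2) (\<lambda>A. 0)"
      proof (rule pexp_cong)
        fix A show "?f (reach A S) = 0" using False reach_superset[of S A] by auto
      qed simp
      also have "\<dots> = 0" using fin by simp
      also have "0 \<le> exp (r * G S C - r * \<mu> * n) * rexp X p1 S (\<lambda>K. of_bool (K \<subseteq> W))"
        using fin par by (intro mult_nonneg_nonneg rexp_nonneg) auto
      finally show ?thesis .
    next
      case SW: True
      \<comment> \<open>The last factor of the claim tracks the \<open>p1\<close> phase in progress.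
        It is 1 when that phase has stopped inside \<open>W\<close>, and it falls to at most
        \<open>1 - Q S y\<close> when a successful check starts a new phase at
        \<open>y\<close>.\<close>
      have one: "rexp X p1 S (\<lambda>K. of_bool (K \<subseteq> W)) = 1"
        using noX SW fin by (subst rexp_terminal) auto
      show ?thesis
      proof (cases "\<exists>x y. x \<in> S \<and> y \<notin> S \<and> {x, y} \<in> R")
        case True
        then obtain x y where xy: "x \<in> S" "y \<notin> S" "{x, y} \<in> R" by blast
        define e where "e = {x, y}"
        have e: "e \<in> R" "e \<notin> X" "e \<notin> C" using xy less.prems by (auto simp: e_def)
        have cR: "card R = Suc (card (R - {e}))" using e fin by (metis card_Suc_Diff1)
        have ih1: "L X (R - {e}) (insert y S) \<le> exp (r * G (insert y S) (insert e C) - r * \<mu> * n) *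
            rexp X p1 (insert y S) (\<lambda>K. of_bool (K \<subseteq> W))"
          unfolding L_def
        proof (rule less.hyps)
          show "d \<inter> insert y S \<noteq> {}" if "d \<in> R - {e} \<union> insert e C" for d
            using that less.prems(6)[of d] by (auto simp: e_def)
          show "X \<union> (R - {e}) \<union> insert e C = {e \<in> E. e \<inter> W \<noteq> {}}" using less.prems(3) e by auto
          show "2 * card X + card (R - {e}) < 2 * card X + card R" using cR by simp
        qed (use less.prems e in auto)
        have ih2: "L X (R - {e}) S \<le> exp (r * G S (insert e C) - r * \<mu> * n) *
            rexp X p1 S (\<lambda>K. of_bool (K \<subseteq> W))"
          unfolding L_def
        proof (rule less.hyps)
          show "d \<inter> S \<noteq> {}" if "d \<in> R - {e} \<union> insert e C" for d
            using that less.prems(6)[of d] xy by (auto simp: e_def)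
          show "X \<union> (R - {e}) \<union> insert e C = {e \<in> E. e \<inter> W \<noteq> {}}" using less.prems(3) e by auto
          show "2 * card X + card (R - {e}) < 2 * card X + card R" using cR by simp
        qed (use less.prems e in auto)
        have XR: "X \<union> R - {e} = X \<union> (R - {e})" "e \<in> X \<union> R" using e by auto
        have cong: "pexp (X \<union> (R - {e})) (\<lambda>d. if d \<in> R then r else p2) g = pexp (X \<union> (R - {e})) (\<lambda>d. if d \<in> R - {e} then r else p2) g" for g
          using e by (intro pexp_cong) auto
        have l1: "L X R S = r * L X (R - {e}) (insert y S) + (1 - r) * L X (R - {e}) S"
          unfolding L_def cong[symmetric]
          using pexp_reach_step[of "X \<union> R" x y S "\<lambda>e. if e \<in> R then r else p2" ?f] fin xy e XR
          unfolding e_def by simp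
        define q where "q = Q S y"
        have q: "0 \<le> q" "q \<le> 1" using Q01 by (auto simp: q_def)
        have GS: "G S (insert e C) = G S C + q"
        proof -
          have "{(a, b). a \<in> S \<and> b \<notin> S \<and> {a, b} \<in> insert e C} = insert (x, y) {(a, b). a \<in> S \<and> b \<notin> S \<and> {a, b} \<in> C}"
            using xy by (auto simp: e_def doubleton_eq_iff)
          moreover have "(x, y) \<notin> {(a, b). a \<in> S \<and> b \<notin> S \<and> {a, b} \<in> C}" using e by (auto simp: e_def)
          ultimately show ?thesis unfolding G_def q_def using finite_crossing_pairs(1)[OF fin(3), of S] by simp
        qed
        have \<alpha>: "rexp X p1 (insert y S) (\<lambda>K. of_bool (K \<subseteq> W)) \<le> 1 - q"
        proof -
          have "q \<le> rexp {e \<in> E. e \<inter> W \<noteq> {} \<and> e \<inter> S = {}} p1 {y} (\<lambda>K. of_bool (\<not> K \<subseteq> W))"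
            unfolding q_def using less.prems(1) xy(2) by (rule Qexit)
          also have "\<dots> \<le> rexp X p1 {y} (\<lambda>K. of_bool (\<not> K \<subseteq> W))"
            unfolding rexp_def
          proof (rule pexp_mono_set)
            show "{e \<in> E. e \<inter> W \<noteq> {} \<and> e \<inter> S = {}} \<subseteq> X"
            proof clarify
              fix d assume "d \<in> E" "d \<inter> W \<noteq> {}" "d \<inter> S = {}"
              then have "d \<in> X \<union> R \<union> C" unfolding less.prems(3) by simp
              then show "d \<in> X" using less.prems(6)[of d] \<open>d \<inter> S = {}\<close> by blast
            qed
            show "of_bool (\<not> reach A {y} \<subseteq> W) \<le> (of_bool (\<not> reach B {y} \<subseteq> W) :: real)" if "A \<subseteq> B" for A B
              using reach_mono[OF that, of "{y}" "{y}"] by auto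
          qed (use par fin in auto)
          finally have "q \<le> rexp X p1 {y} (\<lambda>K. of_bool (\<not> K \<subseteq> W))" .
          moreover have "rexp X p1 (insert y S) (\<lambda>K. of_bool (K \<subseteq> W)) \<le> rexp X p1 {y} (\<lambda>K. 1 - of_bool (\<not> K \<subseteq> W))"
            unfolding rexp_def using fin par
            by (intro pexp_mono) (auto simp: reach_insert[of _ y S])
          ultimately show ?thesis unfolding rexp_diff using fin by simp
        qed
        define c where "c = exp (r * G S C - r * \<mu> * n)"
        have c: "c > 0" by (simp add: c_def)
        \<comment> \<open>An unsuccessful check raises the accumulated risk by \<open>q\<close>, a
          successful one leaves a factor \<open>1 - q\<close>. That their average is at most 1 is
          the supermartingale property behind the claim.\<close>
        have num: "r * (1 - q) + (1 - r) * exp (r * q) \<le> 1"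
        proof -
          have rq: "0 \<le> r * q" "r * q \<le> 1" "r * q \<le> r" using q par by (auto intro: mult_le_one mult_left_le)
          have "exp (r * q) \<le> 1 + r * q + (r * q)\<^sup>2" using rq by (intro exp_bound) auto
          then have "(1 - r) * exp (r * q) \<le> (1 - r) * (1 + r * q + (r * q)\<^sup>2)" using par by (intro mult_left_mono) auto
          moreover have "r * (1 - q) + (1 - r) * (1 + r * q + (r * q)\<^sup>2) = 1 - (r * q) * (r - r * q) - r * (r * q)\<^sup>2"
            by (simp add: power2_eq_square algebra_simps)
          moreover have "0 \<le> (r * q) * (r - r * q)" by (rule mult_nonneg_nonneg[OF rq(1)]) (use rq in simp)
          moreover have "0 \<le> r * (r * q)\<^sup>2" using par by simp
          ultimately show ?thesis by linarith
        qed
        have b1: "L X (R - {e}) (insert y S) \<le> c * (1 - q)"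
        proof -
          have "exp (r * G (insert y S) (insert e C) - r * \<mu> * n) \<le> c"
            unfolding c_def using Gmono[OF xy(1), of y] par unfolding e_def by (auto intro: mult_left_mono)
          then show ?thesis using ih1 \<alpha> c fin par
            by (elim order_trans) (intro mult_mono rexp_nonneg; auto)
        qed
        have b2: "L X (R - {e}) S \<le> c * exp (r * q)"
          using ih2 unfolding one GS c_def exp_add[symmetric] by (simp add: algebra_simps)
        have "L X R S \<le> r * (c * (1 - q)) + (1 - r) * (c * exp (r * q))"
          unfolding l1 using b1 b2 par by (intro add_mono mult_left_mono) auto
        also have "\<dots> = c * (r * (1 - q) + (1 - r) * exp (r * q))" by (simp add: algebra_simps)
        also have "\<dots> \<le> c * 1" using num c by (intro mult_left_mono) auto
        finally show ?thesis unfolding one L_def c_def by simp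
      next
        case noR: False
        have "pexp (X \<union> R) (\<lambda>e. if e \<in> R then r else p2) (\<lambda>A. ?f (reach A S)) = ?f S"
          using noX noR fin by (intro pexp_reach_terminal) auto
        also have "\<dots> \<le> exp (r * G S C - r * \<mu> * n)"
        proof (cases "n \<le> card S")
          case True
          \<comment> \<open>No boundary edge of \<open>S\<close> is left in \<open>X\<close> or
            \<open>R\<close>, so all of them are finished and the accumulated risk is at least
            \<open>\<mu> * card S\<close>; hence the claimed bound is at least 1.\<close>
          have eq: "{(x, y). x \<in> S \<and> y \<notin> S \<and> {x, y} \<in> E} = {(x, y). x \<in> S \<and> y \<notin> S \<and> {x, y} \<in> C}"
          proof -
            have "{x, y} \<in> C" if xy: "x \<in> S" "y \<notin> S" "{x, y} \<in> E" for x y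
            proof -
              have "{x, y} \<in> X \<union> R \<union> C" unfolding less.prems(3) using SW xy by auto
              then show ?thesis using xy noX noR by auto
            qed
            then show ?thesis using subE by auto
          qed
          have "\<mu> * n \<le> \<mu> * card S" using True par by (intro mult_left_mono) auto
          also have "\<dots> \<le> G S C" using Qsum[OF less.prems(1) SW less.prems(2)] unfolding eq G_def .
          finally have "r * (\<mu> * n) \<le> r * G S C" using par by (intro mult_left_mono) auto
          then have "1 \<le> exp (r * G S C - r * \<mu> * n)" by (simp add: mult.assoc)
          then show ?thesis by (auto intro: order_trans[rotated])
        qed simp
        finally show ?thesis unfolding one by simp
      qed
    qed
  qed
qed

text \<open>Until \<open>n0\<close> vertices are found the exploration is an ordinary one at level
  \<open>p2\<close>, and the probability of getting that far is kept as a factor;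
  \<open>hazard\<close> takes over from there. The edges revealed before were never exposed to a
  check, but there are at most \<open>D * n0\<close> of them and each stands for a risk of at most
  \<open>q\<close>, which costs the factor \<open>exp (r * (D * n0 * q))\<close>.\<close>

lemma hazard_prefix:
  fixes Q :: "'a set \<Rightarrow> 'a \<Rightarrow> real" and p1 p2 r \<mu> q :: real
  assumes W: "finite W" and par: "0 \<le> p1" "p1 \<le> 1" "0 \<le> r" "r \<le> 1" "p2 = p1 + (1 - p1) * r" "0 \<le> \<mu>"
    and Q01: "\<And>S y. 0 \<le> Q S y \<and> Q S y \<le> 1"
    and Qanti: "\<And>S T y. finite T \<Longrightarrow> S \<subseteq> T \<Longrightarrow> Q T y \<le> Q S y"
    and Qexit: "\<And>S y. finite S \<Longrightarrow> y \<notin> S \<Longrightarrow>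
      Q S y \<le> rexp {e \<in> E. e \<inter> W \<noteq> {} \<and> e \<inter> S = {}} p1 {y} (\<lambda>K. of_bool (\<not> K \<subseteq> W))"
    and Qsum: "\<And>S. finite S \<Longrightarrow> S \<subseteq> W \<Longrightarrow> S \<noteq> {} \<Longrightarrow>
      \<mu> * card S \<le> (\<Sum>(x, y)\<in>{(x, y). x \<in> S \<and> y \<notin> S \<and> {x, y} \<in> E}. Q S y)"
    and Qmax: "\<And>S y. finite S \<Longrightarrow> Q S y \<le> q"
    and n: "1 \<le> n0" "n0 \<le> n"
  shows "rexp {e \<in> E. e \<inter> W \<noteq> {}} p2 {v} (\<lambda>K. of_bool (K \<subseteq> W \<and> n \<le> card K)) \<le>
    exp (r * (D * n0 * q) - r * \<mu> * n) * rexp {e \<in> E. e \<inter> W \<noteq> {}} p2 {v} (\<lambda>K. of_bool (n0 \<le> card K))"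
proof -
  define FW where "FW = {e \<in> E. e \<inter> W \<noteq> {}}"
  have finFW: "finite FW" unfolding FW_def by (rule finite_touching[OF W])
  have p2: "0 \<le> p2" "p2 \<le> 1" using par mult_left_le[of r "1 - p1"] by auto
  have q0: "0 \<le> q" using Qmax[of "{}" v] Q01[of "{}" v] by simp
  let ?f = "\<lambda>K. of_bool (K \<subseteq> W \<and> n \<le> card K) :: real"
  define c where "c = exp (r * (D * n0 * q) - r * \<mu> * n)"
  have stop: "rexp X p2 S ?f \<le> c * rexp X p2 S (\<lambda>K. of_bool (n0 \<le> card K))"
    if X: "finite X" "finite S" "S \<noteq> {}" "card S = n0" "X \<union> C = FW" "X \<inter> C = {}" "\<And>e. e \<in> C \<Longrightarrow> e \<inter> S \<noteq> {}" for X S C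
  proof -
    have sub: "X \<subseteq> E" "C \<subseteq> E" using X(5) by (auto simp: FW_def)
    have finC: "finite C" "card C \<le> D * card S" using card_touching_le[OF X(2) sub(2) X(7)] by auto
    define G where "G = (\<Sum>(x, y)\<in>{(x, y). x \<in> S \<and> y \<notin> S \<and> {x, y} \<in> C}. Q S y)"
    have "rexp X p2 S ?f = pexp (X \<union> {}) (\<lambda>e. if e \<in> {} then r else p2) (\<lambda>A. of_bool (reach A S \<subseteq> W \<and> n \<le> card (reach A S)))"
      by (simp add: rexp_def)
    also have "\<dots> \<le> exp (r * G - r * \<mu> * n) * rexp X p1 S (\<lambda>K. of_bool (K \<subseteq> W))"
      unfolding G_def using X by (intro hazard[OF W par Q01 Qanti Qexit Qsum X(2,3)]) (auto simp: FW_def)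
    also have "\<dots> \<le> exp (r * G - r * \<mu> * n) * 1"
      using X par by (intro mult_left_mono rexp_le_const) auto
    also have "exp (r * G - r * \<mu> * n) * 1 \<le> c"
    proof -
      have "G \<le> (\<Sum>(x, y)\<in>{(x, y). x \<in> S \<and> y \<notin> S \<and> {x, y} \<in> C}. q)"
        unfolding G_def using X by (intro sum_mono) (auto intro: Qmax)
      also have "\<dots> = card {(x, y). x \<in> S \<and> y \<notin> S \<and> {x, y} \<in> C} * q" by simp
      also have "\<dots> \<le> real (D * n0) * q"
        using finite_crossing_pairs(2)[OF finC(1), of S] finC(2) X(4) q0
        by (intro mult_right_mono) (auto simp del: of_nat_mult)
      finally show ?thesis unfolding c_def using par by (auto intro!: mult_left_mono)
    qed
    finally have "rexp X p2 S ?f \<le> c" .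
    moreover have "rexp X p2 S (\<lambda>K. of_bool (n0 \<le> card K)) = rexp X p2 S (\<lambda>K. 1)"
      unfolding rexp_def
    proof (rule pexp_cong)
      fix A assume "A \<subseteq> X"
      then show "of_bool (n0 \<le> card (reach A S)) = (1 :: real)"
        using card_reach_ge[of X S A] X sub by auto
    qed simp
    ultimately show ?thesis using X by simp
  qed
  have "rexp X p2 S ?f \<le> c * rexp X p2 S (\<lambda>K. of_bool (n0 \<le> card K))"
    if "finite X" "finite S" "S \<noteq> {}" "card S \<le> n0" "X \<union> C = FW" "X \<inter> C = {}" "\<And>e. e \<in> C \<Longrightarrow> e \<inter> S \<noteq> {}" for X S C
    using that
  proof (induction X S arbitrary: C rule: explore_induct)
    case (terminal X S)
    show ?case
    proof (cases "card S = n0")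
      case False
      then have "card S < n0" using terminal.prems by simp
      moreover have "rexp X p2 S ?f = ?f S"
        using terminal.hyps by (intro rexp_terminal) auto
      moreover have "rexp X p2 S (\<lambda>K. of_bool (n0 \<le> card K)) = (of_bool (n0 \<le> card S) :: real)"
        using terminal.hyps by (intro rexp_terminal) auto
      ultimately show ?thesis using n by (simp add: c_def)
    next
      case True
      show ?thesis by (rule stop[OF terminal.hyps(1) terminal.prems(1,2) True terminal.prems(4-6)])
    qed
  next
    case (step X S x y)
    show ?case
    proof (cases "card S = n0")
      case True
      show ?thesis by (rule stop[OF step.hyps(1) step.prems(1,2) True step.prems(4-6)])
    next
      case False
      define e where "e = {x, y}"
      define X' where "X' = X - {e}"
      have e: "e \<in> X" "e \<notin> C" using step.hyps step.prems by (auto simp: e_def)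
      have un: "X' \<union> insert e C = FW" "X' \<inter> insert e C = {}" using e step.prems(4,5) by (auto simp: X'_def)
      have t: "\<And>d. d \<in> insert e C \<Longrightarrow> d \<inter> S \<noteq> {}" "\<And>d. d \<in> insert e C \<Longrightarrow> d \<inter> insert y S \<noteq> {}"
        using step.prems(6) step.hyps(3) by (auto simp: e_def)
      have ih1: "rexp X' p2 (insert y S) ?f \<le> c * rexp X' p2 (insert y S) (\<lambda>K. of_bool (n0 \<le> card K))"
        using False step.hyps(4) step.prems(1,3)
        by (intro step.IH(1)[folded e_def, folded X'_def, OF _ _ _ un t(2)]) auto
      have ih2: "rexp X' p2 S ?f \<le> c * rexp X' p2 S (\<lambda>K. of_bool (n0 \<le> card K))"
        using step.prems(1-3) by (intro step.IH(2)[folded e_def, folded X'_def, OF _ _ _ un t(1)]) auto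
      have st: "rexp X p2 S g = p2 * rexp X' p2 (insert y S) g + (1 - p2) * rexp X' p2 S g" for g
        unfolding X'_def e_def by (rule rexp_step[OF step.hyps(1,2,3)])
      have "rexp X p2 S ?f \<le> p2 * (c * rexp X' p2 (insert y S) (\<lambda>K. of_bool (n0 \<le> card K))) +
          (1 - p2) * (c * rexp X' p2 S (\<lambda>K. of_bool (n0 \<le> card K)))"
        unfolding st using ih1 ih2 p2 by (intro add_mono mult_left_mono) auto
      then show ?thesis unfolding st by (simp add: algebra_simps)
    qed
  qed
  from this[of FW "{v}" "{}"] show ?thesis
    using n finFW unfolding c_def FW_def by auto
qed

end

section \<open>Infinite-volume quantities\<close>

definition off :: "'a set set \<Rightarrow> 'a set \<Rightarrow> 'a set set" where
  "off H S = {e \<in> H. e \<inter> S = {}}"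

lemma off_subset: "off H S \<subseteq> H"
  by (auto simp: off_def)

lemma off_empty [simp]: "off H {} = H"
  by (auto simp: off_def)

lemma off_antimono: "S \<subseteq> T \<Longrightarrow> off H T \<subseteq> off H S"
  by (auto simp: off_def)

lemma finite_off: "finite H \<Longrightarrow> finite (off H S)"
  by (rule finite_subset[OF off_subset])

text \<open>For monotone \<open>h\<close> the expectations increase with the edge set, so this is
  the expectation of \<open>h (card K)\<close> in the infinite graph. A supremum of reals is
  meaningful only with an upper bound, which \<open>cbdd\<close> supplies.\<close>

definition cexp :: "'a set set \<Rightarrow> real \<Rightarrow> (nat \<Rightarrow> real) \<Rightarrow> 'a \<Rightarrow> real" where
  "cexp H p h v = (SUP F\<in>{F. finite F \<and> F \<subseteq> H}. rexp F p {v} (\<lambda>K. h (card K)))"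

definition cbdd :: "'a set set \<Rightarrow> real \<Rightarrow> (nat \<Rightarrow> real) \<Rightarrow> 'a \<Rightarrow> bool" where
  "cbdd H p h v \<longleftrightarrow> bdd_above ((\<lambda>F. rexp F p {v} (\<lambda>K. h (card K))) ` {F. finite F \<and> F \<subseteq> H})"

definition tail :: "'a set set \<Rightarrow> real \<Rightarrow> nat \<Rightarrow> 'a \<Rightarrow> real" where
  "tail H p n v = cexp H p (\<lambda>k. of_bool (n \<le> k)) v"

text \<open>The probability that the cluster of \<open>v\<close> in the edges \<open>H\<close> is
  infinite, as the limit of decreasing tails, so that it is available for \<open>off E S\<close> as
  well as for \<open>E\<close>.\<close>

definition theta :: "'a set set \<Rightarrow> real \<Rightarrow> 'a \<Rightarrow> real" where
  "theta H p v = (INF n. tail H p n v)"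

lemma cbddI: "(\<And>F. finite F \<Longrightarrow> F \<subseteq> H \<Longrightarrow> rexp F p {v} (\<lambda>K. h (card K)) \<le> c) \<Longrightarrow> cbdd H p h v"
  unfolding cbdd_def by (rule bdd_aboveI[of _ c]) auto

lemma rexp_le_cexp:
  "cbdd H p h v \<Longrightarrow> finite F \<Longrightarrow> F \<subseteq> H \<Longrightarrow> rexp F p {v} (\<lambda>K. h (card K)) \<le> cexp H p h v"
  unfolding cexp_def cbdd_def by (rule cSUP_upper) auto

lemma cexp_le: "(\<And>F. finite F \<Longrightarrow> F \<subseteq> H \<Longrightarrow> rexp F p {v} (\<lambda>K. h (card K)) \<le> c) \<Longrightarrow> cexp H p h v \<le> c"
  unfolding cexp_def by (rule cSUP_least) auto

lemma cbdd_tail: "0 \<le> p \<Longrightarrow> p \<le> 1 \<Longrightarrow> cbdd H p (\<lambda>k. of_bool (n \<le> k)) v"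
  by (rule cbddI[of _ _ _ _ 1]) (auto intro: rexp_le_const)

lemma rexp_le_tail:
  "0 \<le> p \<Longrightarrow> p \<le> 1 \<Longrightarrow> finite F \<Longrightarrow> F \<subseteq> H \<Longrightarrow> rexp F p {v} (\<lambda>K. of_bool (n \<le> card K)) \<le> tail H p n v"
  unfolding tail_def by (rule rexp_le_cexp[OF cbdd_tail])

lemma tail_le: "(\<And>F. finite F \<Longrightarrow> F \<subseteq> H \<Longrightarrow> rexp F p {v} (\<lambda>K. of_bool (n \<le> card K)) \<le> c) \<Longrightarrow> tail H p n v \<le> c"
  unfolding tail_def by (rule cexp_le)

lemma tail_nonneg: "0 \<le> p \<Longrightarrow> p \<le> 1 \<Longrightarrow> 0 \<le> tail H p n v"
  by (rule order_trans[OF rexp_nonneg rexp_le_tail[of p "{}"]]) auto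

lemma tail_le_1: "0 \<le> p \<Longrightarrow> p \<le> 1 \<Longrightarrow> tail H p n v \<le> 1"
  by (rule tail_le) (auto intro: rexp_le_const)

lemma tail_antimono_n:
  assumes "0 \<le> p" "p \<le> 1" "m \<le> n"
  shows "tail H p n v \<le> tail H p m v"
proof (rule tail_le)
  fix F assume F: "finite F" "F \<subseteq> H"
  have "rexp F p {v} (\<lambda>K. of_bool (n \<le> card K)) \<le> rexp F p {v} (\<lambda>K. of_bool (m \<le> card K))"
    using F assms by (intro rexp_mono) auto
  also have "\<dots> \<le> tail H p m v" using F assms by (intro rexp_le_tail) auto
  finally show "rexp F p {v} (\<lambda>K. of_bool (n \<le> card K)) \<le> tail H p m v" .
qed

lemma tail_mono_set:
  assumes "0 \<le> p" "p \<le> 1" "H \<subseteq> H'"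
  shows "tail H p n v \<le> tail H' p n v"
  by (rule tail_le, rule rexp_le_tail) (use assms in auto)

lemma theta_bdd: "0 \<le> p \<Longrightarrow> p \<le> 1 \<Longrightarrow> bdd_below (range (\<lambda>n. tail H p n v))"
  by (rule bdd_belowI[of _ 0]) (auto intro: tail_nonneg)

lemma theta_le_tail: "0 \<le> p \<Longrightarrow> p \<le> 1 \<Longrightarrow> theta H p v \<le> tail H p n v"
  unfolding theta_def by (rule cINF_lower[OF theta_bdd]) auto

lemma theta_ge: "(\<And>n. c \<le> tail H p n v) \<Longrightarrow> c \<le> theta H p v"
  unfolding theta_def by (rule cINF_greatest) auto

lemma theta_nonneg: "0 \<le> p \<Longrightarrow> p \<le> 1 \<Longrightarrow> 0 \<le> theta H p v"
  by (rule theta_ge) (rule tail_nonneg)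

lemma theta_le_1: "0 \<le> p \<Longrightarrow> p \<le> 1 \<Longrightarrow> theta H p v \<le> 1"
  using theta_le_tail[of p H v 0] tail_le_1[of p H 0 v] by simp

lemma theta_mono_set: "0 \<le> p \<Longrightarrow> p \<le> 1 \<Longrightarrow> H \<subseteq> H' \<Longrightarrow> theta H p v \<le> theta H' p v"
  by (rule theta_ge) (rule order_trans[OF theta_le_tail tail_mono_set])

lemma tail_tendsto_theta:
  assumes "0 \<le> p" "p \<le> 1"
  shows "(\<lambda>n. tail H p n v) \<longlonglongrightarrow> theta H p v"
  unfolding theta_def by (rule LIMSEQ_decseq_INF[OF theta_bdd[OF assms]])
    (use assms in \<open>auto simp: decseq_def intro: tail_antimono_n\<close>)

text \<open>A path that leaves \<open>W\<close> has, up to its first vertex outside, only edges that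
  meet \<open>W\<close>.\<close>

lemma reach_exit_local:
  assumes "\<not> reach A {y} \<subseteq> W"
  shows "\<not> reach (A \<inter> {e. e \<inter> W \<noteq> {}}) {y} \<subseteq> W"
proof
  let ?T = "A \<inter> {e. e \<inter> W \<noteq> {}}"
  assume sub: "reach ?T {y} \<subseteq> W"
  have "reach A {y} \<subseteq> reach ?T {y}"
  proof (rule reach_least)
    show "b \<in> reach ?T {y}" if "a \<in> reach ?T {y}" "{a, b} \<in> A" for a b
    proof -
      have "{a, b} \<in> ?T" using that sub by auto
      then show ?thesis using that(1) reach_closed[of a ?T "{y}" b] by blast
    qed
  qed auto
  with sub assms show False by auto
qed

lemma reach_within_local:
  assumes "reach (A \<inter> {e. e \<inter> W \<noteq> {}}) {y} \<subseteq> W"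
  shows "reach A {y} = reach (A \<inter> {e. e \<inter> W \<noteq> {}}) {y}"
proof
  let ?T = "A \<inter> {e. e \<inter> W \<noteq> {}}"
  show "reach A {y} \<subseteq> reach ?T {y}"
  proof (rule reach_least)
    show "b \<in> reach ?T {y}" if "a \<in> reach ?T {y}" "{a, b} \<in> A" for a b
    proof -
      have "{a, b} \<in> ?T" using that assms by auto
      then show ?thesis using that(1) reach_closed[of a ?T "{y}" b] by blast
    qed
  qed auto
  show "reach ?T {y} \<subseteq> reach A {y}" by (rule reach_mono) auto
qed

context bounded_degree
begin

lemma rexp_card_mono_set:
  assumes "finite F'" "F \<subseteq> F'" "F' \<subseteq> E" "0 \<le> p" "p \<le> 1" "mono h" "finite S"
  shows "rexp F p S (\<lambda>K. h (card K)) \<le> rexp F' p S (\<lambda>K. h (card K))"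
  unfolding rexp_def
proof (rule pexp_mono_set)
  show "h (card (reach A S)) \<le> h (card (reach B S))" if "A \<subseteq> B" "B \<subseteq> F'" for A B
    using card_reach_mono[of F' S B A S] that assms by (intro monoD[OF assms(6)]) auto
qed (use assms in auto)

lemma rexp_card_mono_p:
  assumes "finite F" "F \<subseteq> E" "0 \<le> p" "p \<le> q" "q \<le> 1" "mono h" "finite S"
  shows "rexp F p S (\<lambda>K. h (card K)) \<le> rexp F q S (\<lambda>K. h (card K))"
  unfolding rexp_def
proof (rule pexp_mono_weight)
  show "h (card (reach A S)) \<le> h (card (reach B S))" if "A \<subseteq> B" "B \<subseteq> F" for A B
    using card_reach_mono[of F S B A S] that assms by (intro monoD[OF assms(6)]) auto
qed (use assms in auto)

lemma mono_of_bool_le: "mono (\<lambda>k. of_bool (n \<le> k) :: real)"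
  by (auto simp: mono_def)

lemma cexp_tendsto:
  assumes "cbdd H p h v" "H \<subseteq> E" "0 \<le> p" "p \<le> 1" "mono h"
  shows "((\<lambda>F. rexp F p {v} (\<lambda>K. h (card K))) \<longlongrightarrow> cexp H p h v) (finite_subsets_at_top H)"
proof (rule increasing_tendsto)
  show "\<forall>\<^sub>F F in finite_subsets_at_top H. rexp F p {v} (\<lambda>K. h (card K)) \<le> cexp H p h v"
    using assms by (intro eventually_finite_subsets_at_top_weakI rexp_le_cexp) auto
  fix c assume "c < cexp H p h v"
  then obtain F where F: "finite F" "F \<subseteq> H" "c < rexp F p {v} (\<lambda>K. h (card K))"
    using assms(1) unfolding cexp_def cbdd_def by (subst (asm) less_cSUP_iff) auto
  show "\<forall>\<^sub>F F in finite_subsets_at_top H. c < rexp F p {v} (\<lambda>K. h (card K))"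
    unfolding eventually_finite_subsets_at_top
  proof (intro exI[of _ F] conjI allI impI)
    fix Y assume Y: "finite Y \<and> F \<subseteq> Y \<and> Y \<subseteq> H"
    then have "rexp F p {v} (\<lambda>K. h (card K)) \<le> rexp Y p {v} (\<lambda>K. h (card K))"
      using assms by (intro rexp_card_mono_set) auto
    then show "c < rexp Y p {v} (\<lambda>K. h (card K))" using F by simp
  qed (use F in auto)
qed

lemma tail_tendsto:
  assumes "H \<subseteq> E" "0 \<le> p" "p \<le> 1"
  shows "((\<lambda>F. rexp F p {v} (\<lambda>K. of_bool (n \<le> card K))) \<longlongrightarrow> tail H p n v) (finite_subsets_at_top H)"
  unfolding tail_def using assms by (intro cexp_tendsto cbdd_tail mono_of_bool_le)

lemma tail_mono_p:
  assumes "H \<subseteq> E" "0 \<le> p" "p \<le> q" "q \<le> 1"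
  shows "tail H p n v \<le> tail H q n v"
proof (rule tail_le)
  fix F assume F: "finite F" "F \<subseteq> H"
  have "rexp F p {v} (\<lambda>K. of_bool (n \<le> card K)) \<le> rexp F q {v} (\<lambda>K. of_bool (n \<le> card K))"
    using F assms by (intro rexp_card_mono_p mono_of_bool_le) auto
  also have "\<dots> \<le> tail H q n v" using F assms by (intro rexp_le_tail) auto
  finally show "rexp F p {v} (\<lambda>K. of_bool (n \<le> card K)) \<le> tail H q n v" .
qed

lemma theta_mono_p: "H \<subseteq> E \<Longrightarrow> 0 \<le> p \<Longrightarrow> p \<le> q \<Longrightarrow> q \<le> 1 \<Longrightarrow> theta H p v \<le> theta H q v"
  by (rule theta_ge) (rule order_trans[OF theta_le_tail tail_mono_p]; simp)

text \<open>An infinite cluster has more than \<open>card W\<close> vertices and hence leaves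
  \<open>W\<close>; by \<open>reach_exit_local\<close> this is decided by the edges that meet
  \<open>W\<close>. It is the property that \<open>hazard\<close> asks of \<open>Q\<close>.\<close>

lemma theta_le_exit:
  assumes "finite W" "0 \<le> p" "p \<le> 1"
  shows "theta (off E S) p y \<le> rexp {e \<in> E. e \<inter> W \<noteq> {} \<and> e \<inter> S = {}} p {y} (\<lambda>K. of_bool (\<not> K \<subseteq> W))"
proof -
  define T where "T = {e \<in> E. e \<inter> W \<noteq> {} \<and> e \<inter> S = {}}"
  have finT: "finite T" unfolding T_def by (rule finite_subset[OF _ finite_touching[OF assms(1)]]) auto
  have "theta (off E S) p y \<le> tail (off E S) p (card W + 1) y" using assms by (intro theta_le_tail)
  also have "\<dots> \<le> rexp T p {y} (\<lambda>K. of_bool (\<not> K \<subseteq> W))"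
  proof (rule tail_le)
    fix F assume F: "finite F" "F \<subseteq> off E S"
    have "rexp F p {y} (\<lambda>K. of_bool (card W + 1 \<le> card K)) \<le> pexp F (\<lambda>_. p) (\<lambda>A. of_bool (\<not> reach (A \<inter> T) {y} \<subseteq> W))"
      unfolding rexp_def
    proof (rule pexp_mono)
      fix A assume A: "A \<subseteq> F"
      have "\<not> reach (A \<inter> T) {y} \<subseteq> W" if "card W + 1 \<le> card (reach A {y})"
      proof -
        have "\<not> reach A {y} \<subseteq> W" using that card_mono[OF assms(1), of "reach A {y}"] by auto
        then have "\<not> reach (A \<inter> {e. e \<inter> W \<noteq> {}}) {y} \<subseteq> W" by (rule reach_exit_local)
        moreover have "A \<inter> {e. e \<inter> W \<noteq> {}} = A \<inter> T" using A F by (auto simp: T_def off_def)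
        ultimately show ?thesis by simp
      qed
      then show "of_bool (card W + 1 \<le> card (reach A {y})) \<le> (of_bool (\<not> reach (A \<inter> T) {y} \<subseteq> W) :: real)" by auto
    qed (use F assms in auto)
    also have "\<dots> = pexp F (\<lambda>_. p) (\<lambda>A. of_bool (\<not> reach ((A \<inter> (F \<inter> T)) \<inter> T) {y} \<subseteq> W))"
      by (intro pexp_cong arg_cong[of _ _ of_bool] arg_cong[of _ _ Not] arg_cong2[of _ _ _ _ "(\<subseteq>)"] arg_cong2[of _ _ _ _ reach]) auto
    also have "\<dots> = pexp (F \<inter> T) (\<lambda>_. p) (\<lambda>A. of_bool (\<not> reach (A \<inter> T) {y} \<subseteq> W))"
      using F by (subst pexp_restrict) auto
    also have "\<dots> \<le> pexp T (\<lambda>_. p) (\<lambda>A. of_bool (\<not> reach (A \<inter> T) {y} \<subseteq> W))"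
    proof (rule pexp_mono_set)
      show "of_bool (\<not> reach (A \<inter> T) {y} \<subseteq> W) \<le> (of_bool (\<not> reach (B \<inter> T) {y} \<subseteq> W) :: real)" if "A \<subseteq> B" for A B
        using reach_mono[of "A \<inter> T" "B \<inter> T" "{y}" "{y}"] that by auto
    qed (use finT assms in auto)
    also have "\<dots> = rexp T p {y} (\<lambda>K. of_bool (\<not> K \<subseteq> W))"
      unfolding rexp_def by (intro pexp_cong) (auto simp: Int_absorb2)
    finally show "rexp F p {y} (\<lambda>K. of_bool (card W + 1 \<le> card K)) \<le> rexp T p {y} (\<lambda>K. of_bool (\<not> K \<subseteq> W))" .
  qed
  finally show ?thesis unfolding T_def .
qed

section \<open>Balls around a set and clusters that leave them\<close>

primrec nball :: "'a set \<Rightarrow> nat \<Rightarrow> 'a set" where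
  "nball S 0 = S"
| "nball S (Suc n) = nball S n \<union> {y. \<exists>x\<in>nball S n. {x, y} \<in> E}"

lemma finite_nball: "finite S \<Longrightarrow> finite (nball S n)"
proof (induction n)
  case (Suc n)
  have "{y. \<exists>x\<in>nball S n. {x, y} \<in> E} \<subseteq> \<Union>{e \<in> E. e \<inter> nball S n \<noteq> {}}" by auto
  moreover have "finite (\<Union>{e \<in> E. e \<inter> nball S n \<noteq> {}})"
    using finite_touching[of "nball S n"] Suc edge_finite by auto
  ultimately have "finite {y. \<exists>x\<in>nball S n. {x, y} \<in> E}" by (rule finite_subset)
  then show ?case using Suc by simp
qed simp

lemma nball_mono: "m \<le> n \<Longrightarrow> nball S m \<subseteq> nball S n"
  by (induction n) (auto simp: le_Suc_eq)

lemma nball_subset_V: "S \<subseteq> V \<Longrightarrow> \<Union>E \<subseteq> V \<Longrightarrow> nball S n \<subseteq> V"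
  by (induction n) auto

text \<open>
  A cluster that leaves the ball of radius \<open>n\<close> has a vertex in each of the \<open>n + 1\<close> spheres.
\<close>

lemma card_reach_exit_ball:
  assumes "A \<subseteq> E" "v \<in> S" "finite S" "\<not> reach A {v} \<subseteq> nball S n"
  shows "n + 1 \<le> card (reach A {v} \<inter> nball S n)"
  using assms(4)
proof (induction n)
  case 0
  have "{v} \<subseteq> reach A {v} \<inter> nball S 0" using assms by auto
  then have "card {v} \<le> card (reach A {v} \<inter> nball S 0)" using assms by (intro card_mono) auto
  then show ?case by simp
next
  case (Suc n)
  have n: "\<not> reach A {v} \<subseteq> nball S n" using Suc.prems by auto
  have "\<exists>z. z \<in> reach A {v} \<and> z \<in> nball S (Suc n) \<and> z \<notin> nball S n"
  proof (rule ccontr)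
    assume no: "\<not> ?thesis"
    have "reach A {v} \<subseteq> reach A {v} \<inter> nball S n"
    proof (rule reach_least)
      show "{v} \<subseteq> reach A {v} \<inter> nball S n" using assms nball_mono[of 0 n S] by auto
      show "y \<in> reach A {v} \<inter> nball S n" if "x \<in> reach A {v} \<inter> nball S n" "{x, y} \<in> A" for x y
        using that no assms(1) reach_closed[of x A "{v}" y] by auto
    qed
    with n show False by auto
  qed
  then obtain z where z: "z \<in> reach A {v}" "z \<in> nball S (Suc n)" "z \<notin> nball S n" by blast
  have "n + 1 + 1 \<le> card (reach A {v} \<inter> nball S n) + 1" using Suc.IH[OF n] by simp
  also have "\<dots> = card (insert z (reach A {v} \<inter> nball S n))"
    using z assms finite_nball by simp
  also have "\<dots> \<le> card (reach A {v} \<inter> nball S (Suc n))"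
    using z finite_nball[OF assms(3), of "Suc n"] by (intro card_mono) (auto simp del: nball.simps(2), simp)
  finally show ?case by simp
qed

lemma exit_ball_le_tail:
  assumes "0 \<le> p" "p \<le> 1" "finite F" "F \<subseteq> H" "H \<subseteq> E" "v \<in> S" "finite S"
  shows "rexp F p {v} (\<lambda>K. of_bool (\<not> K \<subseteq> nball S n)) \<le> tail H p n v"
proof -
  have "rexp F p {v} (\<lambda>K. of_bool (\<not> K \<subseteq> nball S n)) \<le> rexp F p {v} (\<lambda>K. of_bool (n \<le> card K))"
  proof (rule rexp_mono)
    fix A assume A: "A \<subseteq> F"
    have "n \<le> card (reach A {v})" if "\<not> reach A {v} \<subseteq> nball S n"
    proof -
      have "n + 1 \<le> card (reach A {v} \<inter> nball S n)" using that A assms by (intro card_reach_exit_ball) auto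
      also have "\<dots> \<le> card (reach A {v})" using A assms by (intro card_mono finite_reach[of F]) auto
      finally show ?thesis by simp
    qed
    then show "of_bool (\<not> reach A {v} \<subseteq> nball S n) \<le> (of_bool (n \<le> card (reach A {v})) :: real)" by auto
  qed (use assms in auto)
  also have "\<dots> \<le> tail H p n v" using assms by (intro rexp_le_tail) auto
  finally show ?thesis .
qed

text \<open>With the edge \<open>{u, v}\<close> open, at cost \<open>p\<close>, the cluster of
  \<open>u\<close> contains everything that \<open>v\<close> could reach, whatever the original
  state of that edge.\<close>

lemma cexp_adjacent:
  assumes "{u, v} \<in> E" "0 \<le> p" "p \<le> 1" "mono h" "\<And>k. 0 \<le> h k" "cbdd E p h u"
  shows "p * cexp E p h v \<le> cexp E p h u" "0 < p \<Longrightarrow> cbdd E p h v"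
proof -
  have *: "p * rexp F p {v} (\<lambda>K. h (card K)) \<le> cexp E p h u" if F: "finite F" "F \<subseteq> E" for F
  proof -
    define F' where "F' = F - {{u, v}}"
    have F': "finite F'" "F' \<subseteq> E" "insert {u, v} F' \<subseteq> E" "{u, v} \<notin> F'" using F assms by (auto simp: F'_def)
    have "rexp F p {v} (\<lambda>K. h (card K)) \<le> pexp F (\<lambda>_. p) (\<lambda>A. h (card (reach (A \<inter> F') (insert v {u}))))"
      unfolding rexp_def
    proof (rule pexp_mono)
      fix A assume A: "A \<subseteq> F"
      have "reach A {v} \<subseteq> reach (A \<inter> F') (insert v {u})"
      proof (rule reach_least)
        show "{v} \<subseteq> reach (A \<inter> F') (insert v {u})" using reach_superset[of "insert v {u}" "A \<inter> F'"] by auto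
        show "b \<in> reach (A \<inter> F') (insert v {u})" if "a \<in> reach (A \<inter> F') (insert v {u})" "{a, b} \<in> A" for a b
        proof (cases "{a, b} = {u, v}")
          case True
          then have "b \<in> insert v {u}" by (auto simp: doubleton_eq_iff)
          then show ?thesis using reach_superset[of "insert v {u}" "A \<inter> F'"] by auto
        next
          case False
          then have "{a, b} \<in> A \<inter> F'" using that A by (auto simp: F'_def)
          then show ?thesis using that reach_closed[of a "A \<inter> F'"] by blast
        qed
      qed
      then have "card (reach A {v}) \<le> card (reach (A \<inter> F') (insert v {u}))"
        using F' by (intro card_mono finite_reach[of F']) auto
      then show "h (card (reach A {v})) \<le> h (card (reach (A \<inter> F') (insert v {u})))" by (rule monoD[OF assms(4)])
    qed (use F assms in auto)
    also have "\<dots> = rexp F' p (insert v {u}) (\<lambda>K. h (card K))"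
      unfolding rexp_def using F by (subst pexp_restrict[of F F' _ "\<lambda>A. h (card (reach A (insert v {u})))"]) (auto simp: F'_def)
    finally have "p * rexp F p {v} (\<lambda>K. h (card K)) \<le> p * rexp F' p (insert v {u}) (\<lambda>K. h (card K))"
      using assms by (intro mult_left_mono) auto
    also have "\<dots> \<le> p * rexp F' p (insert v {u}) (\<lambda>K. h (card K)) + (1 - p) * rexp F' p {u} (\<lambda>K. h (card K))"
      using F' assms rexp_nonneg[of F' p "\<lambda>K. h (card K)" "{u}"] by simp
    also have "\<dots> = rexp (insert {u, v} F') p {u} (\<lambda>K. h (card K))"
      using F' by (subst rexp_step[of _ u v]) auto
    also have "\<dots> \<le> cexp E p h u" using F' assms by (intro rexp_le_cexp) auto
    finally show ?thesis .
  qed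
  show 2: "cbdd E p h v" if "0 < p"
  proof (rule cbddI)
    fix F assume "finite F" "F \<subseteq> E"
    from *[OF this] show "rexp F p {v} (\<lambda>K. h (card K)) \<le> cexp E p h u / p"
      using that by (simp add: field_simps)
  qed
  show "p * cexp E p h v \<le> cexp E p h u"
  proof (cases "p = 0")
    case True
    have "0 \<le> rexp {} p {u} (\<lambda>K. h (card K))" using assms by (intro rexp_nonneg) auto
    also have "\<dots> \<le> cexp E p h u" using assms by (intro rexp_le_cexp) auto
    finally show ?thesis using True by simp
  next
    case False
    have "cexp E p h v \<le> cexp E p h u / p"
    proof (rule cexp_le)
      fix F assume "finite F" "F \<subseteq> E"
      from *[OF this] show "rexp F p {v} (\<lambda>K. h (card K)) \<le> cexp E p h u / p"
        using False assms by (simp add: field_simps)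
    qed
    then show ?thesis using False assms by (simp add: field_simps)
  qed
qed

text \<open>\<open>k\<close> is the length of a path from \<open>u\<close> to \<open>v\<close>. It
  is fixed before \<open>p\<close> and \<open>h\<close>, so the comparison is uniform in the
  parameter and in the size \<open>n\<close> of a tail event.\<close>

lemma cexp_linked:
  assumes "linked E u v"
  shows "\<exists>k. \<forall>p h. 0 < p \<longrightarrow> p \<le> 1 \<longrightarrow> mono h \<longrightarrow> (\<forall>k. 0 \<le> h k) \<longrightarrow> cbdd E p h u \<longrightarrow>
    cbdd E p h v \<and> p ^ k * cexp E p h v \<le> cexp E p h u"
  using assms
proof (induction rule: linked_induct)
  case refl
  then show ?case by (intro exI[of _ 0]) auto
next
  case (step x y)
  then obtain k where k: "\<And>p h. 0 < p \<Longrightarrow> p \<le> 1 \<Longrightarrow> mono h \<Longrightarrow> (\<forall>k. 0 \<le> h k) \<Longrightarrow> cbdd E p h u \<Longrightarrow>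
    cbdd E p h x \<and> p ^ k * cexp E p h x \<le> cexp E p h u" by blast
  show ?case
  proof (intro exI[of _ "Suc k"] allI impI)
    fix p h assume a: "0 < p" "p \<le> 1" "mono h" "\<forall>k. (0::real) \<le> h k" "cbdd E p h u"
    note x = k[OF a]
    have y: "p * cexp E p h y \<le> cexp E p h x" "cbdd E p h y"
      using cexp_adjacent[of x y p h] step a x by auto
    have "p ^ Suc k * cexp E p h y = p ^ k * (p * cexp E p h y)" by simp
    also have "\<dots> \<le> p ^ k * cexp E p h x" using y a by (intro mult_left_mono) auto
    also have "\<dots> \<le> cexp E p h u" using x by simp
    finally show "cbdd E p h y \<and> p ^ Suc k * cexp E p h y \<le> cexp E p h u" using y by simp
  qed
qed

lemma reach_image:
  assumes "inj_on \<phi> V" "\<Union>A \<subseteq> V" "v \<in> V"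
  shows "reach ((`) \<phi> ` A) {\<phi> v} = \<phi> ` reach A {v}"
proof
  have V: "reach A {v} \<subseteq> V" using reach_subset_Union[of A "{v}"] assms by auto
  show "reach ((`) \<phi> ` A) {\<phi> v} \<subseteq> \<phi> ` reach A {v}"
  proof (rule reach_least)
    show "b \<in> \<phi> ` reach A {v}" if ab: "a \<in> \<phi> ` reach A {v}" "{a, b} \<in> (`) \<phi> ` A" for a b
    proof -
      obtain x where x: "a = \<phi> x" "x \<in> reach A {v}" using ab by auto
      obtain e where e: "e \<in> A" "{a, b} = \<phi> ` e" using ab by auto
      have eV: "e \<subseteq> V" using e assms by auto
      have "a \<in> \<phi> ` e" using e by blast
      then have "x \<in> e" using x eV V assms(1) by (auto dest: inj_onD)
      have "b \<in> \<phi> ` e" using e by blast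
      then obtain y where y: "y \<in> e" "b = \<phi> y" by auto
      have "\<phi> ` e = \<phi> ` {x, y}" using e x y by auto
      then have "e = {x, y}" using assms(1) eV \<open>x \<in> e\<close> y by (subst (asm) inj_on_image_eq_iff[of \<phi> V]) auto
      then have "y \<in> reach A {v}" using x e reach_closed[of x A "{v}" y] by simp
      then show ?thesis using y by auto
    qed
  qed auto
  show "\<phi> ` reach A {v} \<subseteq> reach ((`) \<phi> ` A) {\<phi> v}"
  proof
    fix z assume "z \<in> \<phi> ` reach A {v}"
    then obtain x where x: "z = \<phi> x" "linked A v x" by (auto simp: reach_def)
    from x(2) have "\<phi> x \<in> reach ((`) \<phi> ` A) {\<phi> v}"
    proof (induction rule: linked_induct)
      case (step x y)
      have "{\<phi> x, \<phi> y} = \<phi> ` {x, y}" by auto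
      then have "{\<phi> x, \<phi> y} \<in> (`) \<phi> ` A" using step.hyps by blast
      then show ?case using step.IH reach_closed[of "\<phi> x"] by blast
    qed auto
    then show "z \<in> reach ((`) \<phi> ` A) {\<phi> v}" using x by simp
  qed
qed

lemma cexp_automorphism:
  assumes \<phi>: "bij_betw \<phi> V V" "\<And>u v. u \<in> V \<Longrightarrow> v \<in> V \<Longrightarrow> {\<phi> u, \<phi> v} \<in> E \<longleftrightarrow> {u, v} \<in> E"
    and "\<Union>E \<subseteq> V" "v \<in> V"
  shows "cexp E p h (\<phi> v) = cexp E p h v" "cbdd E p h (\<phi> v) \<longleftrightarrow> cbdd E p h v"
proof -
  have inj: "inj_on \<phi> V" using \<phi> by (simp add: bij_betw_def)
  have surj: "\<phi> ` V = V" using \<phi> by (simp add: bij_betw_def)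
  have EV: "e \<subseteq> V" if "e \<in> E" for e using that assms by auto
  have injE: "inj_on ((`) \<phi>) E"
    using EV inj by (intro inj_onI) (metis inj_on_image_eq_iff)
  have imE: "(`) \<phi> ` E = E"
  proof
    show "(`) \<phi> ` E \<subseteq> E"
    proof clarify
      fix e assume "e \<in> E"
      then obtain x y where "e = {x, y}" by (rule edgeE)
      then show "\<phi> ` e \<in> E" using \<phi>(2)[of x y] EV[OF \<open>e \<in> E\<close>] \<open>e \<in> E\<close> by auto
    qed
    show "E \<subseteq> (`) \<phi> ` E"
    proof
      fix e assume "e \<in> E"
      then obtain a b where ab: "e = {a, b}" by (rule edgeE)
      then have "a \<in> \<phi> ` V" "b \<in> \<phi> ` V" using EV[OF \<open>e \<in> E\<close>] surj by auto
      then obtain x y where xy: "x \<in> V" "y \<in> V" "a = \<phi> x" "b = \<phi> y" by auto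
      then have "{x, y} \<in> E" using \<phi>(2)[of x y] ab \<open>e \<in> E\<close> by simp
      moreover have "e = \<phi> ` {x, y}" using ab xy by auto
      ultimately show "e \<in> (`) \<phi> ` E" by blast
    qed
  qed
  define \<F> where "\<F> = {F. finite F \<and> F \<subseteq> E}"
  have im: "(\<lambda>F. (`) \<phi> ` F) ` \<F> = \<F>"
  proof
    show "(\<lambda>F. (`) \<phi> ` F) ` \<F> \<subseteq> \<F>" using imE by (auto simp: \<F>_def)
    show "\<F> \<subseteq> (\<lambda>F. (`) \<phi> ` F) ` \<F>"
    proof
      fix F assume F: "F \<in> \<F>"
      then have "F \<subseteq> (`) \<phi> ` E" using imE by (auto simp: \<F>_def)
      then obtain G where G: "G \<subseteq> E" "finite G" "F = (`) \<phi> ` G"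
        using finite_subset_image[of F "(`) \<phi>" E] F by (auto simp: \<F>_def)
      then show "F \<in> (\<lambda>F. (`) \<phi> ` F) ` \<F>" by (auto simp: \<F>_def)
    qed
  qed
  have r: "rexp ((`) \<phi> ` F) p {\<phi> v} (\<lambda>K. h (card K)) = rexp F p {v} (\<lambda>K. h (card K))" if "F \<in> \<F>" for F
  proof -
    have F: "finite F" "F \<subseteq> E" using that by (auto simp: \<F>_def)
    have "rexp ((`) \<phi> ` F) p {\<phi> v} (\<lambda>K. h (card K)) = pexp F (\<lambda>_. p) (\<lambda>A. h (card (reach ((`) \<phi> ` A) {\<phi> v})))"
      unfolding rexp_def using F inj_on_subset[OF injE] by (intro pexp_image) auto
    also have "\<dots> = rexp F p {v} (\<lambda>K. h (card K))"
      unfolding rexp_def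
    proof (rule pexp_cong)
      fix A assume A: "A \<subseteq> F"
      then have AV: "\<Union>A \<subseteq> V" using F EV by blast
      have V: "reach A {v} \<subseteq> V" using reach_subset_Union[of A "{v}"] assms(4) AV by blast
      show "h (card (reach ((`) \<phi> ` A) {\<phi> v})) = h (card (reach A {v}))"
        unfolding reach_image[OF inj AV assms(4)] using card_image[OF inj_on_subset[OF inj V]] by simp
    qed simp
    finally show ?thesis .
  qed
  have eq: "(\<lambda>F. rexp F p {\<phi> v} (\<lambda>K. h (card K))) ` \<F> = (\<lambda>F. rexp F p {v} (\<lambda>K. h (card K))) ` \<F>"
  proof -
    have "(\<lambda>F. rexp F p {\<phi> v} (\<lambda>K. h (card K))) ` \<F> = (\<lambda>F. rexp F p {\<phi> v} (\<lambda>K. h (card K))) ` ((\<lambda>F. (`) \<phi> ` F) ` \<F>)"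
      unfolding im ..
    also have "\<dots> = (\<lambda>F. rexp F p {v} (\<lambda>K. h (card K))) ` \<F>"
      unfolding image_image using r by (intro image_cong) auto
    finally show ?thesis .
  qed
  show "cexp E p h (\<phi> v) = cexp E p h v" "cbdd E p h (\<phi> v) \<longleftrightarrow> cbdd E p h v"
    using eq unfolding cexp_def cbdd_def \<F>_def by simp_all
qed

end

section \<open>Sharpness of the phase transition\<close>

text \<open>An escape from \<open>W\<close> is read backwards, so that an exploration can start
  outside \<open>W\<close> and look for \<open>v\<close>.\<close>

lemma reach_compl: "v \<in> reach A (- W) \<longleftrightarrow> \<not> reach A {v} \<subseteq> W"
proof -
  have "v \<in> reach A (- W) \<longleftrightarrow> (\<exists>z. z \<notin> W \<and> v \<in> reach A {z})" by (auto simp: reach_def)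
  also have "\<dots> \<longleftrightarrow> (\<exists>z. z \<notin> W \<and> z \<in> reach A {v})" using reach_sym by metis
  finally show ?thesis by blast
qed

context bounded_degree
begin

lemma rexp_card_ge_sum:
  assumes "finite F" "F \<subseteq> E" "0 \<le> p" "p \<le> 1" "finite U"
  shows "(\<Sum>z\<in>U. rexp F p {y} (\<lambda>K. of_bool (z \<in> K))) \<le> rexp F p {y} (\<lambda>K. real (card K))"
  unfolding rexp_sum[symmetric]
proof (rule rexp_mono)
  fix A assume A: "A \<subseteq> F"
  have "(\<Sum>z\<in>U. of_bool (z \<in> reach A {y})) = real (card (U \<inter> {z. z \<in> reach A {y}}))"
    using assms by (subst sum_of_bool_eq) auto
  also have "\<dots> \<le> real (card (reach A {y}))"
    using A assms by (intro of_nat_mono card_mono finite_reach[of F]) auto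
  finally show "(\<Sum>z\<in>U. of_bool (z \<in> reach A {y})) \<le> real (card (reach A {y}))" .
qed (use assms in auto)

lemma rexp_card_eq_sum:
  assumes "finite U" "insert y (\<Union>F) \<subseteq> U"
  shows "rexp F p {y} (\<lambda>K. real (card K)) = (\<Sum>z\<in>U. rexp F p {y} (\<lambda>K. of_bool (z \<in> K)))"
  unfolding rexp_sum[symmetric] unfolding rexp_def
proof (rule pexp_cong)
  fix A assume A: "A \<subseteq> F"
  have sub: "reach A {y} \<subseteq> U" using reach_subset_Union[of A "{y}"] A assms by auto
  have "(\<Sum>z\<in>U. of_bool (z \<in> reach A {y})) = real (card (U \<inter> {z. z \<in> reach A {y}}))"
    using assms by (subst sum_of_bool_eq) auto
  then show "real (card (reach A {y})) = (\<Sum>z\<in>U. of_bool (z \<in> reach A {y}))" using sub by (simp add: Int_absorb1)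
qed simp

end

text \<open>
  The functional of Duminil-Copin and Tassion.
\<close>

definition phi :: "'a set set \<Rightarrow> real \<Rightarrow> 'a \<Rightarrow> 'a set \<Rightarrow> real" where
  "phi E p v S = p * (\<Sum>(x, y)\<in>{(x, y). x \<in> S \<and> y \<notin> S \<and> {x, y} \<in> E}. rexp {e \<in> E. e \<subseteq> S} p {v} (\<lambda>K. of_bool (x \<in> K)))"

locale quasi_transitive_graph = bounded_degree E D for E :: "'a set set" and D +
  fixes V :: "'a set"
  assumes EV: "\<Union>E \<subseteq> V"
    and linked_V: "u \<in> V \<Longrightarrow> v \<in> V \<Longrightarrow> linked E u v"
    and representatives: "\<exists>R. finite R \<and> R \<subseteq> V \<and> (\<forall>v\<in>V. \<exists>x\<in>R. \<exists>\<phi>. bij_betw \<phi> V V \<and>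
      (\<forall>u\<in>V. \<forall>w\<in>V. {\<phi> u, \<phi> w} \<in> E \<longleftrightarrow> {u, w} \<in> E) \<and> \<phi> x = v)"
begin

text \<open>The quantities depend only on the orbit of the vertex, and finitely many pairs of
  representatives have to be joined by paths, so one exponent \<open>L\<close> serves all.\<close>

lemma comparability:
  "\<exists>L. \<forall>u\<in>V. \<forall>v\<in>V. \<forall>p h. 0 < p \<longrightarrow> p \<le> 1 \<longrightarrow> mono h \<longrightarrow> (\<forall>k. 0 \<le> h k) \<longrightarrow> cbdd E p h u \<longrightarrow>
    cbdd E p h v \<and> p ^ L * cexp E p h v \<le> cexp E p h u"
proof -
  obtain R where R: "finite R" "R \<subseteq> V" "\<And>v. v \<in> V \<Longrightarrow> \<exists>x\<in>R. \<exists>\<phi>. bij_betw \<phi> V V \<and>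
      (\<forall>u\<in>V. \<forall>w\<in>V. {\<phi> u, \<phi> w} \<in> E \<longleftrightarrow> {u, w} \<in> E) \<and> \<phi> x = v"
    using representatives by blast
  have "\<forall>a\<in>R. \<forall>b\<in>R. \<exists>k. \<forall>p h. 0 < p \<longrightarrow> p \<le> 1 \<longrightarrow> mono h \<longrightarrow> (\<forall>k. 0 \<le> h k) \<longrightarrow> cbdd E p h a \<longrightarrow>
    cbdd E p h b \<and> p ^ k * cexp E p h b \<le> cexp E p h a"
    using cexp_linked linked_V R(2) by (meson subsetD)
  then obtain k where k: "\<And>a b p h. a \<in> R \<Longrightarrow> b \<in> R \<Longrightarrow> 0 < p \<Longrightarrow> p \<le> 1 \<Longrightarrow> mono h \<Longrightarrow> (\<forall>k. 0 \<le> h k) \<Longrightarrow> cbdd E p h a \<Longrightarrow>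
    cbdd E p h b \<and> p ^ k a b * cexp E p h b \<le> cexp E p h a"
    by metis
  define L where "L = Max (insert 0 ((\<lambda>(a, b). k a b) ` (R \<times> R)))"
  have kL: "k a b \<le> L" if "a \<in> R" "b \<in> R" for a b
    unfolding L_def using that R(1) by (intro Max_ge) auto
  show ?thesis
  proof (intro exI[of _ L] ballI allI impI)
    fix u v p h assume uv: "u \<in> V" "v \<in> V" and a: "0 < p" "p \<le> 1" "mono h" "\<forall>k. (0::real) \<le> h k" "cbdd E p h u"
    obtain x \<phi> where x: "x \<in> R" "bij_betw \<phi> V V" "\<And>u w. u \<in> V \<Longrightarrow> w \<in> V \<Longrightarrow> {\<phi> u, \<phi> w} \<in> E \<longleftrightarrow> {u, w} \<in> E" "\<phi> x = u"
      using R(3)[OF uv(1)] by blast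
    obtain y \<psi> where y: "y \<in> R" "bij_betw \<psi> V V" "\<And>u w. u \<in> V \<Longrightarrow> w \<in> V \<Longrightarrow> {\<psi> u, \<psi> w} \<in> E \<longleftrightarrow> {u, w} \<in> E" "\<psi> y = v"
      using R(3)[OF uv(2)] by blast
    have xy: "x \<in> V" "y \<in> V" using x y R(2) by auto
    note cx = cexp_automorphism[OF x(2,3) EV xy(1), of p h, unfolded x(4)]
    note cy = cexp_automorphism[OF y(2,3) EV xy(2), of p h, unfolded y(4)]
    have b: "cbdd E p h x" using cx a by simp
    note c = k[OF x(1) y(1) a(1-4) b]
    have "0 \<le> rexp {} p {y} (\<lambda>K. h (card K))" using a by (intro rexp_nonneg) auto
    also have "\<dots> \<le> cexp E p h y" using c by (intro rexp_le_cexp) auto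
    finally have nn: "0 \<le> cexp E p h y" .
    have "p ^ L * cexp E p h y \<le> p ^ k x y * cexp E p h y"
      using a kL[OF x(1) y(1)] nn by (intro mult_right_mono power_decreasing) auto
    then show "cbdd E p h v \<and> p ^ L * cexp E p h v \<le> cexp E p h u"
      using c cx cy by auto
  qed
qed

lemma phi_mono:
  assumes "finite S" "0 \<le> p" "p \<le> q" "q \<le> 1"
  shows "phi E p v S \<le> phi E q v S"
  unfolding phi_def
proof (rule mult_mono)
  have fin: "finite {e \<in> E. e \<subseteq> S}"
    using finite_subset[of "{e \<in> E. e \<subseteq> S}" "Pow S"] assms(1) by auto
  have "rexp {e \<in> E. e \<subseteq> S} p {v} (\<lambda>K. of_bool (x \<in> K)) \<le> rexp {e \<in> E. e \<subseteq> S} q {v} (\<lambda>K. of_bool (x \<in> K))" for x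
    unfolding rexp_def using assms fin
    by (intro pexp_mono_weight) (auto dest!: reach_mono[of _ _ "{v}" "{v}"])
  then show "(\<Sum>(x, y)\<in>{(x, y). x \<in> S \<and> y \<notin> S \<and> {x, y} \<in> E}. rexp {e \<in> E. e \<subseteq> S} p {v} (\<lambda>K. of_bool (x \<in> K)))
    \<le> (\<Sum>(x, y)\<in>{(x, y). x \<in> S \<and> y \<notin> S \<and> {x, y} \<in> E}. rexp {e \<in> E. e \<subseteq> S} q {v} (\<lambda>K. of_bool (x \<in> K)))"
    by (intro sum_mono) auto
  show "0 \<le> (\<Sum>(x, y)\<in>{(x, y). x \<in> S \<and> y \<notin> S \<and> {x, y} \<in> E}. rexp {e \<in> E. e \<subseteq> S} p {v} (\<lambda>K. of_bool (x \<in> K)))"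
    using assms fin by (intro sum_nonneg) (auto intro!: rexp_nonneg)
qed (use assms in auto)

text \<open>The exploration starts outside a large ball \<open>W\<close>. If it stops before
  reaching \<open>v\<close>, the unexplored vertices form a finite set around \<open>v\<close>, on
  which the functional is at least 1; \<open>russo_lower\<close> turns this into a derivative of at
  least \<open>(1 - f q) / (q * (1 - q))\<close>, and \<open>q * (1 - q) \<le> 1 / 4\<close> gives
  the rate 4.\<close>

lemma theta_lower:
  assumes v: "v \<in> V" and p: "0 < p0" "p0 \<le> p" "p < 1"
    and bad: "\<And>S. finite S \<Longrightarrow> S \<subseteq> V \<Longrightarrow> v \<in> S \<Longrightarrow> 1 \<le> phi E p0 v S"
  shows "1 - exp (- 4 * (p - p0)) \<le> theta E p v"
proof (rule theta_ge)
  fix n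
  define W where "W = nball {v} n"
  have W: "finite W" "v \<in> W" "W \<subseteq> V"
    using finite_nball[of "{v}" n] nball_mono[of 0 n "{v}"] nball_subset_V[of "{v}" V n] v EV by (auto simp: W_def)
  define FW where "FW = {e \<in> E. e \<inter> W \<noteq> {}}"
  have FW: "finite FW" "FW \<subseteq> E" unfolding FW_def using finite_touching[OF W(1)] by auto
  let ?f = "\<lambda>K. of_bool (v \<in> K) :: real"
  define f where "f = (\<lambda>t. rexp FW t (- W) ?f)"
  have der: "\<exists>d. (f has_real_derivative d) (at q) \<and> 4 * (1 - f q) \<le> d" if q: "p0 \<le> q" "q \<le> p" for q
  proof -
    have q01: "0 < q" "q < 1" using q p by auto
    let ?h = "\<lambda>K. 1 / (q * (1 - q)) * (1 - of_bool (v \<in> K) :: real)"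
    have "\<exists>d. ((\<lambda>t. rexp FW t (- W) ?f) has_real_derivative d) (at q) \<and> rexp FW q (- W) ?h \<le> d"
    proof (rule russo_lower[OF FW(1) q01])
      fix F S
      assume F: "F \<subseteq> FW" and nc: "\<And>x y. x \<in> S \<Longrightarrow> {x, y} \<in> F \<Longrightarrow> y \<in> S"
        and cov: "\<And>e. e \<in> FW \<Longrightarrow> e \<inter> S = {} \<Longrightarrow> e \<in> F" and ex: "\<exists>A\<subseteq>FW. S = reach A (- W)"
      obtain A where "S = reach A (- W)" using ex by blast
      then have SW: "- W \<subseteq> S" using reach_superset[of "- W" A] by simp
      have finF: "finite F" using F FW finite_subset by blast
      show "(1 - q) * ?h S \<le> (\<Sum>(x, y)\<in>{(x, y). x \<in> S \<and> y \<notin> S \<and> {x, y} \<in> FW}. rexp F q (insert y S) ?f - ?f S)"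
      proof (cases "v \<in> S")
        case True
        have "rexp F q (insert y S) ?f = 1" for y
        proof -
          have "rexp F q (insert y S) ?f = rexp F q (insert y S) (\<lambda>_. 1)"
            unfolding rexp_def
          proof (rule pexp_cong)
            fix A show "?f (reach A (insert y S)) = 1"
              using reach_superset[of "insert y S" A] True by auto
          qed simp
          then show ?thesis using finF by simp
        qed
        then show ?thesis using True by (auto intro!: sum_nonneg)
      next
        case False
        \<comment> \<open>The unexplored vertices. All edges inside this set are still unknown, and
          its boundary pairs are those of \<open>S\<close> with the two ends exchanged.\<close>
        define S' where "S' = - S"
        have S': "finite S'" "S' \<subseteq> V" "v \<in> S'" using SW W False finite_subset[of "- S" W] by (auto simp: S'_def)
        define I where "I = {(x, y). x \<in> S' \<and> y \<notin> S' \<and> {x, y} \<in> E}"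
        have I: "{(x, y). x \<in> S \<and> y \<notin> S \<and> {x, y} \<in> FW} = prod.swap ` I"
          using SW by (auto simp: I_def S'_def FW_def image_iff insert_commute)
        have ES: "{e \<in> E. e \<subseteq> S'} \<subseteq> F"
        proof clarify
          fix e assume e: "e \<in> E" "e \<subseteq> S'"
          then have "e \<noteq> {}" using edge_card[OF e(1)] by auto
          moreover have "e \<subseteq> W" "e \<inter> S = {}" using e SW by (auto simp: S'_def)
          ultimately show "e \<in> F" using e by (intro cov) (auto simp: FW_def)
        qed
        have "1 \<le> phi E p0 v S'" using bad S' by blast
        also have "\<dots> \<le> phi E q v S'" using S' p q by (intro phi_mono) auto
        also have "\<dots> \<le> q * (\<Sum>(x, y)\<in>I. rexp F q (insert x S) ?f)"
          unfolding phi_def I_def[symmetric]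
        proof (intro mult_left_mono sum_mono, clarify)
          fix x y
          have "rexp {e \<in> E. e \<subseteq> S'} q {v} (\<lambda>K. of_bool (x \<in> K)) \<le> rexp F q {v} (\<lambda>K. of_bool (x \<in> K))"
            unfolding rexp_def using ES finF q01
            by (intro pexp_mono_set) (auto dest!: reach_mono[of _ _ "{v}" "{v}"])
          also have "\<dots> \<le> rexp F q (insert x S) ?f"
            unfolding rexp_def using finF q01
            by (intro pexp_mono) (auto simp: reach_sym[of x _ v] reach_insert[of _ x S])
          finally show "rexp {e \<in> E. e \<subseteq> S'} q {v} (\<lambda>K. of_bool (x \<in> K)) \<le> rexp F q (insert x S) ?f" .
        qed (use q01 in auto)
        finally have "1 / q \<le> (\<Sum>(x, y)\<in>I. rexp F q (insert x S) ?f)"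
          using q01 by (simp add: field_simps)
        also have "\<dots> = (\<Sum>(x, y)\<in>{(x, y). x \<in> S \<and> y \<notin> S \<and> {x, y} \<in> FW}. rexp F q (insert y S) ?f)"
          unfolding I by (subst sum.reindex) (auto simp: case_prod_beta)
        finally show ?thesis using False q01 by simp
      qed
    qed
    then obtain d where d: "(f has_real_derivative d) (at q)" "rexp FW q (- W) ?h \<le> d"
      unfolding f_def by blast
    have "rexp FW q (- W) ?h = 1 / (q * (1 - q)) * (1 - f q)"
      unfolding rexp_cmult rexp_diff f_def using FW by simp
    moreover have "4 \<le> 1 / (q * (1 - q))"
    proof -
      have "0 \<le> (2 * q - 1)\<^sup>2" by simp
      then have "4 * (q * (1 - q)) \<le> 1" by (simp add: power2_eq_square algebra_simps)
      then show ?thesis using q01 by (simp add: field_simps)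
    qed
    moreover have "f q \<le> 1" unfolding f_def using FW q01 by (intro rexp_le_const) auto
    ultimately have "4 * (1 - f q) \<le> d" using d(2) mult_right_mono[of 4 "1 / (q * (1 - q))" "1 - f q"] by simp
    then show ?thesis using d by blast
  qed
  \<comment> \<open>Gronwall's argument for the probability \<open>1 - f t\<close> of no
    connection.\<close>
  have "(1 - f p) * exp (4 * p) \<le> (1 - f p0) * exp (4 * p0)"
  proof (rule DERIV_nonpos_imp_nonincreasing[OF p(2)])
    fix q assume q: "p0 \<le> q" "q \<le> p"
    then obtain d where d: "(f has_real_derivative d) (at q)" "4 * (1 - f q) \<le> d" using der by blast
    have "((\<lambda>t. (1 - f t) * exp (4 * t)) has_real_derivative ((4 * (1 - f q) - d) * exp (4 * q))) (at q)"
      by (auto intro!: derivative_eq_intros d(1) simp: algebra_simps)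
    moreover have "(4 * (1 - f q) - d) * exp (4 * q) \<le> 0" using d by (intro mult_nonpos_nonneg) auto
    ultimately show "\<exists>y. ((\<lambda>t. (1 - f t) * exp (4 * t)) has_real_derivative y) (at q) \<and> y \<le> 0" by blast
  qed
  also have "0 \<le> f p0" unfolding f_def using FW p by (intro rexp_nonneg) auto
  then have "(1 - f p0) * exp (4 * p0) \<le> exp (4 * p0)" by simp
  finally have "(1 - f p) \<le> exp (4 * p0) / exp (4 * p)" by (simp add: field_simps)
  then have "1 - f p \<le> exp (- 4 * (p - p0))" unfolding exp_diff[symmetric] by (simp add: algebra_simps)
  moreover have "f p \<le> tail E p n v"
  proof -
    have "f p = rexp FW p {v} (\<lambda>K. of_bool (\<not> K \<subseteq> W))"
      unfolding f_def rexp_def by (intro pexp_cong) (auto simp: reach_compl)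
    also have "\<dots> \<le> tail E p n v" unfolding W_def using p FW by (intro exit_ball_le_tail) auto
    finally show ?thesis .
  qed
  ultimately show "1 - exp (- 4 * (p - p0)) \<le> tail E p n v" by simp
qed

lemma phi_automorphism:
  assumes \<phi>: "bij_betw \<phi> V V" "\<And>u v. u \<in> V \<Longrightarrow> v \<in> V \<Longrightarrow> {\<phi> u, \<phi> v} \<in> E \<longleftrightarrow> {u, v} \<in> E"
    and S: "finite S" "S \<subseteq> V" "v \<in> S"
  shows "phi E p (\<phi> v) (\<phi> ` S) = phi E p v S"
proof -
  have inj: "inj_on \<phi> V" and surj: "\<phi> ` V = V" using \<phi> by (auto simp: bij_betw_def)
  have EV': "e \<subseteq> V" if "e \<in> E" for e using that EV by auto
  have finS: "finite {e \<in> E. e \<subseteq> S}" using finite_subset[of "{e \<in> E. e \<subseteq> S}" "Pow S"] S by auto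
  have inS: "\<phi> y \<in> \<phi> ` S \<longleftrightarrow> y \<in> S" if "y \<in> V" for y using that S inj by (auto dest: inj_onD)
  have pre: "\<exists>y\<in>V. b = \<phi> y" if "b \<in> V" for b using that surj by blast
  have im: "{e \<in> E. e \<subseteq> \<phi> ` S} = (`) \<phi> ` {e \<in> E. e \<subseteq> S}"
  proof (intro set_eqI iffI)
    fix e assume "e \<in> {e \<in> E. e \<subseteq> \<phi> ` S}"
    then have e: "e \<in> E" "e \<subseteq> \<phi> ` S" by auto
    obtain a b where ab: "e = {a, b}" using edgeE[OF e(1)] by blast
    then obtain x y where xy: "x \<in> S" "y \<in> S" "a = \<phi> x" "b = \<phi> y" using e by auto
    then have "{x, y} \<in> E" using \<phi>(2)[of x y] S e ab by auto
    moreover have "e = \<phi> ` {x, y}" using ab xy by auto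
    ultimately show "e \<in> (`) \<phi> ` {e \<in> E. e \<subseteq> S}" using xy by blast
  next
    fix e assume "e \<in> (`) \<phi> ` {e \<in> E. e \<subseteq> S}"
    then obtain d where d: "d \<in> E" "d \<subseteq> S" "e = \<phi> ` d" by auto
    obtain x y where xy: "d = {x, y}" using edgeE[OF d(1)] by blast
    then show "e \<in> {e \<in> E. e \<subseteq> \<phi> ` S}" using d \<phi>(2)[of x y] S by auto
  qed
  have bd: "{(x, y). x \<in> \<phi> ` S \<and> y \<notin> \<phi> ` S \<and> {x, y} \<in> E} = map_prod \<phi> \<phi> ` {(x, y). x \<in> S \<and> y \<notin> S \<and> {x, y} \<in> E}"
  proof (intro set_eqI iffI)
    fix z assume "z \<in> {(x, y). x \<in> \<phi> ` S \<and> y \<notin> \<phi> ` S \<and> {x, y} \<in> E}"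
    then obtain a b where ab: "z = (a, b)" "a \<in> \<phi> ` S" "b \<notin> \<phi> ` S" "{a, b} \<in> E" by auto
    then obtain x where x: "x \<in> S" "a = \<phi> x" by auto
    obtain y where y: "y \<in> V" "b = \<phi> y" using pre[of b] EV'[OF ab(4)] by auto
    have "y \<notin> S" using y ab by auto
    moreover have "{x, y} \<in> E" using \<phi>(2)[of x y] x y S ab by auto
    ultimately show "z \<in> map_prod \<phi> \<phi> ` {(x, y). x \<in> S \<and> y \<notin> S \<and> {x, y} \<in> E}"
      using ab x y by (auto intro!: image_eqI[of _ _ "(x, y)"])
  next
    fix z assume "z \<in> map_prod \<phi> \<phi> ` {(x, y). x \<in> S \<and> y \<notin> S \<and> {x, y} \<in> E}"
    then obtain x y where xy: "z = (\<phi> x, \<phi> y)" "x \<in> S" "y \<notin> S" "{x, y} \<in> E" by auto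
    have "y \<in> V" "x \<in> V" using EV'[OF xy(4)] by auto
    then show "z \<in> {(x, y). x \<in> \<phi> ` S \<and> y \<notin> \<phi> ` S \<and> {x, y} \<in> E}" using xy \<phi>(2)[of x y] inS[of y] by auto
  qed
  have injb: "inj_on (map_prod \<phi> \<phi>) {(x, y). x \<in> S \<and> y \<notin> S \<and> {x, y} \<in> E}"
  proof (rule inj_on_subset)
    show "inj_on (map_prod \<phi> \<phi>) (V \<times> V)" using map_prod_inj_on[OF inj inj] .
    show "{(x, y). x \<in> S \<and> y \<notin> S \<and> {x, y} \<in> E} \<subseteq> V \<times> V" using EV' by fastforce
  qed
  have r: "rexp {e \<in> E. e \<subseteq> \<phi> ` S} p {\<phi> v} (\<lambda>K. of_bool (\<phi> x \<in> K)) = rexp {e \<in> E. e \<subseteq> S} p {v} (\<lambda>K. of_bool (x \<in> K))"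
    if "x \<in> S" for x
  proof -
    have "inj_on ((`) \<phi>) {e \<in> E. e \<subseteq> S}"
      using EV' inj by (intro inj_onI) (metis (no_types, lifting) inj_on_image_eq_iff mem_Collect_eq)
    then have "rexp {e \<in> E. e \<subseteq> \<phi> ` S} p {\<phi> v} (\<lambda>K. of_bool (\<phi> x \<in> K)) =
        pexp {e \<in> E. e \<subseteq> S} (\<lambda>_. p) (\<lambda>A. of_bool (\<phi> x \<in> reach ((`) \<phi> ` A) {\<phi> v}))"
      unfolding rexp_def im using finS by (intro pexp_image) auto
    also have "\<dots> = rexp {e \<in> E. e \<subseteq> S} p {v} (\<lambda>K. of_bool (x \<in> K))"
      unfolding rexp_def
    proof (rule pexp_cong)
      fix A assume A: "A \<subseteq> {e \<in> E. e \<subseteq> S}"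
      then have AV: "\<Union>A \<subseteq> V" using S by blast
      have V: "reach A {v} \<subseteq> V" using reach_subset_Union[of A "{v}"] S AV by blast
      have "\<phi> x \<in> \<phi> ` reach A {v} \<longleftrightarrow> x \<in> reach A {v}"
        using V that S inj by (auto dest: inj_onD)
      then show "of_bool (\<phi> x \<in> reach ((`) \<phi> ` A) {\<phi> v}) = (of_bool (x \<in> reach A {v}) :: real)"
        using reach_image[OF inj AV] S by auto
    qed simp
    finally show ?thesis .
  qed
  show ?thesis
    unfolding phi_def bd sum.reindex[OF injb]
    by (intro arg_cong[of _ _ "(*) p"] sum.cong) (auto simp: r)
qed

text \<open>Splitting a connection at its first exit from a good set around the starting point gives
  \<open>X \<le> s + a * X\<close> with \<open>a < 1\<close>, for \<open>X\<close> the supremum of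
  the mean cluster sizes. The edge set \<open>F\<close> is fixed so that \<open>X\<close> is finite;
  the resulting bound does not depend on it. Quasi-transitivity makes \<open>s\<close> and
  \<open>a\<close> uniform.\<close>

lemma susceptibility_bounded:
  assumes p: "0 \<le> p" "p \<le> 1"
    and good: "\<And>v. v \<in> V \<Longrightarrow> \<exists>S. finite S \<and> S \<subseteq> V \<and> v \<in> S \<and> phi E p v S < 1"
  shows "\<exists>X. \<forall>v\<in>V. \<forall>F. finite F \<longrightarrow> F \<subseteq> E \<longrightarrow> rexp F p {v} (\<lambda>K. real (card K)) \<le> X"
proof -
  obtain R where R: "finite R" "R \<subseteq> V" "\<And>v. v \<in> V \<Longrightarrow> \<exists>x\<in>R. \<exists>\<phi>. bij_betw \<phi> V V \<and>
      (\<forall>u\<in>V. \<forall>w\<in>V. {\<phi> u, \<phi> w} \<in> E \<longleftrightarrow> {u, w} \<in> E) \<and> \<phi> x = v"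
    using representatives by blast
  have "\<forall>x\<in>R. \<exists>S. finite S \<and> S \<subseteq> V \<and> x \<in> S \<and> phi E p x S < 1" using good R(2) by blast
  then obtain T where T: "\<And>x. x \<in> R \<Longrightarrow> finite (T x) \<and> T x \<subseteq> V \<and> x \<in> T x \<and> phi E p x (T x) < 1" by metis
  define s where "s = Max (insert 0 ((\<lambda>x. card (T x)) ` R))"
  define a where "a = Max (insert 0 ((\<lambda>x. phi E p x (T x)) ` R))"
  have s: "card (T x) \<le> s" and a: "phi E p x (T x) \<le> a" if "x \<in> R" for x
    unfolding s_def a_def using that R(1) by (auto intro!: Max_ge)
  have a1: "0 \<le> a" "a < 1" unfolding a_def using R(1) T by auto
  have ex: "\<exists>S. finite S \<and> S \<subseteq> V \<and> v \<in> S \<and> phi E p v S \<le> a \<and> card S \<le> s" if v: "v \<in> V" for v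
  proof -
    obtain x \<phi> where x: "x \<in> R" "bij_betw \<phi> V V" "\<And>u w. u \<in> V \<Longrightarrow> w \<in> V \<Longrightarrow> {\<phi> u, \<phi> w} \<in> E \<longleftrightarrow> {u, w} \<in> E" "\<phi> x = v"
      using R(3)[OF v] by blast
    have Tx: "finite (T x)" "T x \<subseteq> V" "x \<in> T x" using T[OF x(1)] by auto
    have "\<phi> ` T x \<subseteq> V" using Tx x(2) by (auto simp: bij_betw_def)
    moreover have "card (\<phi> ` T x) \<le> s" using card_image_le[OF Tx(1), of \<phi>] s[OF x(1)] by simp
    moreover have "phi E p v (\<phi> ` T x) \<le> a"
      using phi_automorphism[OF x(2,3) Tx, of p] a[OF x(1)] x(4) by simp
    ultimately show ?thesis using Tx x(4) by (intro exI[of _ "\<phi> ` T x"]) auto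
  qed
  show ?thesis
  proof (intro exI[of _ "s / (1 - a)"] ballI allI impI)
    fix v F assume v: "v \<in> V" and F: "finite F" "F \<subseteq> E"
    let ?c = "\<lambda>K :: 'a set. real (card K)"
    define U where "U = \<Union>F"
    have U: "finite U" using F edge_finite by (auto simp: U_def)
    have bound: "rexp F p {w} ?c \<le> card U + 1" for w
    proof (rule rexp_le_const)
      fix A assume "A \<subseteq> F"
      then have "reach A {w} \<subseteq> insert w U" using reach_subset_Union[of A "{w}"] by (auto simp: U_def)
      then have "card (reach A {w}) \<le> card (insert w U)" using U by (intro card_mono) auto
      also have "\<dots> \<le> card U + 1" using U by (simp add: card_insert_if)
      finally show "?c (reach A {w}) \<le> card U + 1" by simp
    qed (use F p in auto)
    define X where "X = (SUP w\<in>V. rexp F p {w} ?c)"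
    have bdd: "bdd_above ((\<lambda>w. rexp F p {w} ?c) ` V)" using bound by (intro bdd_aboveI[of _ "real (card U + 1)"]) auto
    have leX: "rexp F p {w} ?c \<le> X" if "w \<in> V" for w unfolding X_def using that bdd by (rule cSUP_upper)
    have X0: "0 \<le> X" using leX[OF v] rexp_nonneg[of F p ?c "{v}"] F p by auto
    have "rexp F p {w} ?c \<le> s + a * X" if w: "w \<in> V" for w
    proof -
      obtain S where S: "finite S" "S \<subseteq> V" "w \<in> S" "phi E p w S \<le> a" "card S \<le> s" using ex[OF w] by blast
      define I where "I = {(y, y'). y \<in> - S \<and> y' \<notin> - S \<and> {y, y'} \<in> F}"
      have U': "finite (insert w U)" using U by simp
      have one: "rexp F p {w} (\<lambda>K. of_bool (z \<in> K)) \<le> 1" for z using F p by (intro rexp_le_const) auto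
      \<comment> \<open>\<open>last_exit\<close> for the complement of \<open>S\<close>, seen from
        \<open>z\<close>: the pair \<open>(y, y')\<close> is where the path from \<open>w\<close>
        steps out of \<open>S\<close>, so \<open>w\<close> and \<open>y'\<close> are connected
        inside \<open>S\<close>.\<close>
      have exit: "rexp F p {w} (\<lambda>K. of_bool (z \<in> K)) \<le>
        (\<Sum>(y, y')\<in>I. p * rexp F p {z} (\<lambda>K. of_bool (y \<in> K)) * rexp {e \<in> F. e \<inter> - S = {}} p {w} (\<lambda>K. of_bool (y' \<in> K)))"
        if "z \<notin> S" for z
        unfolding I_def using that S F p by (intro last_exit) auto
      have FS: "{e \<in> F. e \<inter> - S = {}} \<subseteq> {e \<in> E. e \<subseteq> S}" using F by auto
      have finS: "finite {e \<in> E. e \<subseteq> S}" using finite_subset[of "{e \<in> E. e \<subseteq> S}" "Pow S"] S by auto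
      have g: "rexp {e \<in> F. e \<inter> - S = {}} p {w} (\<lambda>K. of_bool (y' \<in> K)) \<le> rexp {e \<in> E. e \<subseteq> S} p {w} (\<lambda>K. of_bool (y' \<in> K))" for y'
        unfolding rexp_def using FS finS p
        by (intro pexp_mono_set) (auto dest!: reach_mono[of _ _ "{w}" "{w}"])
      have col: "(\<Sum>z\<in>insert w U - S. rexp F p {z} (\<lambda>K. of_bool (y \<in> K))) \<le> X" if "y \<in> V" for y
      proof -
        have "(\<Sum>z\<in>insert w U - S. rexp F p {z} (\<lambda>K. of_bool (y \<in> K))) = (\<Sum>z\<in>insert w U - S. rexp F p {y} (\<lambda>K. of_bool (z \<in> K)))"
          unfolding rexp_def by (intro sum.cong refl pexp_cong) (auto simp: reach_sym)
        also have "\<dots> \<le> rexp F p {y} ?c" using U' F p by (intro rexp_card_ge_sum) auto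
        also have "\<dots> \<le> X" by (rule leX[OF that])
        finally show ?thesis .
      qed
      have "rexp F p {w} ?c = (\<Sum>z\<in>insert w U \<inter> S. rexp F p {w} (\<lambda>K. of_bool (z \<in> K))) +
          (\<Sum>z\<in>insert w U - S. rexp F p {w} (\<lambda>K. of_bool (z \<in> K)))"
        unfolding rexp_card_eq_sum[of "insert w U" w F, unfolded U_def, OF U'[unfolded U_def] order_refl]
        using U' by (subst sum.Int_Diff[of _ _ S]) (auto simp: U_def)
      also have "\<dots> \<le> (\<Sum>z\<in>insert w U \<inter> S. 1) + (\<Sum>z\<in>insert w U - S.
          (\<Sum>(y, y')\<in>I. p * rexp F p {z} (\<lambda>K. of_bool (y \<in> K)) * rexp {e \<in> F. e \<inter> - S = {}} p {w} (\<lambda>K. of_bool (y' \<in> K))))"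
        by (intro add_mono sum_mono one exit) auto
      also have "(\<Sum>z\<in>insert w U \<inter> S. 1 :: real) \<le> s"
      proof -
        have "card (insert w U \<inter> S) \<le> card S" using S by (intro card_mono) auto
        then show ?thesis using S by simp
      qed
      also have "(\<Sum>z\<in>insert w U - S. (\<Sum>(y, y')\<in>I. p * rexp F p {z} (\<lambda>K. of_bool (y \<in> K)) * rexp {e \<in> F. e \<inter> - S = {}} p {w} (\<lambda>K. of_bool (y' \<in> K))))
        = (\<Sum>(y, y')\<in>I. p * rexp {e \<in> F. e \<inter> - S = {}} p {w} (\<lambda>K. of_bool (y' \<in> K)) * (\<Sum>z\<in>insert w U - S. rexp F p {z} (\<lambda>K. of_bool (y \<in> K))))"
        by (subst sum.swap) (auto simp: sum_distrib_left sum_distrib_right mult_ac intro!: sum.cong)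
      also have "\<dots> \<le> (\<Sum>(y, y')\<in>I. p * rexp {e \<in> E. e \<subseteq> S} p {w} (\<lambda>K. of_bool (y' \<in> K)) * X)"
      proof (intro sum_mono, clarify)
        fix y y' assume "(y, y') \<in> I"
        then have "y \<in> V" using F EV by (auto simp: I_def)
        have nn: "0 \<le> rexp {e \<in> E. e \<subseteq> S} p {w} (\<lambda>K. of_bool (y' \<in> K))" using finS p by (intro rexp_nonneg) auto
        show "p * rexp {e \<in> F. e \<inter> - S = {}} p {w} (\<lambda>K. of_bool (y' \<in> K)) * (\<Sum>z\<in>insert w U - S. rexp F p {z} (\<lambda>K. of_bool (y \<in> K)))
          \<le> p * rexp {e \<in> E. e \<subseteq> S} p {w} (\<lambda>K. of_bool (y' \<in> K)) * X"
          using p g[of y'] col[OF \<open>y \<in> V\<close>] nn F finS by (intro mult_mono mult_left_mono sum_nonneg rexp_nonneg mult_nonneg_nonneg) auto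
      qed
      also have "\<dots> \<le> phi E p w S * X"
      proof -
        define J where "J = {(x, y). x \<in> S \<and> y \<notin> S \<and> {x, y} \<in> E}"
        have finJ: "finite J"
        proof -
          have "J = {(x, y). x \<in> S \<and> y \<notin> S \<and> {x, y} \<in> {e \<in> E. e \<inter> S \<noteq> {}}}" by (auto simp: J_def)
          then show ?thesis using finite_crossing_pairs(1)[OF finite_touching[OF S(1)], of S] by simp
        qed
        have IJ: "prod.swap ` I \<subseteq> J" using F by (auto simp: I_def J_def insert_commute)
        have "(\<Sum>(y, y')\<in>I. p * rexp {e \<in> E. e \<subseteq> S} p {w} (\<lambda>K. of_bool (y' \<in> K)) * X) =
          (\<Sum>(x, y)\<in>prod.swap ` I. p * rexp {e \<in> E. e \<subseteq> S} p {w} (\<lambda>K. of_bool (x \<in> K)) * X)"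
          by (subst sum.reindex) (auto simp: case_prod_beta)
        also have "\<dots> \<le> (\<Sum>(x, y)\<in>J. p * rexp {e \<in> E. e \<subseteq> S} p {w} (\<lambda>K. of_bool (x \<in> K)) * X)"
          using finJ IJ p X0 finS by (intro sum_mono2) (auto intro!: mult_nonneg_nonneg rexp_nonneg)
        also have "\<dots> = phi E p w S * X"
          unfolding phi_def J_def[symmetric] by (simp add: sum_distrib_left sum_distrib_right case_prod_beta)
        finally show ?thesis .
      qed
      also have "\<dots> \<le> a * X" using S X0 by (intro mult_right_mono) auto
      finally show ?thesis by simp
    qed
    then have "X \<le> s + a * X" unfolding X_def using v by (intro cSUP_least) (auto simp: X_def)
    then have "X \<le> s / (1 - a)" using a1 by (simp add: field_simps)
    then show "rexp F p {v} ?c \<le> s / (1 - a)" using leX[OF v] by simp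
  qed
qed

end

section \<open>Boundary estimates from the L2 bound\<close>

text \<open>An increment form of g' >= c g^2, suited to a function that is only known as a supremum.
  If the bound failed at \<open>s\<close>, \<open>g\<close> would double along the points
  \<open>q k\<close>, which accumulate at \<open>q'\<close> before \<open>b\<close>, and
  \<open>g q'\<close> would exceed every real.\<close>

lemma quadratic_growth_bound:
  fixes g :: "real \<Rightarrow> real"
  assumes c: "c > 0" and C0: "C0 > 0"
    and grow: "\<And>s t. lo \<le> s \<Longrightarrow> s < t \<Longrightarrow> t < b \<Longrightarrow> C0 \<le> g s \<Longrightarrow> g s + c * (t - s) * (g s)\<^sup>2 \<le> g t"
    and s: "lo \<le> s" "s < b"
  shows "g s \<le> max C0 (2 / (c * (b - s)))"
proof (rule ccontr)
  assume "\<not> ?thesis"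
  then have x: "C0 < g s" "2 / (c * (b - s)) < g s" by auto
  define x where "x = g s"
  have x0: "x > 0" "C0 < x" using x C0 by (auto simp: x_def)
  \<comment> \<open>At \<open>q k\<close> the value is at least \<open>2 ^ k * x\<close>, so a
    further distance \<open>1 / (c * x * 2 ^ k)\<close> suffices for the next doubling; the
    distances add up to \<open>2 / (c * x)\<close>.\<close>
  define q where "q = (\<lambda>k :: nat. s + 2 / (c * x) * (1 - 1 / 2 ^ k))"
  define q' where "q' = s + 2 / (c * x)"
  have q'b: "q' < b"
  proof -
    have "2 < x * (c * (b - s))" using x(2) c s unfolding x_def by (simp add: field_simps)
    then have "2 / (c * x) < b - s" using c x0 by (simp add: field_simps)
    then show ?thesis by (simp add: q'_def)
  qed
  have qq': "q k < q'" "s \<le> q k" for k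
    unfolding q_def q'_def using c x0 by (auto intro!: mult_nonneg_nonneg simp: field_simps)
  have dbl: "2 ^ k * x \<le> g (q k)" for k
  proof (induction k)
    case (Suc k)
    have pos: "2 ^ k * x \<ge> x" using x0 by simp
    have st: "q (Suc k) - q k = 1 / (c * x * 2 ^ k)"
      unfolding q_def using c x0 by (simp add: field_simps)
    have lt: "q k < q (Suc k)" using st c x0 by (smt (verit) divide_pos_pos mult_pos_pos zero_less_power)
    have gk: "2 ^ k * x \<le> g (q k)" by (rule Suc.IH)
    have g0: "0 < g (q k)" using gk pos x0 by linarith
    have "g (q k) \<le> c * (q (Suc k) - q k) * (g (q k))\<^sup>2"
    proof -
      have "1 \<le> g (q k) / (2 ^ k * x)" using gk x0 by (simp add: field_simps)
      then have "g (q k) * 1 \<le> g (q k) * (g (q k) / (2 ^ k * x))" using g0 by (intro mult_left_mono) auto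
      also have "\<dots> = c * (q (Suc k) - q k) * (g (q k))\<^sup>2"
        unfolding st using c x0 by (simp add: field_simps power2_eq_square)
      finally show ?thesis by simp
    qed
    moreover have "g (q k) + c * (q (Suc k) - q k) * (g (q k))\<^sup>2 \<le> g (q (Suc k))"
    proof (rule grow)
      show "C0 \<le> g (q k)" using gk pos x0 by linarith
    qed (use qq'[of k] qq'[of "Suc k"] lt q'b s in auto)
    ultimately show ?case using gk by simp
  qed (simp add: q_def x_def)
  have le: "2 ^ k * x \<le> g q'" for k
  proof -
    have pos: "2 ^ k * x \<ge> x" using x0 by simp
    have "g (q k) + c * (q' - q k) * (g (q k))\<^sup>2 \<le> g q'"
    proof (rule grow)
      show "C0 \<le> g (q k)" using dbl[of k] pos x0 by linarith
    qed (use qq'[of k] q'b s in auto)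
    moreover have "0 \<le> c * (q' - q k) * (g (q k))\<^sup>2" using qq'[of k] c by (intro mult_nonneg_nonneg) auto
    ultimately show ?thesis using dbl[of k] by linarith
  qed
  obtain k :: nat where "g q' / x < 2 ^ k" using real_arch_pow[of 2 "g q' / x"] by auto
  then have "g q' < 2 ^ k * x" using x0 by (simp add: field_simps)
  with le[of k] show False by simp
qed

text \<open>
  In the application \<open>\<tau>\<close> is the two-point function at some \<open>ph\<close> between \<open>p_c\<close> and \<open>p_2_2\<close>.
\<close>

locale l2_bounded_graph = quasi_transitive_graph +
  fixes \<tau> :: "'a \<Rightarrow> 'a \<Rightarrow> real" and M ph :: real
  assumes ph: "0 < ph" "ph \<le> 1" and M: "0 < M"
    and tau: "\<And>F x y. finite F \<Longrightarrow> F \<subseteq> E \<Longrightarrow> x \<in> V \<Longrightarrow> y \<in> V \<Longrightarrow> rexp F ph {x} (\<lambda>K. of_bool (y \<in> K)) \<le> \<tau> x y"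
    and l2_bound: "\<And>S a. finite S \<Longrightarrow> S \<subseteq> V \<Longrightarrow> (\<And>y. 0 \<le> a y) \<Longrightarrow>
      (\<Sum>x\<in>S. \<Sum>y\<in>S. \<tau> x y * a y) \<le> M * sqrt (card S) * sqrt (\<Sum>y\<in>S. (a y)\<^sup>2)"
begin

lemma tau_p:
  assumes "0 \<le> p" "p \<le> ph" "finite F" "F \<subseteq> E" "x \<in> V" "y \<in> V"
  shows "rexp F p {x} (\<lambda>K. of_bool (y \<in> K)) \<le> \<tau> x y"
proof -
  have "rexp F p {x} (\<lambda>K. of_bool (y \<in> K)) \<le> rexp F ph {x} (\<lambda>K. of_bool (y \<in> K))"
    unfolding rexp_def using assms ph
    by (intro pexp_mono_weight) (auto dest!: reach_mono[of _ _ "{x}" "{x}"])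
  then show ?thesis using tau[OF assms(3-6)] by simp
qed

lemma tau_nonneg: "x \<in> V \<Longrightarrow> y \<in> V \<Longrightarrow> 0 \<le> \<tau> x y"
  using rexp_nonneg[of "{}" ph "\<lambda>K. of_bool (y \<in> K)" "{x}"] tau[of "{}" x y] ph by simp

text \<open>The bilinear form of \<open>\<tau>\<close> is tested on the indicator of
  \<open>S\<close> and on \<open>a\<close>. Bounding the square of \<open>a\<close> by
  \<open>A * a\<close> then turns the quadratic norm into the sum of \<open>a\<close>.\<close>

lemma l2_lower:
  assumes S: "finite S" "S \<subseteq> V" "S \<noteq> {}" and a: "\<And>y. 0 \<le> a y" "\<And>y. y \<in> S \<Longrightarrow> a y \<le> A"
    and b: "0 \<le> b" "\<And>x. x \<in> S \<Longrightarrow> b \<le> (\<Sum>y\<in>S. \<tau> x y * a y)"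
  shows "b\<^sup>2 * card S \<le> M\<^sup>2 * A * (\<Sum>y\<in>S. a y)"
proof -
  have "b * card S = (\<Sum>x\<in>S. b)" by simp
  also have "\<dots> \<le> (\<Sum>x\<in>S. \<Sum>y\<in>S. \<tau> x y * a y)" by (intro sum_mono b)
  also have "\<dots> \<le> M * sqrt (card S) * sqrt (\<Sum>y\<in>S. (a y)\<^sup>2)" using S a by (intro l2_bound) auto
  finally have "(b * card S)\<^sup>2 \<le> (M * sqrt (card S) * sqrt (\<Sum>y\<in>S. (a y)\<^sup>2))\<^sup>2"
    using b by (intro power_mono) auto
  also have "\<dots> = M\<^sup>2 * card S * (\<Sum>y\<in>S. (a y)\<^sup>2)"
    by (simp add: power_mult_distrib sum_nonneg)
  also have "\<dots> \<le> M\<^sup>2 * card S * (\<Sum>y\<in>S. A * a y)"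
    using a by (intro mult_left_mono sum_mono) (auto simp: power2_eq_square intro!: mult_right_mono)
  also have "(\<Sum>y\<in>S. A * a y) = A * (\<Sum>y\<in>S. a y)" by (simp add: sum_distrib_left)
  finally have "(b\<^sup>2 * card S) * card S \<le> (M\<^sup>2 * A * (\<Sum>y\<in>S. a y)) * card S"
    by (simp add: power2_eq_square algebra_simps)
  moreover have "0 < real (card S)" using S by (simp add: card_gt_0_iff)
  ultimately show ?thesis by (rule mult_right_le_imp_le)
qed

lemma boundary_Sigma: "{(x, y). x \<in> S \<and> y \<notin> S \<and> {x, y} \<in> E} = Sigma S (\<lambda>x. {y. y \<notin> S \<and> {x, y} \<in> E})"
  by auto

lemma neighbours: "finite {y. y \<notin> S \<and> {x, y} \<in> E}" "card {y. y \<notin> S \<and> {x, y} \<in> E} \<le> D"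
proof -
  have inj: "inj_on (\<lambda>y. {x, y}) {y. y \<notin> S \<and> {x, y} \<in> E}" by (auto simp: inj_on_def doubleton_eq_iff)
  have sub: "(\<lambda>y. {x, y}) ` {y. y \<notin> S \<and> {x, y} \<in> E} \<subseteq> {e \<in> E. x \<in> e}" by auto
  show fin: "finite {y. y \<notin> S \<and> {x, y} \<in> E}" using inj sub finite_incident by (meson finite_imageD finite_subset)
  have "card {y. y \<notin> S \<and> {x, y} \<in> E} \<le> card {e \<in> E. x \<in> e}"
    using card_inj_on_le[OF inj sub finite_incident] .
  then show "card {y. y \<notin> S \<and> {x, y} \<in> E} \<le> D" using degree_le[of x] by simp
qed

text \<open>Cauchy--Schwarz brings \<open>T\<close> squared on the left and the pointwise bound
  \<open>D * T\<close> for the boundary sums \<open>a\<close> on the right. One power of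
  \<open>T\<close> cancels, which makes the estimate linear in \<open>T\<close>.\<close>

lemma boundary_theta:
  assumes p: "0 \<le> p" "p \<le> ph" and S: "finite S" "S \<subseteq> V" "S \<noteq> {}"
    and T: "0 < T" "0 \<le> k" "\<And>v. v \<in> V \<Longrightarrow> k * T \<le> theta E p v \<and> theta E p v \<le> T"
  shows "k\<^sup>2 * T * card S \<le> M\<^sup>2 * D * (\<Sum>(x, y)\<in>{(x, y). x \<in> S \<and> y \<notin> S \<and> {x, y} \<in> E}. theta (off E S) p y)"
proof -
  have p1: "p \<le> 1" using p ph by simp
  define N where "N = (\<lambda>x. {y. y \<notin> S \<and> {x, y} \<in> E})"
  have fN: "finite (N y)" "card (N y) \<le> D" for y unfolding N_def by (rule neighbours)+
  have NV: "y \<in> V" if "y \<in> N x" for x y using that EV by (auto simp: N_def)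
  define a where "a = (\<lambda>y. \<Sum>y'\<in>N y. theta (off E S) p y')"
  have a0: "0 \<le> a y" for y unfolding a_def using p p1 by (intro sum_nonneg theta_nonneg) auto
  have aA: "a y \<le> D * T" for y
  proof -
    have "a y \<le> (\<Sum>y'\<in>N y. T)"
      unfolding a_def
    proof (rule sum_mono)
      fix y' assume "y' \<in> N y"
      then show "theta (off E S) p y' \<le> T"
        using theta_mono_set[OF p(1) p1 off_subset, of E S y'] T(3)[OF NV] by fastforce
    qed
    also have "\<dots> \<le> D * T" using fN(2)[of y] T(1) by simp
    finally show ?thesis .
  qed
  have b: "k * T \<le> (\<Sum>y\<in>S. \<tau> x y * a y)" if x: "x \<in> S" for x
  proof -
    have xV: "x \<in> V" using x S by auto
    have n: "theta E p x \<le> (\<Sum>y\<in>S. \<Sum>y'\<in>N y. \<tau> x y * tail (off E S) p n y')" for n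
    proof -
      \<comment> \<open>The ball is built around \<open>S\<close> together with its neighbours,
        because \<open>exit_ball_le_tail\<close> wants the starting point \<open>y'\<close> in the
        centre set.\<close>
      define S1 where "S1 = nball S 1"
      define W where "W = nball S1 n"
      have S1: "finite S1" "S \<subseteq> S1" "\<And>y y'. y \<in> S \<Longrightarrow> y' \<in> N y \<Longrightarrow> y' \<in> S1"
        using finite_nball[OF S(1), of 1] by (auto simp: S1_def N_def)
      have W: "finite W" "S \<subseteq> W" using finite_nball[OF S1(1)] nball_mono[of 0 n S1] S1(2) by (auto simp: W_def)
      define FW where "FW = {e \<in> E. e \<inter> W \<noteq> {}}"
      have FW: "finite FW" "FW \<subseteq> E" unfolding FW_def using finite_touching[OF W(1)] by auto
      have "theta E p x \<le> rexp FW p {x} (\<lambda>K. of_bool (\<not> K \<subseteq> W))"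
        using theta_le_exit[OF W(1) p(1) p1, of "{}" x] by (simp add: FW_def)
      also have "\<dots> = rexp FW p (- W) (\<lambda>K. of_bool (x \<in> K))"
        unfolding rexp_def by (intro pexp_cong) (auto simp: reach_compl)
      also have "\<dots> \<le> (\<Sum>(y, y')\<in>{(y, y'). y \<in> S \<and> y' \<notin> S \<and> {y, y'} \<in> FW}.
         p * \<tau> x y * rexp {e \<in> FW. e \<inter> S = {}} p (- W) (\<lambda>K. of_bool (y' \<in> K)))"
        using FW W x xV S p p1 by (intro last_exit) (auto intro!: tau_p)
      also have "{(y, y'). y \<in> S \<and> y' \<notin> S \<and> {y, y'} \<in> FW} = Sigma S N"
        using W by (auto simp: FW_def N_def)
      also have "(\<Sum>(y, y')\<in>Sigma S N. p * \<tau> x y * rexp {e \<in> FW. e \<inter> S = {}} p (- W) (\<lambda>K. of_bool (y' \<in> K)))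
        \<le> (\<Sum>(y, y')\<in>Sigma S N. \<tau> x y * tail (off E S) p n y')"
      proof (rule sum_mono)
        fix z assume "z \<in> Sigma S N"
        then obtain y y' where z: "z = (y, y')" "y \<in> S" "y' \<in> N y" by auto
        have "rexp {e \<in> FW. e \<inter> S = {}} p (- W) (\<lambda>K. of_bool (y' \<in> K)) = rexp {e \<in> FW. e \<inter> S = {}} p {y'} (\<lambda>K. of_bool (\<not> K \<subseteq> W))"
          unfolding rexp_def by (intro pexp_cong) (auto simp: reach_compl)
        also have "\<dots> \<le> tail (off E S) p n y'"
          unfolding W_def using p p1 FW S1 z off_subset[of E S]
          by (intro exit_ball_le_tail) (auto simp: off_def)
        finally have 1: "rexp {e \<in> FW. e \<inter> S = {}} p (- W) (\<lambda>K. of_bool (y' \<in> K)) \<le> tail (off E S) p n y'" .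
        have t: "0 \<le> \<tau> x y" using z S xV by (intro tau_nonneg) auto
        have "p * \<tau> x y * rexp {e \<in> FW. e \<inter> S = {}} p (- W) (\<lambda>K. of_bool (y' \<in> K)) \<le> 1 * \<tau> x y * tail (off E S) p n y'"
          using p p1 t 1 FW by (intro mult_mono rexp_nonneg mult_right_mono mult_nonneg_nonneg) auto
        then show "(case z of (y, y') \<Rightarrow> p * \<tau> x y * rexp {e \<in> FW. e \<inter> S = {}} p (- W) (\<lambda>K. of_bool (y' \<in> K)))
          \<le> (case z of (y, y') \<Rightarrow> \<tau> x y * tail (off E S) p n y')" by (simp add: z)
      qed
      also have "\<dots> = (\<Sum>y\<in>S. \<Sum>y'\<in>N y. \<tau> x y * tail (off E S) p n y')"
        using S fN by (subst sum.Sigma) auto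
      finally show ?thesis .
    qed
    have "(\<lambda>n. \<Sum>y\<in>S. \<Sum>y'\<in>N y. \<tau> x y * tail (off E S) p n y') \<longlonglongrightarrow> (\<Sum>y\<in>S. \<Sum>y'\<in>N y. \<tau> x y * theta (off E S) p y')"
      by (intro tendsto_sum tendsto_mult tendsto_const tail_tendsto_theta p p1)
    then have "theta E p x \<le> (\<Sum>y\<in>S. \<Sum>y'\<in>N y. \<tau> x y * theta (off E S) p y')"
      by (rule LIMSEQ_le_const) (use n in auto)
    also have "\<dots> = (\<Sum>y\<in>S. \<tau> x y * a y)" by (simp add: a_def sum_distrib_left)
    finally show ?thesis using T(3)[OF xV] by simp
  qed
  have "(k * T)\<^sup>2 * card S \<le> M\<^sup>2 * (D * T) * (\<Sum>y\<in>S. a y)"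
    using S a0 aA T b by (intro l2_lower) auto
  then have "T * (k\<^sup>2 * T * card S) \<le> T * (M\<^sup>2 * D * (\<Sum>y\<in>S. a y))"
    by (simp add: power2_eq_square algebra_simps)
  then have "k\<^sup>2 * T * card S \<le> M\<^sup>2 * D * (\<Sum>y\<in>S. a y)" using T(1) by simp
  also have "(\<Sum>y\<in>S. a y) = (\<Sum>(x, y)\<in>{(x, y). x \<in> S \<and> y \<notin> S \<and> {x, y} \<in> E}. theta (off E S) p y)"
    unfolding a_def boundary_Sigma N_def[symmetric] using S fN by (subst sum.Sigma) auto
  finally show ?thesis .
qed

text \<open>The argument of \<open>boundary_theta\<close> with the end of the path at any vertex
  \<open>z\<close>. A vertex \<open>z\<close> of \<open>S\<close> contributes
  \<open>\<tau> x z\<close> itself, hence the summand 1 in \<open>a\<close> and the term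
  \<open>card S\<close> on the right. The lower bound with \<open>k\<close> is asked on
  \<open>S\<close> only, since \<open>F\<close> will be chosen to approximate the infinite graph
  well at finitely many vertices.\<close>

lemma boundary_chi:
  fixes X k :: real
  assumes p: "0 \<le> p" "p \<le> ph" and S: "finite S" "S \<subseteq> V" "S \<noteq> {}"
    and F: "finite F" "F \<subseteq> E" "\<And>e. e \<in> E \<Longrightarrow> e \<inter> S \<noteq> {} \<Longrightarrow> e \<in> F"
    and X: "1 \<le> X" "\<And>v. v \<in> V \<Longrightarrow> rexp F p {v} (\<lambda>K. real (card K)) \<le> X"
    and k: "0 \<le> k" "\<And>v. v \<in> S \<Longrightarrow> k * X \<le> rexp F p {v} (\<lambda>K. real (card K))"
  shows "k\<^sup>2 * X * card S \<le> M\<^sup>2 * (1 + D) *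
    (card S + (\<Sum>(x, y)\<in>{(x, y). x \<in> S \<and> y \<notin> S \<and> {x, y} \<in> E}. rexp (off F S) p {y} (\<lambda>K. real (card K))))"
proof -
  have p1: "p \<le> 1" using p ph by simp
  let ?c = "\<lambda>K :: 'a set. real (card K)"
  define N where "N = (\<lambda>x. {y. y \<notin> S \<and> {x, y} \<in> E})"
  have fN: "finite (N y)" "card (N y) \<le> D" for y unfolding N_def by (rule neighbours)+
  have NV: "y \<in> V" if "y \<in> N x" for x y using that EV by (auto simp: N_def)
  have offF: "finite (off F S)" "off F S \<subseteq> E" "off F S \<subseteq> F" using F off_subset[of F S] finite_off by auto
  define a where "a = (\<lambda>y. 1 + (\<Sum>y'\<in>N y. rexp (off F S) p {y'} ?c))"
  have r0: "0 \<le> rexp (off F S) p {y'} ?c" for y' using offF p p1 by (intro rexp_nonneg) auto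
  have a0: "0 \<le> a y" for y unfolding a_def using r0 by (intro add_nonneg_nonneg sum_nonneg) auto
  have aA: "a y \<le> (1 + D) * X" for y
  proof -
    have "(\<Sum>y'\<in>N y. rexp (off F S) p {y'} ?c) \<le> (\<Sum>y'\<in>N y. X)"
    proof (rule sum_mono)
      fix y' assume y': "y' \<in> N y"
      have "rexp (off F S) p {y'} ?c \<le> rexp F p {y'} ?c"
        using rexp_card_mono_set[of F "off F S" p real "{y'}"] F offF p p1 by (simp add: mono_def)
      then show "rexp (off F S) p {y'} ?c \<le> X" using X(2)[OF NV[OF y']] by simp
    qed
    also have "\<dots> \<le> D * X" using fN(2)[of y] X(1) by simp
    finally show ?thesis using X(1) unfolding a_def by (simp add: algebra_simps)
  qed
  have b: "k * X \<le> (\<Sum>y\<in>S. \<tau> x y * a y)" if x: "x \<in> S" for x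
  proof -
    have xV: "x \<in> V" using x S by auto
    define U where "U = insert x (\<Union>F)"
    have U: "finite U" using F(1,2) edge_finite unfolding U_def by (simp add: subset_iff)
    have UV: "U \<subseteq> V" using Union_mono[OF F(2)] EV xV unfolding U_def by blast
    have exit: "rexp F p {x} (\<lambda>K. of_bool (z \<in> K)) \<le>
      (\<Sum>(y, y')\<in>Sigma S N. \<tau> x y * rexp (off F S) p {y'} (\<lambda>K. of_bool (z \<in> K)))" if "z \<notin> S" for z
    proof -
      have "rexp F p {x} (\<lambda>K. of_bool (z \<in> K)) = rexp F p {z} (\<lambda>K. of_bool (x \<in> K))"
        unfolding rexp_def by (intro pexp_cong) (auto simp: reach_sym)
      also have "\<dots> \<le> (\<Sum>(y, y')\<in>{(y, y'). y \<in> S \<and> y' \<notin> S \<and> {y, y'} \<in> F}.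
         p * \<tau> x y * rexp {e \<in> F. e \<inter> S = {}} p {z} (\<lambda>K. of_bool (y' \<in> K)))"
        using F that x xV S p p1 by (intro last_exit) (auto intro!: tau_p)
      also have "{(y, y'). y \<in> S \<and> y' \<notin> S \<and> {y, y'} \<in> F} = Sigma S N"
        using F by (auto simp: N_def)
      also have "(\<Sum>(y, y')\<in>Sigma S N. p * \<tau> x y * rexp {e \<in> F. e \<inter> S = {}} p {z} (\<lambda>K. of_bool (y' \<in> K))) \<le>
         (\<Sum>(y, y')\<in>Sigma S N. \<tau> x y * rexp (off F S) p {y'} (\<lambda>K. of_bool (z \<in> K)))"
      proof (rule sum_mono)
        fix w assume "w \<in> Sigma S N"
        then obtain y y' where w: "w = (y, y')" "y \<in> S" "y' \<in> N y" by auto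
        have 1: "rexp {e \<in> F. e \<inter> S = {}} p {z} (\<lambda>K. of_bool (y' \<in> K)) = rexp (off F S) p {y'} (\<lambda>K. of_bool (z \<in> K))"
          unfolding rexp_def off_def by (intro pexp_cong) (auto simp: reach_sym)
        have t: "0 \<le> \<tau> x y" using w S xV by (intro tau_nonneg) auto
        have "p * \<tau> x y * rexp (off F S) p {y'} (\<lambda>K. of_bool (z \<in> K)) \<le> 1 * \<tau> x y * rexp (off F S) p {y'} (\<lambda>K. of_bool (z \<in> K))"
          using p p1 t offF by (intro mult_right_mono rexp_nonneg) auto
        then show "(case w of (y, y') \<Rightarrow> p * \<tau> x y * rexp {e \<in> F. e \<inter> S = {}} p {z} (\<lambda>K. of_bool (y' \<in> K))) \<le>
          (case w of (y, y') \<Rightarrow> \<tau> x y * rexp (off F S) p {y'} (\<lambda>K. of_bool (z \<in> K)))" by (simp add: w 1)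
      qed
      finally show ?thesis .
    qed
    have "k * X \<le> rexp F p {x} ?c" by (rule k(2)[OF x])
    also have "\<dots> = (\<Sum>z\<in>U. rexp F p {x} (\<lambda>K. of_bool (z \<in> K)))"
      by (rule rexp_card_eq_sum) (use U in \<open>auto simp: U_def\<close>)
    also have "\<dots> = (\<Sum>z\<in>U \<inter> S. rexp F p {x} (\<lambda>K. of_bool (z \<in> K))) + (\<Sum>z\<in>U - S. rexp F p {x} (\<lambda>K. of_bool (z \<in> K)))"
      using U by (rule sum.Int_Diff)
    also have "\<dots> \<le> (\<Sum>z\<in>U \<inter> S. \<tau> x z) + (\<Sum>z\<in>U - S. \<Sum>(y, y')\<in>Sigma S N. \<tau> x y * rexp (off F S) p {y'} (\<lambda>K. of_bool (z \<in> K)))"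
      using F p UV xV by (intro add_mono sum_mono exit tau_p) auto
    also have "(\<Sum>z\<in>U \<inter> S. \<tau> x z) \<le> (\<Sum>z\<in>S. \<tau> x z)"
      using S xV by (intro sum_mono2) (auto intro!: tau_nonneg)
    also have "(\<Sum>z\<in>U - S. \<Sum>(y, y')\<in>Sigma S N. \<tau> x y * rexp (off F S) p {y'} (\<lambda>K. of_bool (z \<in> K)))
      = (\<Sum>(y, y')\<in>Sigma S N. \<tau> x y * (\<Sum>z\<in>U - S. rexp (off F S) p {y'} (\<lambda>K. of_bool (z \<in> K))))"
      by (subst sum.swap) (auto simp: sum_distrib_left intro!: sum.cong)
    also have "\<dots> \<le> (\<Sum>(y, y')\<in>Sigma S N. \<tau> x y * rexp (off F S) p {y'} ?c)"
    proof (rule sum_mono)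
      fix w assume "w \<in> Sigma S N"
      then obtain y y' where w: "w = (y, y')" "y \<in> S" "y' \<in> N y" by auto
      have "0 \<le> \<tau> x y" using w S xV by (intro tau_nonneg) auto
      then show "(case w of (y, y') \<Rightarrow> \<tau> x y * (\<Sum>z\<in>U - S. rexp (off F S) p {y'} (\<lambda>K. of_bool (z \<in> K)))) \<le>
        (case w of (y, y') \<Rightarrow> \<tau> x y * rexp (off F S) p {y'} ?c)"
        unfolding w(1) using offF p p1 U by (simp, intro mult_left_mono rexp_card_ge_sum) auto
    qed
    also have "\<dots> = (\<Sum>y\<in>S. \<tau> x y * (\<Sum>y'\<in>N y. rexp (off F S) p {y'} ?c))"
      unfolding sum_distrib_left using S fN by (subst sum.Sigma) auto
    finally show ?thesis by (simp add: a_def distrib_left sum.distrib)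
  qed
  have "(k * X)\<^sup>2 * card S \<le> M\<^sup>2 * ((1 + D) * X) * (\<Sum>y\<in>S. a y)"
    using S a0 aA X k b by (intro l2_lower) auto
  then have "X * (k\<^sup>2 * X * card S) \<le> X * (M\<^sup>2 * (1 + D) * (\<Sum>y\<in>S. a y))"
    by (simp add: power2_eq_square algebra_simps)
  then have "k\<^sup>2 * X * card S \<le> M\<^sup>2 * (1 + D) * (\<Sum>y\<in>S. a y)" using X(1) by simp
  also have "(\<Sum>y\<in>S. a y) = card S + (\<Sum>(x, y)\<in>{(x, y). x \<in> S \<and> y \<notin> S \<and> {x, y} \<in> E}. rexp (off F S) p {y} ?c)"
    unfolding a_def boundary_Sigma N_def[symmetric] sum.distrib using S fN by (subst sum.Sigma) auto
  finally show ?thesis .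
qed

end

section \<open>Growth of the susceptibility\<close>

context l2_bounded_graph
begin

lemma mono_real: "mono (real :: nat \<Rightarrow> real)"
  by (simp add: mono_def)

lemma mono_min: "mono (\<lambda>k. real (min m k))"
  by (auto simp: mono_def)

lemma cbdd_real_mono_p:
  assumes "cbdd E q real v" "0 \<le> p" "p \<le> q" "q \<le> 1"
  shows "cbdd E p real v"
proof (rule cbddI)
  fix F assume F: "finite F" "F \<subseteq> E"
  have "rexp F p {v} (\<lambda>K. real (card K)) \<le> rexp F q {v} (\<lambda>K. real (card K))"
    using F assms by (intro rexp_card_mono_p mono_real) auto
  also have "\<dots> \<le> cexp E q real v" using F assms by (intro rexp_le_cexp) auto
  finally show "rexp F p {v} (\<lambda>K. real (card K)) \<le> cexp E q real v" .
qed

lemma cexp_real_ge_1: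
  assumes "cbdd E p real v"
  shows "1 \<le> cexp E p real v"
  using rexp_le_cexp[OF assms, of "{}"] rexp_terminal[of "{}" "{v}" p "\<lambda>K. real (card K)"] by simp

text \<open>\<open>S\<close> and the cluster of \<open>y\<close> off \<open>S\<close> are disjoint,
  so opening a boundary edge of a completed cluster \<open>S\<close> adds at least that cluster.
  This is the gain that enters Russo's formula for the mean size.\<close>

lemma rexp_insert_off:
  assumes "finite F" "F \<subseteq> E" "finite S" "y \<notin> S" "0 \<le> q" "q \<le> 1"
  shows "card S + rexp (off F S) q {y} (\<lambda>K. real (card K)) \<le> rexp (off F S) q (insert y S) (\<lambda>K. real (card K))"
proof -
  have fin: "finite (off F S)" using assms finite_off by auto
  have "real (card S) + rexp (off F S) q {y} (\<lambda>K. real (card K)) = rexp (off F S) q {y} (\<lambda>K. real (card S) + real (card K))"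
    unfolding rexp_add using fin by simp
  also have "\<dots> \<le> rexp (off F S) q (insert y S) (\<lambda>K. real (card K))"
    unfolding rexp_def
  proof (rule pexp_mono)
    fix A assume A: "A \<subseteq> off F S"
    have "reach A {y} \<subseteq> - S"
    proof (rule reach_least)
      show "b \<in> - S" if "a \<in> - S" "{a, b} \<in> A" for a b using that A by (auto simp: off_def)
    qed (use assms in auto)
    then have dis: "S \<inter> reach A {y} = {}" by auto
    have sub: "S \<union> reach A {y} \<subseteq> reach A (insert y S)"
      using reach_superset[of S A] unfolding reach_insert[of A y S] by auto
    have finr: "finite (reach A {y})" "finite (reach A (insert y S))"
      using A assms off_subset[of F S] by (auto intro!: finite_reach[of F])
    have "card S + card (reach A {y}) = card (S \<union> reach A {y})"
      using card_Un_disjoint[OF assms(3) finr(1) dis] by simp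
    also have "\<dots> \<le> card (reach A (insert y S))" using sub finr by (intro card_mono)
    finally show "real (card S) + real (card (reach A {y})) \<le> real (card (reach A (insert y S)))" by linarith
  qed (use fin assms in auto)
  finally show ?thesis .
qed

text \<open>
  An integrated form of \<open>\<chi>' \<ge> c \<chi>\<^sup>2\<close>. Clusters with more than \<open>m\<close> vertices are dropped from Russo's formula so
  that the boundary estimate is needed for finitely many sets only.
\<close>

lemma chi_growth:
  fixes p p' \<kappa> :: real
  defines "c \<equiv> (\<kappa>\<^sup>2 / 2)\<^sup>2 / (8 * M\<^sup>2 * (1 + D))"
  assumes p: "0 < p" "p < p'" "p' \<le> ph" "p' < 1" and \<kappa>: "0 < \<kappa>" "\<kappa> \<le> 1"
    and comp: "\<And>u v. u \<in> V \<Longrightarrow> v \<in> V \<Longrightarrow> \<kappa> * cexp E p real v \<le> cexp E p real u"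
    and bd: "\<And>v. v \<in> V \<Longrightarrow> cbdd E p' real v"
    and v: "v \<in> V" and big: "2 * M\<^sup>2 * (1 + D) \<le> (\<kappa>\<^sup>2 / 2)\<^sup>2 * cexp E p real v"
  shows "cexp E p real v + c * (p' - p) * (cexp E p real v)\<^sup>2 \<le> cexp E p' real v"
proof -
  let ?c = "\<lambda>K :: 'a set. real (card K)"
  define x where "x = cexp E p real v"
  define x' where "x' = cexp E p' real v"
  have bdp: "cbdd E p real u" if "u \<in> V" for u by (rule cbdd_real_mono_p[OF bd[OF that]]) (use p in auto)
  have x1: "1 \<le> x" unfolding x_def using cexp_real_ge_1[OF bdp[OF v]] .
  define X where "X = x / \<kappa>"
  \<comment> \<open>One factor \<open>\<kappa>\<close> compares an arbitrary vertex with
    \<open>v\<close>, one comes from \<open>X = x / \<kappa>\<close>, and the half is lost in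
    passing to a finite edge set.\<close>
  define k where "k = \<kappa>\<^sup>2 / 2"
  have k: "0 < k" using \<kappa> by (simp add: k_def)
  have "x * \<kappa> \<le> x * 1" using \<kappa> x1 by (intro mult_left_mono) auto
  then have X1: "x \<le> X" unfolding X_def using \<kappa> by (simp add: field_simps)
  with x1 have X1: "x \<le> X" "1 \<le> X" by auto
  have XX: "cexp E p real u \<le> X" if "u \<in> V" for u
    using comp[OF v that] \<kappa> unfolding X_def x_def by (simp add: field_simps)
  have kX: "k * X \<le> cexp E p real u / 2" if "u \<in> V" for u
    using comp[OF that v] \<kappa> unfolding X_def x_def k_def by (simp add: field_simps power2_eq_square)
  define lb where "lb = k\<^sup>2 * x / (2 * M\<^sup>2 * (1 + D))"
  have M2: "0 < M\<^sup>2 * real (1 + D)" using M by (intro mult_pos_pos) auto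
  have lb0: "0 \<le> lb" unfolding lb_def using x1 M2 by simp
  have t: "((\<lambda>F. rexp F q {u} ?c) \<longlongrightarrow> cexp E q real u) (finite_subsets_at_top E)" if "cbdd E q real u" "0 \<le> q" "q \<le> 1" for q u
    using that by (intro cexp_tendsto mono_real) auto
  \<comment> \<open>\<open>F0\<close> sees at least half of the mean size at \<open>p\<close> and
    all but \<open>x / 8\<close> of the mean size at \<open>p'\<close>; the second property makes
    the contribution of clusters above \<open>m\<close> small on the whole interval.\<close>
  obtain F0 where F0: "finite F0" "F0 \<subseteq> E" "x / 2 \<le> rexp F0 p {v} ?c" "x' - x / 8 \<le> rexp F0 p' {v} ?c"
  proof -
    have "\<forall>\<^sub>F F in finite_subsets_at_top E. x / 2 < rexp F p {v} ?c"
      using order_tendstoD(1)[OF t[OF bdp[OF v]], of "x / 2"] p x1 unfolding x_def by auto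
    moreover have "\<forall>\<^sub>F F in finite_subsets_at_top E. x' - x / 8 < rexp F p' {v} ?c"
      using order_tendstoD(1)[OF t[OF bd[OF v]], of "x' - x / 8"] p x1 unfolding x'_def by auto
    ultimately have "\<forall>\<^sub>F F in finite_subsets_at_top E. x / 2 < rexp F p {v} ?c \<and> x' - x / 8 < rexp F p' {v} ?c"
      by (rule eventually_conj)
    then obtain F0 where "finite F0" "F0 \<subseteq> E" "\<forall>Y. finite Y \<and> F0 \<subseteq> Y \<and> Y \<subseteq> E \<longrightarrow> x / 2 < rexp Y p {v} ?c \<and> x' - x / 8 < rexp Y p' {v} ?c"
      unfolding eventually_finite_subsets_at_top by blast
    then show ?thesis using that[of F0] by auto
  qed
  define N where "N = card (insert v (\<Union>F0))"
  define m where "m = 2 * N"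
  have finU: "finite (insert v (\<Union>F0))" using F0(1,2) edge_finite by (simp add: subset_iff)
  have N: "card (reach A {v}) \<le> N" if "A \<subseteq> F0" for A
    unfolding N_def using reach_subset_Union[of A "{v}"] that finU by (intro card_mono) auto
  have minN: "rexp F0 q {v} (\<lambda>K. real (min j (card K))) = rexp F0 q {v} ?c" if "N \<le> j" for j q
    unfolding rexp_def
  proof (rule pexp_cong)
    fix A assume "A \<subseteq> F0"
    then have "card (reach A {v}) \<le> j" using N[of A] that by linarith
    then show "real (min j (card (reach A {v}))) = real (card (reach A {v}))" by simp
  qed simp
  define W where "W = nball {v} m"
  have W: "finite W" "W \<subseteq> V"
    using finite_nball[of "{v}" m] nball_subset_V[of "{v}" V m] v EV by (auto simp: W_def)
  define good where "good = (\<lambda>F. F0 \<subseteq> F \<and> {e \<in> E. e \<inter> W \<noteq> {}} \<subseteq> F \<and> (\<forall>u\<in>W. cexp E p real u / 2 \<le> rexp F p {u} ?c))"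
  have good: "\<forall>\<^sub>F F in finite_subsets_at_top E. finite F \<and> F \<subseteq> E \<and> good F"
  proof -
    have "\<forall>\<^sub>F F in finite_subsets_at_top E. cexp E p real u / 2 \<le> rexp F p {u} ?c" if "u \<in> W" for u
    proof -
      have u: "u \<in> V" using that W by auto
      have "cexp E p real u / 2 < cexp E p real u" using cexp_real_ge_1[OF bdp[OF u]] by simp
      from order_tendstoD(1)[OF t[OF bdp[OF u]] this] show ?thesis
        using p by (auto elim: eventually_mono)
    qed
    then have "\<forall>\<^sub>F F in finite_subsets_at_top E. \<forall>u\<in>W. cexp E p real u / 2 \<le> rexp F p {u} ?c"
      using W by (intro eventually_ball_finite) auto
    moreover have "\<forall>\<^sub>F F in finite_subsets_at_top E. F0 \<union> {e \<in> E. e \<inter> W \<noteq> {}} \<subseteq> F \<and> finite F \<and> F \<subseteq> E"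
      unfolding eventually_finite_subsets_at_top
      using F0 finite_touching[OF W(1)] by (intro exI[of _ "F0 \<union> {e \<in> E. e \<inter> W \<noteq> {}}"]) auto
    ultimately show ?thesis by eventually_elim (auto simp: good_def)
  qed
  have main: "rexp F p {v} ?c + (p' - p) * (lb * (x / 4)) \<le> rexp F p' {v} ?c"
    if F: "finite F" "F \<subseteq> E" "good F" for F
  proof -
    have FF0: "F0 \<subseteq> F" and FW: "\<And>e. e \<in> E \<Longrightarrow> e \<inter> W \<noteq> {} \<Longrightarrow> e \<in> F"
      and Fh: "\<And>u. u \<in> W \<Longrightarrow> cexp E p real u / 2 \<le> rexp F p {u} ?c"
      using F(3) unfolding good_def by auto
    let ?h = "\<lambda>S :: 'a set. lb * (if card S \<le> m then real (card S) else 0)"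
    have der: "\<exists>d. ((\<lambda>t. rexp F t {v} ?c) has_real_derivative d) (at q) \<and> rexp F q {v} ?h \<le> d"
      if q: "p \<le> q" "q \<le> p'" for q
    proof (rule russo_lower[OF F(1)])
      show q01: "0 < q" "q < 1" using q p by auto
      fix F' S
      assume F': "F' \<subseteq> F" and nc: "\<And>x y. x \<in> S \<Longrightarrow> {x, y} \<in> F' \<Longrightarrow> y \<in> S"
        and cov: "\<And>e. e \<in> F \<Longrightarrow> e \<inter> S = {} \<Longrightarrow> e \<in> F'" and ex: "\<exists>A\<subseteq>F. S = reach A {v}"
      obtain A where A: "A \<subseteq> F" "S = reach A {v}" using ex by blast
      have finS: "finite S" unfolding A(2) using F A by (intro finite_reach[of F]) auto
      have vS: "v \<in> S" using A by auto
      have finF': "finite F'" using F' F finite_subset by auto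
      have offF': "off F S \<subseteq> F'" using cov by (auto simp: off_def)
      let ?I = "{(x, y). x \<in> S \<and> y \<notin> S \<and> {x, y} \<in> F}"
      \<comment> \<open>The boundary estimate is used at \<open>p\<close> for every \<open>q\<close>
        between \<open>p\<close> and \<open>p'\<close>; monotonicity in the parameter keeps the
        factor \<open>lb\<close> independent of \<open>q\<close>.\<close>
      have trm: "rexp (off F S) p {y} ?c \<le> rexp F' q (insert y S) ?c - ?c S" if "y \<notin> S" for y
      proof -
        have "rexp (off F S) p {y} ?c \<le> rexp (off F S) q {y} ?c"
          using finite_off[OF F(1)] off_subset[of F S] F p q q01 by (intro rexp_card_mono_p mono_real) auto
        also have "\<dots> \<le> rexp (off F S) q (insert y S) ?c - ?c S"
          using rexp_insert_off[OF F(1,2) finS that, of q] q01 by simp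
        also have "rexp (off F S) q (insert y S) ?c \<le> rexp F' q (insert y S) ?c"
          using finF' offF' F F' finS q01 by (intro rexp_card_mono_set mono_real) auto
        finally show ?thesis by simp
      qed
      have r0: "0 \<le> rexp (off F S) p {y} ?c" for y using finite_off[OF F(1)] p by (intro rexp_nonneg) auto
      have sum: "(\<Sum>(x, y)\<in>?I. rexp (off F S) p {y} ?c) \<le> (\<Sum>(x, y)\<in>?I. rexp F' q (insert y S) ?c - ?c S)"
        by (intro sum_mono) (use trm in auto)
      show "(1 - q) * ?h S \<le> (\<Sum>(x, y)\<in>?I. rexp F' q (insert y S) ?c - ?c S)"
      proof (cases "card S \<le> m")
        case False
        have "0 \<le> (\<Sum>(x, y)\<in>?I. rexp (off F S) p {y} ?c)" using r0 by (intro sum_nonneg) auto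
        with sum show ?thesis using False by simp
      next
        case True
        have SW: "S \<subseteq> W"
        proof (rule ccontr)
          assume "\<not> S \<subseteq> W"
          then have "m + 1 \<le> card (reach A {v} \<inter> nball {v} m)"
            unfolding A(2) W_def using A F by (intro card_reach_exit_ball) auto
          also have "\<dots> \<le> card S" unfolding A(2)[symmetric] using finS by (intro card_mono) auto
          finally show False using True by simp
        qed
        have I: "?I = {(x, y). x \<in> S \<and> y \<notin> S \<and> {x, y} \<in> E}" using FW SW F by auto
        have bc: "k\<^sup>2 * X * card S \<le> M\<^sup>2 * (1 + D) * (card S + (\<Sum>(x, y)\<in>?I. rexp (off F S) p {y} ?c))"
          unfolding I
        proof (rule boundary_chi)
          show "rexp F p {u} ?c \<le> X" if "u \<in> V" for u
            using rexp_le_cexp[OF bdp[OF that] F(1,2)] XX[OF that] by simp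
          show "k * X \<le> rexp F p {u} ?c" if "u \<in> S" for u
            using kX[of u] Fh[of u] that SW W by fastforce
          show "e \<in> F" if "e \<in> E" "e \<inter> S \<noteq> {}" for e using FW[of e] that SW by auto
        qed (use p finS SW W vS F X1 k in auto)
        have "2 * (lb * card S) * (M\<^sup>2 * (1 + D)) = k\<^sup>2 * x * card S" unfolding lb_def using M by simp
        also have "\<dots> \<le> k\<^sup>2 * X * card S" using X1 by (intro mult_right_mono mult_left_mono) auto
        also note bc
        finally have "2 * (lb * card S) * (M\<^sup>2 * (1 + D)) \<le> (card S + (\<Sum>(x, y)\<in>?I. rexp (off F S) p {y} ?c)) * (M\<^sup>2 * (1 + D))"
          by (simp add: mult.commute)
        then have "2 * (lb * card S) \<le> card S + (\<Sum>(x, y)\<in>?I. rexp (off F S) p {y} ?c)"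
          using M2 by (rule mult_right_le_imp_le)
        \<comment> \<open>The hypothesis \<open>big\<close> is chosen for this: the term
          \<open>card S\<close> from \<open>boundary_chi\<close> is absorbed by half of the
          left-hand side.\<close>
        moreover have "1 \<le> lb" using big M2 unfolding lb_def k_def[symmetric] x_def by (simp add: field_simps)
        then have "real (card S) \<le> lb * card S" using mult_right_mono[of 1 lb "real (card S)"] by simp
        ultimately have "lb * card S \<le> (\<Sum>(x, y)\<in>?I. rexp (off F S) p {y} ?c)" by simp
        moreover have "(1 - q) * (lb * card S) \<le> 1 * (lb * card S)" using q01 lb0 by (intro mult_right_mono) auto
        ultimately show ?thesis using sum True by simp
      qed
    qed
    obtain d where d: "\<And>q. p \<le> q \<Longrightarrow> q \<le> p' \<Longrightarrow> ((\<lambda>t. rexp F t {v} ?c) has_real_derivative d q) (at q) \<and> rexp F q {v} ?h \<le> d q"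
    proof -
      have "\<forall>q\<in>{p..p'}. \<exists>d. ((\<lambda>t. rexp F t {v} ?c) has_real_derivative d) (at q) \<and> rexp F q {v} ?h \<le> d"
        using der by auto
      then obtain d where "\<forall>q\<in>{p..p'}. ((\<lambda>t. rexp F t {v} ?c) has_real_derivative d q) (at q) \<and> rexp F q {v} ?h \<le> d q"
        using bchoice[of "{p..p'}" "\<lambda>q d. ((\<lambda>t. rexp F t {v} ?c) has_real_derivative d) (at q) \<and> rexp F q {v} ?h \<le> d"] by blast
      then show ?thesis by (intro that[of d]) auto
    qed
    obtain z where z: "p < z" "z < p'" "rexp F p' {v} ?c - rexp F p {v} ?c = (p' - p) * d z"
      using MVT2[OF p(2), of "\<lambda>t. rexp F t {v} ?c" d] d by auto
    have z01: "0 \<le> z" "z \<le> 1" using z p by auto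
    have "lb * (x / 4) \<le> rexp F z {v} ?h"
    proof -
      have a: "x / 2 \<le> rexp F z {v} (\<lambda>K. real (min m (card K)))"
      proof -
        have "x / 2 \<le> rexp F0 p {v} (\<lambda>K. real (min m (card K)))" using F0(3) minN[of m p] by (simp add: m_def)
        also have "\<dots> \<le> rexp F p {v} (\<lambda>K. real (min m (card K)))"
          using F F0 FF0 p by (intro rexp_card_mono_set[where h = "\<lambda>k. real (min m k)"] mono_min) auto
        also have "\<dots> \<le> rexp F z {v} (\<lambda>K. real (min m (card K)))"
          using F p z by (intro rexp_card_mono_p[where h = "\<lambda>k. real (min m k)"] mono_min) auto
        finally show ?thesis .
      qed
      \<comment> \<open>A cluster with more than \<open>m = 2 * N\<close> vertices exceeds
        \<open>N\<close> by more than half of \<open>m\<close>. Since \<open>N\<close> bounds every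
        cluster of \<open>v\<close> inside \<open>F0\<close>, the mean excess over \<open>N\<close>
        is at most what \<open>F0\<close> misses at \<open>p'\<close>.\<close>
      have b: "m * rexp F z {v} (\<lambda>K. of_bool (m + 1 \<le> card K)) \<le> x / 4"
      proof -
        have "m * rexp F z {v} (\<lambda>K. of_bool (m + 1 \<le> card K)) \<le> m * rexp F p' {v} (\<lambda>K. of_bool (m + 1 \<le> card K))"
          using F p z by (intro mult_left_mono rexp_card_mono_p[where h = "\<lambda>k. of_bool (m + 1 \<le> k)"] mono_of_bool_le) auto
        also have "\<dots> = rexp F p' {v} (\<lambda>K. m * of_bool (m + 1 \<le> card K))" by (simp add: rexp_cmult)
        also have "\<dots> \<le> rexp F p' {v} (\<lambda>K. 2 * (real (card K) - real (min N (card K))))"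
          using F p by (intro rexp_mono) (auto simp: m_def min_def)
        also have "\<dots> = 2 * (rexp F p' {v} ?c - rexp F p' {v} (\<lambda>K. real (min N (card K))))"
          by (simp add: rexp_cmult rexp_diff)
        also have "\<dots> \<le> 2 * (x' - rexp F0 p' {v} (\<lambda>K. real (min N (card K))))"
        proof -
          have "rexp F p' {v} ?c \<le> x'" unfolding x'_def using F bd[OF v] by (intro rexp_le_cexp) auto
          moreover have "rexp F0 p' {v} (\<lambda>K. real (min N (card K))) \<le> rexp F p' {v} (\<lambda>K. real (min N (card K)))"
            using F F0 FF0 p by (intro rexp_card_mono_set[where h = "\<lambda>k. real (min N k)"] mono_min) auto
          ultimately show ?thesis by simp
        qed
        also have "\<dots> \<le> x / 4" using F0(4) minN[of N p'] by simp
        finally show ?thesis .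
      qed
      have "x / 4 \<le> rexp F z {v} (\<lambda>K. real (min m (card K))) - m * rexp F z {v} (\<lambda>K. of_bool (m + 1 \<le> card K))"
        using a b by simp
      also have "\<dots> = rexp F z {v} (\<lambda>K. real (min m (card K)) - m * of_bool (m + 1 \<le> card K))"
        by (simp add: rexp_diff rexp_cmult)
      also have "\<dots> \<le> rexp F z {v} (\<lambda>S. if card S \<le> m then real (card S) else 0)"
        using F z01 by (intro rexp_mono) auto
      finally show ?thesis unfolding rexp_cmult using lb0 by (intro mult_left_mono) auto
    qed
    also have "\<dots> \<le> d z" using d[of z] z by auto
    finally have "(p' - p) * (lb * (x / 4)) \<le> (p' - p) * d z" using p by (intro mult_left_mono) auto
    then show ?thesis using z(3) by linarith
  qed
  have "x + (p' - p) * (lb * (x / 4)) \<le> x'"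
  proof (rule tendsto_le[OF finite_subsets_at_top_neq_bot])
    show "((\<lambda>F. rexp F p' {v} ?c) \<longlongrightarrow> x') (finite_subsets_at_top E)"
      unfolding x'_def using bd[OF v] p by (intro t) auto
    show "((\<lambda>F. rexp F p {v} ?c + (p' - p) * (lb * (x / 4))) \<longlongrightarrow> x + (p' - p) * (lb * (x / 4))) (finite_subsets_at_top E)"
      unfolding x_def using bdp[OF v] p by (intro tendsto_add tendsto_const t) auto
    show "\<forall>\<^sub>F F in finite_subsets_at_top E. rexp F p {v} ?c + (p' - p) * (lb * (x / 4)) \<le> rexp F p' {v} ?c"
      using good by eventually_elim (use main in auto)
  qed
  moreover have "(p' - p) * (lb * (x / 4)) = c * (p' - p) * x\<^sup>2"
    unfolding lb_def c_def k_def by (simp add: field_simps power2_eq_square)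
  ultimately show ?thesis unfolding x_def x'_def by linarith
qed

lemma susceptibility_bound:
  assumes plo: "0 < plo" and pc: "pc \<le> ph" "pc \<le> 1"
    and bd: "\<And>p v. 0 < p \<Longrightarrow> p < pc \<Longrightarrow> v \<in> V \<Longrightarrow> cbdd E p real v"
  shows "\<exists>C\<ge>1. \<forall>p v. plo \<le> p \<longrightarrow> p < pc \<longrightarrow> v \<in> V \<longrightarrow> cexp E p real v \<le> C / (pc - p)"
proof -
  obtain L where L: "\<And>u v p h. u \<in> V \<Longrightarrow> v \<in> V \<Longrightarrow> 0 < p \<Longrightarrow> p \<le> 1 \<Longrightarrow> mono h \<Longrightarrow> (\<forall>k. 0 \<le> h k) \<Longrightarrow> cbdd E p h u \<Longrightarrow>
    cbdd E p h v \<and> p ^ L * cexp E p h v \<le> cexp E p h u"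
    using comparability by blast
  define \<kappa> where "\<kappa> = min plo 1 ^ L"
  have \<kappa>: "0 < \<kappa>" "\<kappa> \<le> 1" unfolding \<kappa>_def using plo by (auto intro: power_le_one)
  define c where "c = (\<kappa>\<^sup>2 / 2)\<^sup>2 / (8 * M\<^sup>2 * (1 + D))"
  \<comment> \<open>The value of the susceptibility from which on \<open>chi_growth\<close>
    applies.\<close>
  define C0 where "C0 = 2 * M\<^sup>2 * (1 + D) / (\<kappa>\<^sup>2 / 2)\<^sup>2"
  have M2: "0 < M\<^sup>2 * real (1 + D)" using M by (intro mult_pos_pos) auto
  have c: "0 < c" and C0: "0 < C0" unfolding c_def C0_def using \<kappa> M2 by (auto intro!: divide_pos_pos simp: mult.commute)
  show ?thesis
  proof (intro exI[of _ "C0 + 2 / c + 1"] conjI allI impI)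
    show "1 \<le> C0 + 2 / c + 1" using c C0 by simp
    fix p v assume p: "plo \<le> p" "p < pc" and v: "v \<in> V"
    have "cexp E p real v \<le> max C0 (2 / (c * (pc - p)))"
    proof (rule quadratic_growth_bound[where lo = plo and g = "\<lambda>p. cexp E p real v"])
      fix s t assume st: "plo \<le> s" "s < t" "t < pc" "C0 \<le> cexp E s real v"
      have s: "0 < s" "s \<le> 1" using st plo pc by auto
      show "cexp E s real v + c * (t - s) * (cexp E s real v)\<^sup>2 \<le> cexp E t real v"
        unfolding c_def
      proof (rule chi_growth)
        show "\<kappa> * cexp E s real w \<le> cexp E s real u" if "u \<in> V" "w \<in> V" for u w
        proof -
          have b: "cbdd E s real u" "cbdd E s real w" using that st plo by (auto intro!: bd)
          have "\<kappa> \<le> s ^ L" unfolding \<kappa>_def using st plo by (intro power_mono) auto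
          then have "\<kappa> * cexp E s real w \<le> s ^ L * cexp E s real w"
            using cexp_real_ge_1[OF b(2)] by (intro mult_right_mono) auto
          also have "\<dots> \<le> cexp E s real u" using L[OF that s mono_real _ b(1)] by auto
          finally show ?thesis .
        qed
        show "2 * M\<^sup>2 * (1 + D) \<le> (\<kappa>\<^sup>2 / 2)\<^sup>2 * cexp E s real v"
          using st(4) \<kappa> unfolding C0_def by (simp add: field_simps)
      qed (use st plo pc \<kappa> v s in \<open>auto intro!: bd\<close>)
    qed (use c C0 p in auto)
    also have "\<dots> \<le> (C0 + 2 / c + 1) / (pc - p)"
    proof -
      have q: "0 < pc - p" "pc - p \<le> 1" using p plo pc by auto
      have "C0 * (pc - p) \<le> C0 * 1" using q C0 by (intro mult_left_mono) auto
      also have "\<dots> \<le> C0 + 2 / c + 1" using c by simp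
      finally have "C0 \<le> (C0 + 2 / c + 1) / (pc - p)" using q by (simp add: field_simps)
      moreover have "2 / (c * (pc - p)) = (2 / c) / (pc - p)" by simp
      moreover have "(2 / c) / (pc - p) \<le> (C0 + 2 / c + 1) / (pc - p)"
        using q C0 by (intro divide_right_mono) auto
      ultimately show ?thesis by simp
    qed
    finally show "cexp E p real v \<le> (C0 + 2 / c + 1) / (pc - p)" .
  qed
qed

end

section \<open>Estimates in the critical window\<close>

text \<open>\<open>ln (1 + x) \<ge> x - 2 * x\<^sup>2\<close> for \<bar>x\<bar> \<le> 1 / 2,
  exponentiated. It provides the assumptions \<open>kp\<close> and \<open>kq\<close> of
  \<open>tilt\<close> with \<open>K = 2 / \<beta>\<^sup>2\<close>, the second one through
  \<open>1 - p0\<close> and \<open>1 - p\<close>.\<close>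

lemma tilt_log_bound:
  fixes p p0 \<beta> :: real
  assumes "0 < \<beta>" "\<beta> \<le> p0" "\<bar>p - p0\<bar> \<le> p0 / 2"
  shows "p0 * exp ((p - p0) / p0 - 2 / \<beta>\<^sup>2 * (p - p0)\<^sup>2) \<le> p"
proof -
  define x where "x = (p - p0) / p0"
  have p0: "p0 > 0" using assms by simp
  have x: "\<bar>x\<bar> \<le> 1 / 2" using assms p0 by (simp add: x_def abs_divide field_simps)
  have "x - 2 * x\<^sup>2 \<le> ln (1 + x)" using abs_ln_one_plus_x_minus_x_bound[OF x] by linarith
  moreover have "2 * x\<^sup>2 \<le> 2 / \<beta>\<^sup>2 * (p - p0)\<^sup>2"
  proof -
    have "\<beta>\<^sup>2 \<le> p0\<^sup>2" using assms by (intro power_mono) auto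
    then have "2 * (p - p0)\<^sup>2 / p0\<^sup>2 \<le> 2 * (p - p0)\<^sup>2 / \<beta>\<^sup>2" using assms by (intro divide_left_mono) auto
    then show ?thesis by (simp add: x_def power_divide)
  qed
  ultimately have "x - 2 / \<beta>\<^sup>2 * (p - p0)\<^sup>2 \<le> ln (1 + x)" by linarith
  then have "exp (x - 2 / \<beta>\<^sup>2 * (p - p0)\<^sup>2) \<le> 1 + x" using x by (subst (asm) ln_ge_iff) auto
  then have "p0 * exp (x - 2 / \<beta>\<^sup>2 * (p - p0)\<^sup>2) \<le> p0 * (1 + x)" using p0 by (intro mult_left_mono) auto
  also have "\<dots> = p" using p0 by (simp add: x_def field_simps)
  finally show ?thesis by (simp add: x_def)
qed

text \<open>\<open>8 * \<delta> \<le> pc\<close> and \<open>8 * \<delta> \<le> 1 - pc\<close> keep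
  the distance of two parameters of the window below half the distance of either to 0 and to 1, as
  \<open>tilt_log_bound\<close> requires; \<open>pc + \<delta> < ph\<close> lets the two-point
  function at \<open>ph\<close> serve throughout the window.\<close>

locale critical_window = l2_bounded_graph +
  fixes pc \<delta> \<beta> :: real
  assumes subcritical: "\<And>p v. 0 < p \<Longrightarrow> p < pc \<Longrightarrow> v \<in> V \<Longrightarrow> cbdd E p real v"
    and supercritical: "\<And>p. pc < p \<Longrightarrow> p < ph \<Longrightarrow> \<exists>v\<in>V. \<forall>S. finite S \<longrightarrow> S \<subseteq> V \<longrightarrow> v \<in> S \<longrightarrow> 1 \<le> phi E p v S"
    and delta: "0 < \<delta>" "8 * \<delta> \<le> pc" "8 * \<delta> \<le> 1 - pc" "pc + \<delta> < ph"
    and beta: "0 < \<beta>" "\<beta> \<le> pc - \<delta>" "\<beta> \<le> 1 - (pc + \<delta>)"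
begin

lemma window: "pc - \<delta> \<le> p \<Longrightarrow> p \<le> pc + \<delta> \<Longrightarrow> \<beta> \<le> p \<and> \<beta> \<le> 1 - p \<and> 0 < p \<and> p < 1 \<and> p < ph"
  using delta beta by auto

lemma scale: "1 \<le> n \<Longrightarrow> 0 < \<delta> / sqrt (real n) \<and> \<delta> / sqrt (real n) \<le> \<delta>"
  using delta by (auto simp: field_simps)

text \<open>\<open>tilt\<close> with \<open>c = 0\<close> bounds the relative derivative by
  \<open>sqrt (D * m / (\<beta>\<^sup>2 * g))\<close>. If \<open>m\<close> is of order
  \<open>sqrt N\<close> and \<open>g\<close> of order \<open>1 / sqrt N\<close>, this is of order
  \<open>sqrt N\<close>, so a change of the parameter by \<open>1 / sqrt N\<close> costs only a
  constant factor.\<close>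

lemma window_tilt:
  fixes f :: "'a set \<Rightarrow> real" and m g :: real
  assumes p: "pc - \<delta> \<le> p" "p \<le> pc + \<delta>" "pc - \<delta> \<le> p0" "p0 \<le> pc + \<delta>" and F: "finite F" "F \<subseteq> E" and N: "1 \<le> N"
    and f01: "\<And>T. 0 \<le> f T \<and> f T \<le> 1"
    and fN: "\<And>T T'. finite T' \<Longrightarrow> T \<subseteq> T' \<Longrightarrow> N \<le> card T \<Longrightarrow> f T' = f T"
    and g: "0 < g" "g \<le> rexp F p0 {v} f"
    and m: "rexp F p0 {v} (\<lambda>K. real (min N (card K))) \<le> m"
  shows "rexp F p0 {v} f * exp (- (\<bar>p - p0\<bar> * sqrt (D * m / (\<beta>\<^sup>2 * g)) + 2 / \<beta>\<^sup>2 * D * N * (p - p0)\<^sup>2)) \<le> rexp F p {v} f"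
proof -
  have w: "\<beta> \<le> p" "\<beta> \<le> p0" "\<beta> \<le> 1 - p" "\<beta> \<le> 1 - p0" "0 < p" "p < 1" "0 < p0" "p0 < 1"
    using window[OF p(1,2)] window[OF p(3,4)] by auto
  define g0 where "g0 = rexp F p0 {v} f"
  define m0 where "m0 = rexp F p0 {v} (\<lambda>K. real (min N (card K)))"
  have g0: "0 < g0" "g \<le> g0" using g by (auto simp: g0_def)
  have m0: "0 \<le> m0" "m0 \<le> m" unfolding m0_def using F w m by (auto intro!: rexp_nonneg)
  have "\<bar>p - p0\<bar> \<le> 2 * \<delta>" unfolding abs_le_iff using p by simp
  moreover have "2 * \<delta> \<le> p0 / 2" "2 * \<delta> \<le> (1 - p0) / 2" using p(3,4) delta(1-3) by (simp_all add: field_simps)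
  ultimately have ab: "\<bar>p - p0\<bar> \<le> p0 / 2" "\<bar>p - p0\<bar> \<le> (1 - p0) / 2"
    by (blast intro: order_trans)+
  have kp: "p0 * exp ((p - p0) / p0 - 2 / \<beta>\<^sup>2 * (p - p0)\<^sup>2) \<le> p"
    using beta w ab by (intro tilt_log_bound) auto
  have kq: "(1 - p0) * exp (- (p - p0) / (1 - p0) - 2 / \<beta>\<^sup>2 * (p - p0)\<^sup>2) \<le> 1 - p"
    using tilt_log_bound[of \<beta> "1 - p0" "1 - p"] beta w ab by (simp add: abs_minus_commute power2_commute)
  have "\<exists>d. (\<forall>c. (d + c * g0)\<^sup>2 \<le> ((D * m0 - card ({} :: 'a set set)) / (p0 * (1 - p0)) + c\<^sup>2) * g0) \<and>
      rexp F p {v} f \<ge> g0 * exp ((p - p0) * d / g0 - 2 / \<beta>\<^sup>2 * (p - p0)\<^sup>2 * (D * N - real (card ({} :: 'a set set))))"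
    unfolding g0_def m0_def using F N w kp kq f01 fN beta
    by (intro tilt) auto
  then obtain d where d: "\<And>c. (d + c * g0)\<^sup>2 \<le> (D * m0 / (p0 * (1 - p0)) + c\<^sup>2) * g0"
    "g0 * exp ((p - p0) * d / g0 - 2 / \<beta>\<^sup>2 * (p - p0)\<^sup>2 * (D * N)) \<le> rexp F p {v} f"
    by auto
  have "d\<^sup>2 \<le> D * m0 / (p0 * (1 - p0)) * g0" using d(1)[of 0] by simp
  then have "d\<^sup>2 / g0\<^sup>2 \<le> (D * m0 / (p0 * (1 - p0)) * g0) / g0\<^sup>2" by (intro divide_right_mono) auto
  then have "(d / g0)\<^sup>2 \<le> D * m0 / (p0 * (1 - p0) * g0)"
    using g0 by (simp add: power_divide power2_eq_square)
  also have "\<dots> \<le> D * m / (\<beta>\<^sup>2 * g)"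
  proof (intro frac_le mult_left_mono mult_mono)
    show "\<beta>\<^sup>2 \<le> p0 * (1 - p0)" unfolding power2_eq_square using w beta by (intro mult_mono) auto
  qed (use m0 g0 g w beta in \<open>auto intro!: mult_pos_pos\<close>)
  finally have "\<bar>d / g0\<bar> \<le> sqrt (D * m / (\<beta>\<^sup>2 * g))" 
    by (intro real_le_rsqrt) (simp only: power2_abs)
  then have "\<bar>p - p0\<bar> * \<bar>d / g0\<bar> \<le> \<bar>p - p0\<bar> * sqrt (D * m / (\<beta>\<^sup>2 * g))" by (intro mult_left_mono) auto
  then have "- (\<bar>p - p0\<bar> * sqrt (D * m / (\<beta>\<^sup>2 * g))) \<le> (p - p0) * d / g0"
    unfolding abs_mult[symmetric] times_divide_eq_right by (subst minus_le_iff) (rule abs_le_D2)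
  then have "- (\<bar>p - p0\<bar> * sqrt (D * m / (\<beta>\<^sup>2 * g)) + 2 / \<beta>\<^sup>2 * D * N * (p - p0)\<^sup>2) \<le>
      (p - p0) * d / g0 - 2 / \<beta>\<^sup>2 * (p - p0)\<^sup>2 * (D * N)" by (simp add: algebra_simps)
  then have "g0 * exp (- (\<bar>p - p0\<bar> * sqrt (D * m / (\<beta>\<^sup>2 * g)) + 2 / \<beta>\<^sup>2 * D * N * (p - p0)\<^sup>2)) \<le>
     g0 * exp ((p - p0) * d / g0 - 2 / \<beta>\<^sup>2 * (p - p0)\<^sup>2 * (D * N))" using g0 by (intro mult_left_mono) auto
  with d(2) show ?thesis unfolding g0_def by linarith
qed

lemma chi_bound: "\<exists>C\<ge>1. \<forall>p v. pc - \<delta> \<le> p \<longrightarrow> p < pc \<longrightarrow> v \<in> V \<longrightarrow> cexp E p real v \<le> C / (pc - p)"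
  using delta beta subcritical by (intro susceptibility_bound) auto

lemma min_eq_sum: "real (min n j) = (\<Sum>k=1..n. of_bool (k \<le> j))"
proof -
  have "(\<Sum>k=1..n. of_bool (k \<le> j) :: real) = real (card ({1..n} \<inter> {k. k \<le> j}))"
    by (subst sum_of_bool_eq) auto
  also have "{1..n} \<inter> {k. k \<le> j} = {1..min n j}" by auto
  finally show ?thesis by simp
qed

text \<open>
  Tilt from \<open>pc + \<delta> / sqrt n\<close> down to \<open>pc - \<delta> / sqrt n\<close>, where the susceptibility is of order \<open>sqrt n\<close>. The
  tilt costs a constant factor for each tail probability that is not much below the average.
\<close>

lemma truncated_moment_bound:
  "\<exists>C\<ge>1. \<forall>n v F p. 1 \<le> n \<longrightarrow> v \<in> V \<longrightarrow> finite F \<longrightarrow> F \<subseteq> E \<longrightarrow> 0 \<le> p \<longrightarrow> p \<le> pc + \<delta> / sqrt n \<longrightarrow>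
     rexp F p {v} (\<lambda>K. real (min n (card K))) \<le> C * sqrt n"
proof -
  obtain C0 where C0: "1 \<le> C0" "\<And>p v. pc - \<delta> \<le> p \<Longrightarrow> p < pc \<Longrightarrow> v \<in> V \<Longrightarrow> cexp E p real v \<le> C0 / (pc - p)"
    using chi_bound by blast
  define c where "c = 2 * \<delta> * sqrt (2 * D / \<beta>\<^sup>2) + 8 / \<beta>\<^sup>2 * D * \<delta>\<^sup>2"
  show ?thesis
  proof (intro exI[of _ "max 1 (2 * exp c * C0 / \<delta>)"] conjI allI impI)
    fix n v F p assume n: "1 \<le> (n::nat)" and v: "v \<in> V" and F: "finite F" "F \<subseteq> E" and p: "0 \<le> p" "p \<le> pc + \<delta> / sqrt n"
    define s where "s = \<delta> / sqrt n"
    have s: "0 < s" "s \<le> \<delta>" using scale[OF n] by (auto simp: s_def)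
    define pu where "pu = pc + s"
    define pl where "pl = pc - s"
    have pul: "pc - \<delta> \<le> pu" "pu \<le> pc + \<delta>" "pc - \<delta> \<le> pl" "pl \<le> pc + \<delta>" "pl < pc" using s by (auto simp: pu_def pl_def)
    have w: "0 < pu" "pu < 1" "0 < pl" "pl < 1" using window[OF pul(1,2)] window[OF pul(3,4)] by auto
    define m where "m = rexp F pu {v} (\<lambda>K. real (min n (card K)))"
    have m1: "1 \<le> m"
    proof -
      have "rexp F pu {v} (\<lambda>K. 1) \<le> m"
        unfolding m_def
      proof (rule rexp_mono)
        fix A assume "A \<subseteq> F"
        then have "1 \<le> card (reach A {v})" using card_reach_ge[of F "{v}" A] F by auto
        then show "1 \<le> real (min n (card (reach A {v})))" using n by simp
      qed (use F w in auto)
      then show ?thesis using F by simp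
    qed
    have sn: "s\<^sup>2 * n = \<delta>\<^sup>2" using n by (simp add: s_def power_divide)
    \<comment> \<open>Indices whose tail is below \<open>m / (2 * n)\<close> contribute at most half
      of \<open>m\<close> in total and are given up. For the others \<open>g = m / (2 * n)\<close>
      makes the quotient of \<open>m\<close> and \<open>g\<close> equal to \<open>2 * n\<close>,
      whatever \<open>m\<close> is.\<close>
    have key: "exp (- c) * (rexp F pu {v} (\<lambda>K. of_bool (k \<le> card K)) - m / (2 * n)) \<le> rexp F pl {v} (\<lambda>K. of_bool (k \<le> card K))"
      if k: "k \<in> {1..n}" for k
    proof (cases "m / (2 * n) \<le> rexp F pu {v} (\<lambda>K. of_bool (k \<le> card K))")
      case False
      then have "exp (- c) * (rexp F pu {v} (\<lambda>K. of_bool (k \<le> card K)) - m / (2 * n)) \<le> 0"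
        by (intro mult_nonneg_nonpos) auto
      also have "0 \<le> rexp F pl {v} (\<lambda>K. of_bool (k \<le> card K))" using F w by (intro rexp_nonneg) auto
      finally show ?thesis .
    next
      case True
      have "rexp F pu {v} (\<lambda>K. of_bool (k \<le> card K)) *
          exp (- (\<bar>pl - pu\<bar> * sqrt (D * m / (\<beta>\<^sup>2 * (m / (2 * n)))) + 2 / \<beta>\<^sup>2 * D * n * (pl - pu)\<^sup>2)) \<le> rexp F pl {v} (\<lambda>K. of_bool (k \<le> card K))"
      proof (rule window_tilt)
        show "(of_bool (k \<le> card T') :: real) = of_bool (k \<le> card T)" if "finite T'" "T \<subseteq> T'" "n \<le> card T" for T T' :: "'a set"
          using card_mono[OF that(1,2)] that k by auto
      qed (use pul F n True m1 in \<open>auto simp: m_def\<close>)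
      also have "\<bar>pl - pu\<bar> * sqrt (D * m / (\<beta>\<^sup>2 * (m / (2 * n)))) + 2 / \<beta>\<^sup>2 * D * n * (pl - pu)\<^sup>2 = c"
      proof -
        have "D * m / (\<beta>\<^sup>2 * (m / (2 * n))) = (2 * D / \<beta>\<^sup>2) * n" using m1 n beta by (simp add: field_simps)
        then have "\<bar>pl - pu\<bar> * sqrt (D * m / (\<beta>\<^sup>2 * (m / (2 * n)))) = 2 * s * sqrt n * sqrt (2 * D / \<beta>\<^sup>2)"
          using s by (simp only: pl_def pu_def real_sqrt_mult) simp
        also have "2 * s * sqrt n = 2 * \<delta>" using n by (simp add: s_def)
        finally have 1: "\<bar>pl - pu\<bar> * sqrt (D * m / (\<beta>\<^sup>2 * (m / (2 * n)))) = 2 * \<delta> * sqrt (2 * D / \<beta>\<^sup>2)" .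
        have "(pl - pu)\<^sup>2 = 4 * s\<^sup>2" by (simp add: pl_def pu_def power2_eq_square)
        then have "2 / \<beta>\<^sup>2 * D * n * (pl - pu)\<^sup>2 = 8 / \<beta>\<^sup>2 * D * (s\<^sup>2 * n)" by simp
        then show ?thesis unfolding 1 sn c_def by simp
      qed
      finally have "exp (- c) * rexp F pu {v} (\<lambda>K. of_bool (k \<le> card K)) \<le> rexp F pl {v} (\<lambda>K. of_bool (k \<le> card K))"
        by (simp add: mult.commute)
      moreover have "0 \<le> exp (- c) * (m / (2 * n))" using m1 by simp
      ultimately show ?thesis by (simp add: right_diff_distrib)
    qed
    have sums: "rexp F q {v} (\<lambda>K. real (min n (card K))) = (\<Sum>k=1..n. rexp F q {v} (\<lambda>K. of_bool (k \<le> card K)))" for q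
      unfolding min_eq_sum by (rule rexp_sum)
    have "exp (- c) * (m / 2) = (\<Sum>k=1..n. exp (- c) * (rexp F pu {v} (\<lambda>K. of_bool (k \<le> card K)) - m / (2 * n)))"
      unfolding sum_distrib_left[symmetric] sum_subtractf sums[symmetric] m_def[symmetric] using n by simp
    also have "\<dots> \<le> (\<Sum>k=1..n. rexp F pl {v} (\<lambda>K. of_bool (k \<le> card K)))" by (intro sum_mono key)
    also have "\<dots> = rexp F pl {v} (\<lambda>K. real (min n (card K)))" by (simp add: sums)
    also have "\<dots> \<le> rexp F pl {v} (\<lambda>K. real (card K))" using F w by (intro rexp_mono) auto
    also have "\<dots> \<le> cexp E pl real v" using F w pul v by (intro rexp_le_cexp subcritical) auto
    also have "\<dots> \<le> C0 / (pc - pl)" using pul v by (intro C0) auto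
    also have "\<dots> = C0 / \<delta> * sqrt n" using n by (simp add: pl_def s_def)
    finally have "exp c * (exp (- c) * (m / 2)) \<le> exp c * (C0 / \<delta> * sqrt n)" by (intro mult_left_mono) auto
    moreover have "exp c * (exp (- c) * (m / 2)) = m / 2" by (simp add: mult.assoc[symmetric] exp_add[symmetric])
    ultimately have "m \<le> 2 * (exp c * (C0 / \<delta> * sqrt n))" by linarith
    also have "\<dots> = (2 * exp c * C0 / \<delta>) * sqrt n" by simp
    also have "\<dots> \<le> max 1 (2 * exp c * C0 / \<delta>) * sqrt n" by (intro mult_right_mono) auto
    finally have "m \<le> max 1 (2 * exp c * C0 / \<delta>) * sqrt n" .
    moreover have "rexp F p {v} (\<lambda>K. real (min n (card K))) \<le> m"
      unfolding m_def using F p w by (intro rexp_card_mono_p[where h = "\<lambda>k. real (min n k)"] mono_min) (auto simp: pu_def s_def)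
    ultimately show "rexp F p {v} (\<lambda>K. real (min n (card K))) \<le> max 1 (2 * exp c * C0 / \<delta>) * sqrt n" by simp
  qed simp
qed

text \<open>Markov's inequality for the truncated size, whose mean is of order
  \<open>sqrt n\<close>.\<close>

lemma tail_bound:
  "\<exists>C\<ge>1. \<forall>n v p. 1 \<le> n \<longrightarrow> v \<in> V \<longrightarrow> 0 \<le> p \<longrightarrow> p \<le> pc + \<delta> / sqrt n \<longrightarrow> tail E p n v \<le> C / sqrt n"
proof -
  obtain C where C: "1 \<le> C" "\<And>n v F p. 1 \<le> n \<Longrightarrow> v \<in> V \<Longrightarrow> finite F \<Longrightarrow> F \<subseteq> E \<Longrightarrow> 0 \<le> p \<Longrightarrow> p \<le> pc + \<delta> / sqrt n \<Longrightarrow>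
     rexp F p {v} (\<lambda>K. real (min n (card K))) \<le> C * sqrt n" using truncated_moment_bound by blast
  show ?thesis
  proof (intro exI[of _ C] conjI allI impI)
    fix n v p assume n: "1 \<le> (n::nat)" and v: "v \<in> V" and p: "0 \<le> p" "p \<le> pc + \<delta> / sqrt n"
    have p1: "p \<le> 1" using scale[OF n] p delta by auto
    show "tail E p n v \<le> C / sqrt n"
    proof (rule tail_le)
      fix F assume F: "finite F" "F \<subseteq> E"
      have "n * rexp F p {v} (\<lambda>K. of_bool (n \<le> card K)) = rexp F p {v} (\<lambda>K. n * of_bool (n \<le> card K))" by (simp add: rexp_cmult)
      also have "\<dots> \<le> rexp F p {v} (\<lambda>K. real (min n (card K)))" using F p p1 by (intro rexp_mono) auto
      also have "\<dots> \<le> C * sqrt n" by (rule C(2)[OF n v F p])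
      finally have "sqrt n * (sqrt n * rexp F p {v} (\<lambda>K. of_bool (n \<le> card K))) \<le> sqrt n * C"
        by (simp add: mult.assoc[symmetric] mult.commute)
      then have "sqrt n * rexp F p {v} (\<lambda>K. of_bool (n \<le> card K)) \<le> C" using n by (simp add: mult_le_cancel_left)
      then show "rexp F p {v} (\<lambda>K. of_bool (n \<le> card K)) \<le> C / sqrt n" using n by (simp add: field_simps)
    qed
  qed (use C in auto)
qed

text \<open>\<open>n\<close> is the integer part of \<open>(\<delta> / s)\<^sup>2\<close>, the
  largest size whose critical window still contains \<open>pc + s\<close>. The last clause is for
  the supercritical tail, where this \<open>n\<close> must not exceed the size considered.\<close>

lemma inverse_square_nat:
  assumes "0 < s" "s \<le> \<delta>"
  shows "\<exists>n::nat. 1 \<le> n \<and> sqrt n \<le> \<delta> / s \<and> 1 / sqrt n \<le> 2 * s / \<delta> \<and> real n \<le> (\<delta> / s)\<^sup>2 \<and> (\<forall>k::nat. (\<delta> / s)\<^sup>2 < k \<longrightarrow> n \<le> k)"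
proof -
  define x where "x = (\<delta> / s)\<^sup>2"
  have x1: "1 \<le> x" unfolding x_def using assms by (intro one_le_power) (simp add: field_simps)
  define n where "n = nat \<lfloor>x\<rfloor>"
  have fl: "real n \<le> x" "x < real n + 1" unfolding n_def using x1 by linarith+
  have n1: "1 \<le> n" unfolding n_def using x1 by linarith
  have nx: "x / 4 \<le> n" using fl n1 by linarith
  have ds: "0 < \<delta> / s" using assms delta by simp
  have "sqrt n \<le> sqrt x" using fl by simp
  also have sx: "sqrt x = \<delta> / s" unfolding x_def by (rule real_sqrt_unique) (use ds in auto)
  finally have 1: "sqrt n \<le> \<delta> / s" .
  have "sqrt (x / 4) \<le> sqrt n" using nx by simp
  then have "\<delta> / s / 2 \<le> sqrt n" using sx by (simp add: real_sqrt_divide)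
  then have 2: "1 / sqrt n \<le> 2 * s / \<delta>" using assms delta n1 by (simp add: field_simps)
  have 3: "n \<le> k" if "x < real k" for k :: nat using fl that by linarith
  show ?thesis using n1 1 2 3 fl unfolding x_def by (intro exI[of _ n]) auto
qed

lemma theta_upper_bound: "\<exists>C\<ge>1. \<forall>v p. v \<in> V \<longrightarrow> pc < p \<longrightarrow> p \<le> pc + \<delta> \<longrightarrow> theta E p v \<le> C * (p - pc)"
proof -
  obtain C where C: "1 \<le> C" "\<And>n v p. 1 \<le> n \<Longrightarrow> v \<in> V \<Longrightarrow> 0 \<le> p \<Longrightarrow> p \<le> pc + \<delta> / sqrt n \<Longrightarrow> tail E p n v \<le> C / sqrt n"
    using tail_bound by blast
  show ?thesis
  proof (intro exI[of _ "2 * C / \<delta>"] conjI allI impI)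
    show "1 \<le> 2 * C / \<delta>" using C(1) delta ph beta by (simp add: field_simps)
    fix v p assume v: "v \<in> V" and p: "pc < p" "p \<le> pc + \<delta>"
    have p01: "0 \<le> p" "p \<le> 1" using p delta by auto
    obtain n :: nat where n: "1 \<le> n" "sqrt n \<le> \<delta> / (p - pc)" "1 / sqrt n \<le> 2 * (p - pc) / \<delta>"
      using inverse_square_nat[of "p - pc"] p by auto
    have "p \<le> pc + \<delta> / sqrt n" using n p by (simp add: field_simps)
    then have "tail E p n v \<le> C / sqrt n" using n v p01 by (intro C) auto
    also have "\<dots> = C * (1 / sqrt n)" by simp
    also have "\<dots> \<le> C * (2 * (p - pc) / \<delta>)" using n C(1) by (intro mult_left_mono) auto
    also have "\<dots> = 2 * C / \<delta> * (p - pc)" by simp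
    finally show "theta E p v \<le> 2 * C / \<delta> * (p - pc)" using theta_le_tail[OF p01, of E v n] by linarith
  qed
qed

text \<open>The vertex supplied by \<open>supercritical\<close> may change with the parameter, so
  the bound is carried to all vertices by the comparability of tails.\<close>

lemma theta_lower_bound: "\<exists>c>0. \<forall>v p. v \<in> V \<longrightarrow> pc < p \<longrightarrow> p \<le> pc + \<delta> \<longrightarrow> c * (p - pc) \<le> theta E p v"
proof -
  obtain L where L: "\<And>u v p h. u \<in> V \<Longrightarrow> v \<in> V \<Longrightarrow> 0 < p \<Longrightarrow> p \<le> 1 \<Longrightarrow> mono h \<Longrightarrow> (\<forall>k. 0 \<le> h k) \<Longrightarrow> cbdd E p h u \<Longrightarrow>
    cbdd E p h v \<and> p ^ L * cexp E p h v \<le> cexp E p h u"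
    using comparability by blast
  have comp: "p ^ L * tail E p n v \<le> tail E p n u" if "u \<in> V" "v \<in> V" "0 < p" "p \<le> 1" for u v p n
    unfolding tail_def using L[OF that mono_of_bool_le, of n] cbdd_tail[of p E n u] that by auto
  define c where "c = \<beta> ^ L / 4"
  show ?thesis
  proof (intro exI[of _ c] conjI allI impI)
    show "0 < c" unfolding c_def using beta by simp
    fix u p assume u: "u \<in> V" and p: "pc < p" "p \<le> pc + \<delta>"
    have w: "\<beta> \<le> p" "0 < p" "p < 1" "p < ph" using window[of p] p delta by auto
    \<comment> \<open>The functional is controlled strictly above \<open>pc\<close>, and
      \<open>theta_lower\<close> gains only from a gap below \<open>p\<close>; the midpoint provides
      both.\<close>
    define p0 where "p0 = (pc + p) / 2"
    have p0: "pc < p0" "p0 < p" "p0 < ph" using p w by (auto simp: p0_def)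
    obtain v where v: "v \<in> V" "\<And>S. finite S \<Longrightarrow> S \<subseteq> V \<Longrightarrow> v \<in> S \<Longrightarrow> 1 \<le> phi E p0 v S"
      using supercritical[OF p0(1,3)] by blast
    have "1 - exp (- 4 * (p - p0)) \<le> theta E p v"
      using v p0 w delta by (intro theta_lower) auto
    moreover have "(p - pc) / 4 \<le> 1 - exp (- 4 * (p - p0))"
    proof -
      define x where "x = 4 * (p - p0)"
      have x: "x = 2 * (p - pc)" "0 < x" "x \<le> 1" using p delta by (auto simp: x_def p0_def field_simps)
      have "exp (- x) \<le> 1 / (1 + x)" using exp_ge_add_one_self[of x] x by (simp add: exp_minus field_simps)
      also have "1 / (1 + x) \<le> 1 - x / 2" using x by (simp add: field_simps power2_eq_square)
      finally have "x / 2 \<le> 1 - exp (- x)" by simp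
      then show ?thesis using x p unfolding x_def by simp
    qed
    ultimately have th: "(p - pc) / 4 \<le> theta E p v" by simp
    show "c * (p - pc) \<le> theta E p u"
    proof (rule theta_ge)
      fix n
      have "c * (p - pc) = \<beta> ^ L * ((p - pc) / 4)" by (simp add: c_def)
      also have "\<dots> \<le> \<beta> ^ L * theta E p v" using th beta by (intro mult_left_mono) auto
      also have "\<dots> \<le> p ^ L * tail E p n v"
        using w beta theta_nonneg[of p E v] theta_le_tail[of p E v n] by (intro mult_mono power_mono) auto
      also have "\<dots> \<le> tail E p n u" using u v w by (intro comp) auto
      finally show "c * (p - pc) \<le> tail E p n u" .
    qed
  qed
qed

text \<open>Tilt from \<open>pc + \<delta> / sqrt n\<close>, where the tail is at least \<theta> and
  thus at least of order \<open>1 / sqrt n\<close>, down to \<open>pc\<close>.\<close>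

lemma critical_tail_lower: "\<exists>c>0. \<forall>n v. 1 \<le> n \<longrightarrow> v \<in> V \<longrightarrow> c / sqrt n \<le> tail E pc n v"
proof -
  obtain C where C: "1 \<le> C" "\<And>n v F p. 1 \<le> n \<Longrightarrow> v \<in> V \<Longrightarrow> finite F \<Longrightarrow> F \<subseteq> E \<Longrightarrow> 0 \<le> p \<Longrightarrow> p \<le> pc + \<delta> / sqrt n \<Longrightarrow>
     rexp F p {v} (\<lambda>K. real (min n (card K))) \<le> C * sqrt n" using truncated_moment_bound by blast
  obtain c where c: "0 < c" "\<And>v p. v \<in> V \<Longrightarrow> pc < p \<Longrightarrow> p \<le> pc + \<delta> \<Longrightarrow> c * (p - pc) \<le> theta E p v"
    using theta_lower_bound by blast
  define e where "e = \<delta> * sqrt (2 * D * C / (\<beta>\<^sup>2 * c * \<delta>)) + 2 / \<beta>\<^sup>2 * D * \<delta>\<^sup>2"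
  show ?thesis
  proof (intro exI[of _ "c * \<delta> / 2 * exp (- e)"] conjI allI impI)
    show "0 < c * \<delta> / 2 * exp (- e)" using c delta by simp
    fix n v assume n: "1 \<le> (n::nat)" and v: "v \<in> V"
    define s where "s = \<delta> / sqrt n"
    have s: "0 < s" "s \<le> \<delta>" using scale[OF n] by (auto simp: s_def)
    have sn: "s\<^sup>2 * n = \<delta>\<^sup>2" using n by (simp add: s_def power_divide)
    define p0 where "p0 = pc + s"
    have p0: "pc < p0" "pc - \<delta> \<le> p0" "p0 \<le> pc + \<delta>" using s by (auto simp: p0_def)
    have w: "0 < p0" "p0 < 1" using window[OF p0(2,3)] by auto
    define g where "g = c * s / 2"
    have g0: "0 < g" using c s by (simp add: g_def)
    have "g < c * s" using c s by (simp add: g_def)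
    also have "c * s \<le> theta E p0 v" using c(2)[OF v p0(1,3)] by (simp add: p0_def)
    also have "\<dots> \<le> tail E p0 n v" using w by (intro theta_le_tail) auto
    finally have "\<forall>\<^sub>F F in finite_subsets_at_top E. g < rexp F p0 {v} (\<lambda>K. of_bool (n \<le> card K))"
      using order_tendstoD(1)[OF tail_tendsto[of E p0 v n]] w by auto
    then obtain F where F: "finite F" "F \<subseteq> E" "g < rexp F p0 {v} (\<lambda>K. of_bool (n \<le> card K))"
      unfolding eventually_finite_subsets_at_top by blast
    have "rexp F p0 {v} (\<lambda>K. of_bool (n \<le> card K)) *
        exp (- (\<bar>pc - p0\<bar> * sqrt (D * (C * sqrt n) / (\<beta>\<^sup>2 * g)) + 2 / \<beta>\<^sup>2 * D * n * (pc - p0)\<^sup>2)) \<le> rexp F pc {v} (\<lambda>K. of_bool (n \<le> card K))"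
    proof (rule window_tilt)
      show "(of_bool (n \<le> card T') :: real) = of_bool (n \<le> card T)" if "finite T'" "T \<subseteq> T'" "n \<le> card T" for T T' :: "'a set"
        using card_mono[OF that(1,2)] that by auto
      show "rexp F p0 {v} (\<lambda>K. real (min n (card K))) \<le> C * sqrt n"
        using n v F w by (intro C) (auto simp: p0_def s_def)
    qed (use p0 F n g0 delta in auto)
    also have "\<bar>pc - p0\<bar> * sqrt (D * (C * sqrt n) / (\<beta>\<^sup>2 * g)) + 2 / \<beta>\<^sup>2 * D * n * (pc - p0)\<^sup>2 = e"
    proof -
      have "D * (C * sqrt n) / (\<beta>\<^sup>2 * g) = (2 * D * C / (\<beta>\<^sup>2 * c * \<delta>)) * n"
        unfolding g_def s_def using n c delta beta by (simp add: field_simps)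
      then have "\<bar>pc - p0\<bar> * sqrt (D * (C * sqrt n) / (\<beta>\<^sup>2 * g)) = s * sqrt n * sqrt (2 * D * C / (\<beta>\<^sup>2 * c * \<delta>))"
        using s by (simp only: p0_def real_sqrt_mult) simp
      also have "s * sqrt n = \<delta>" using n by (simp add: s_def)
      finally have 1: "\<bar>pc - p0\<bar> * sqrt (D * (C * sqrt n) / (\<beta>\<^sup>2 * g)) = \<delta> * sqrt (2 * D * C / (\<beta>\<^sup>2 * c * \<delta>))" .
      have "2 / \<beta>\<^sup>2 * D * n * (pc - p0)\<^sup>2 = 2 / \<beta>\<^sup>2 * D * (s\<^sup>2 * n)" by (simp add: p0_def)
      then show ?thesis unfolding 1 sn e_def by simp
    qed
    finally have "g * exp (- e) \<le> rexp F pc {v} (\<lambda>K. of_bool (n \<le> card K))"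
      using F(3) by (elim order_trans[rotated]) (intro mult_right_mono; simp)
    also have "\<dots> \<le> tail E pc n v" using F delta by (intro rexp_le_tail) auto
    finally show "c * \<delta> / 2 * exp (- e) / sqrt n \<le> tail E pc n v" by (simp add: g_def s_def field_simps)
  qed
qed

end

section \<open>Tails on both sides of criticality\<close>

text \<open>With \<open>y = k * s\<^sup>2 * n\<close>, the inequality
  \<open>sqrt y \<le> exp (y / 2)\<close> gives up half of the exponent in exchange for
  \<open>1 / sqrt n\<close> in place of \<open>s\<close>.\<close>

lemma gaussian_absorb:
  fixes s k :: real and n :: nat
  assumes "0 < s" "0 < k" "1 \<le> n"
  shows "s * exp (- k * s\<^sup>2 * n) \<le> (1 / sqrt k) / sqrt n * exp (- (k / 2) * s\<^sup>2 * n)"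
proof -
  define y where "y = k * s\<^sup>2 * n"
  have y0: "0 < y" using assms by (simp add: y_def)
  have "y \<le> exp y" using exp_ge_add_one_self[of y] by linarith
  also have "exp y = (exp (y / 2))\<^sup>2" by (simp add: exp_double[symmetric])
  finally have sy: "sqrt y \<le> exp (y / 2)" by (intro real_le_lsqrt) (use y0 in auto)
  have "sqrt y = sqrt k * s * sqrt n" unfolding y_def using assms by (simp add: real_sqrt_mult)
  then have s: "s = sqrt y * ((1 / sqrt k) / sqrt n)" using assms by simp
  have "s * exp (- y) = (1 / sqrt k) / sqrt n * (sqrt y * exp (- y))" by (subst (1) s) simp
  also have "\<dots> \<le> (1 / sqrt k) / sqrt n * (exp (y / 2) * exp (- y))"
    using sy assms by (intro mult_left_mono mult_right_mono) auto
  also have "exp (y / 2) * exp (- y) = exp (- (y / 2))" by (simp add: exp_add[symmetric])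
  finally show ?thesis by (simp add: y_def)
qed

context bounded_degree
begin

lemma reach_outside:
  assumes "A \<subseteq> E" "y \<notin> \<Union>E"
  shows "reach A {y} = {y}"
  by (rule reach_eq_self) (use assms in auto)

end

context critical_window
begin

text \<open>The event used is that the size is at least \<open>n\<close> and below
  \<open>M * n\<close>: it forces a finite cluster and is settled by the first \<open>M * n\<close>
  vertices, so it can be tilted. At \<open>pc\<close> it keeps the order \<open>1 / sqrt n\<close>,
  because for large \<open>M\<close> the tail at \<open>M * n\<close> is at most a quarter of the
  lower bound at \<open>n\<close>. This \<open>M\<close> is a new natural number, not the bound on
  the operator norm.\<close>

lemma window_lower:
  "\<exists>(M::nat) c C. 0 < c \<and> 0 < C \<and> (\<forall>n v p. 1 \<le> n \<longrightarrow> v \<in> V \<longrightarrow> pc - \<delta> \<le> p \<longrightarrow> p \<le> pc + \<delta> \<longrightarrow>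
    c / sqrt n * exp (- C * (p - pc)\<^sup>2 * n) \<le> tail E p n v - tail E p (M * n) v)"
proof -
  obtain C1 where C1: "1 \<le> C1" "\<And>n v F p. 1 \<le> n \<Longrightarrow> v \<in> V \<Longrightarrow> finite F \<Longrightarrow> F \<subseteq> E \<Longrightarrow> 0 \<le> p \<Longrightarrow> p \<le> pc + \<delta> / sqrt n \<Longrightarrow>
     rexp F p {v} (\<lambda>K. real (min n (card K))) \<le> C1 * sqrt n" using truncated_moment_bound by blast
  obtain C2 where C2: "1 \<le> C2" "\<And>n v p. 1 \<le> n \<Longrightarrow> v \<in> V \<Longrightarrow> 0 \<le> p \<Longrightarrow> p \<le> pc + \<delta> / sqrt n \<Longrightarrow> tail E p n v \<le> C2 / sqrt n"
    using tail_bound by blast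
  obtain c where c: "0 < c" "\<And>n v. 1 \<le> n \<Longrightarrow> v \<in> V \<Longrightarrow> c / sqrt n \<le> tail E pc n v"
    using critical_tail_lower by blast
  obtain M :: nat where M0: "(4 * C2 / c)\<^sup>2 < M" using reals_Archimedean2 by blast
  have M1: "1 \<le> M" using M0 by (cases M) auto
  have M: "C2 / sqrt M \<le> c / 4"
  proof -
    have "4 * C2 / c \<le> sqrt M" using M0 by (intro real_le_rsqrt) auto
    then have "4 * C2 \<le> c * sqrt M" using c by (simp add: field_simps)
    then show ?thesis using M1 by (simp add: field_simps)
  qed
  define a where "a = sqrt (D * (C1 * sqrt M) / (\<beta>\<^sup>2 * (c / 4)))"
  define b where "b = 2 / \<beta>\<^sup>2 * D * M"
  have a0: "0 \<le> a" unfolding a_def using C1 c by simp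
  have b0: "0 \<le> b" unfolding b_def by simp
  show ?thesis
  proof (rule exI[of _ M], rule exI[of _ "c / 4 * exp (- a)"], rule exI[of _ "a + b + 1"], intro conjI allI impI)
    show "0 < c / 4 * exp (- a)" using c by simp
    show "0 < a + b + 1" using a0 b0 by simp
    fix n v p assume n: "1 \<le> (n::nat)" and v: "v \<in> V" and p: "pc - \<delta> \<le> p" "p \<le> pc + \<delta>"
    have w: "0 < p" "p < 1" using window[OF p] by auto
    define N where "N = M * n"
    have N: "1 \<le> N" "n \<le> N" using M1 n by (auto simp: N_def)
    define g where "g = c / 4 / sqrt n"
    have g0: "0 < g" using c n by (simp add: g_def)
    let ?f = "\<lambda>K :: 'a set. of_bool (n \<le> card K) - of_bool (N \<le> card K) :: real"
    have tailN: "tail E pc N v \<le> c / 4 / sqrt n"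
    proof -
      have "tail E pc N v \<le> C2 / sqrt N" using N v delta scale[OF N(1)] by (intro C2) auto
      also have "\<dots> = (C2 / sqrt M) / sqrt n" by (simp add: N_def real_sqrt_mult)
      also have "\<dots> \<le> (c / 4) / sqrt n" using M by (intro divide_right_mono) auto
      finally show ?thesis .
    qed
    have lim: "((\<lambda>F. rexp F q {v} ?f) \<longlongrightarrow> tail E q n v - tail E q N v) (finite_subsets_at_top E)" if "0 \<le> q" "q \<le> 1" for q
      unfolding rexp_diff using that by (intro tendsto_diff tail_tendsto) auto
    have "g < c / sqrt n - c / 4 / sqrt n" using c n by (simp add: g_def field_simps)
    also have "\<dots> \<le> tail E pc n v - tail E pc N v" using c(2)[OF n v] tailN by simp
    finally have ev: "\<forall>\<^sub>F F in finite_subsets_at_top E. g < rexp F pc {v} ?f"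
      using order_tendstoD(1)[OF lim[of pc]] delta by auto
    have main: "g * exp (- (\<bar>p - pc\<bar> * sqrt n * a + b * n * (p - pc)\<^sup>2)) \<le> rexp F p {v} ?f"
      if F: "finite F" "F \<subseteq> E" "g < rexp F pc {v} ?f" for F
    proof -
      have "rexp F pc {v} ?f * exp (- (\<bar>p - pc\<bar> * sqrt (D * (C1 * sqrt N) / (\<beta>\<^sup>2 * g)) + 2 / \<beta>\<^sup>2 * D * N * (p - pc)\<^sup>2)) \<le> rexp F p {v} ?f"
      proof (rule window_tilt)
        show "?f T' = ?f T" if "finite T'" "T \<subseteq> T'" "N \<le> card T" for T T'
          using card_mono[OF that(1,2)] that N by auto
        show "0 \<le> ?f T \<and> ?f T \<le> 1" for T using N by auto
        show "rexp F pc {v} (\<lambda>K. real (min N (card K))) \<le> C1 * sqrt N"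
          using N v F delta scale[OF N(1)] by (intro C1) auto
      qed (use p F N g0 delta in auto)
      also have "sqrt (D * (C1 * sqrt N) / (\<beta>\<^sup>2 * g)) = sqrt n * a"
      proof -
        have "D * (C1 * sqrt N) / (\<beta>\<^sup>2 * g) = n * (D * (C1 * sqrt M) / (\<beta>\<^sup>2 * (c / 4)))"
          unfolding g_def N_def using n c beta by (simp add: real_sqrt_mult field_simps)
        then show ?thesis unfolding a_def by (simp only: real_sqrt_mult)
      qed
      also have "2 / \<beta>\<^sup>2 * D * N * (p - pc)\<^sup>2 = b * n * (p - pc)\<^sup>2" by (simp add: b_def N_def)
      finally have "rexp F pc {v} ?f * exp (- (\<bar>p - pc\<bar> * sqrt n * a + b * n * (p - pc)\<^sup>2)) \<le> rexp F p {v} ?f"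
        by (simp add: mult.assoc)
      moreover have "g * exp (- (\<bar>p - pc\<bar> * sqrt n * a + b * n * (p - pc)\<^sup>2)) \<le>
          rexp F pc {v} ?f * exp (- (\<bar>p - pc\<bar> * sqrt n * a + b * n * (p - pc)\<^sup>2))"
        using F(3) by (intro mult_right_mono) auto
      ultimately show ?thesis by linarith
    qed
    have "g * exp (- (\<bar>p - pc\<bar> * sqrt n * a + b * n * (p - pc)\<^sup>2)) \<le> tail E p n v - tail E p N v"
    proof (rule tendsto_lowerbound[OF lim])
      have fin: "\<forall>\<^sub>F F in finite_subsets_at_top E. finite F \<and> F \<subseteq> E"
        by (rule eventually_finite_subsets_at_top_weakI) auto
      show "\<forall>\<^sub>F F in finite_subsets_at_top E. g * exp (- (\<bar>p - pc\<bar> * sqrt n * a + b * n * (p - pc)\<^sup>2)) \<le> rexp F p {v} ?f"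
        using ev fin by eventually_elim (use main in auto)
    qed (use w in auto)
    moreover have "c / 4 * exp (- a) / sqrt n * exp (- (a + b + 1) * (p - pc)\<^sup>2 * n) \<le> g * exp (- (\<bar>p - pc\<bar> * sqrt n * a + b * n * (p - pc)\<^sup>2))"
    proof -
      \<comment> \<open>The first-order cost is linear in \<open>t\<close> and is absorbed by
        \<open>t \<le> 1 + t\<^sup>2\<close>; hence \<open>exp (- a)\<close> in the lower constant
        and \<open>a\<close> in the rate \<open>a + b + 1\<close>, where the 1 ensures
        positivity.\<close>
      define t where "t = \<bar>p - pc\<bar> * sqrt n"
      have t2: "t\<^sup>2 = (p - pc)\<^sup>2 * n" by (simp add: t_def power_mult_distrib)
      have "2 * t \<le> 1 + t\<^sup>2" using sum_squares_bound[of 1 t] by simp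
      moreover have "0 \<le> t" by (simp add: t_def)
      ultimately have "t \<le> 1 + t\<^sup>2" by simp
      then have "t * a \<le> (1 + t\<^sup>2) * a" using a0 by (intro mult_right_mono) auto
      then have h: "t * a \<le> a + a * t\<^sup>2" by (simp add: algebra_simps)
      have "- a + (- (a + b + 1) * t\<^sup>2) = - (a + a * t\<^sup>2) - b * t\<^sup>2 - t\<^sup>2" by (simp add: algebra_simps)
      also have "\<dots> \<le> - (t * a + b * t\<^sup>2)" using h zero_le_power2[of t] by linarith
      finally have "- a + (- (a + b + 1) * t\<^sup>2) \<le> - (t * a + b * t\<^sup>2)" .
      then have "exp (- a) * exp (- (a + b + 1) * t\<^sup>2) \<le> exp (- (t * a + b * t\<^sup>2))"
        unfolding exp_add[symmetric] by simp
      then have "g * (exp (- a) * exp (- (a + b + 1) * t\<^sup>2)) \<le> g * exp (- (t * a + b * t\<^sup>2))"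
        using g0 by (intro mult_left_mono) auto
      then show ?thesis unfolding t2 t_def[symmetric] g_def by (simp add: mult_ac)
    qed
    ultimately show "c / 4 * exp (- a) / sqrt n * exp (- (a + b + 1) * (p - pc)\<^sup>2 * n) \<le> tail E p n v - tail E p (M * n) v"
      unfolding N_def by linarith
  qed
qed

text \<open>The mean size is at most \<open>X = C0 / s\<close>, so with \<open>l\<close> of order
  \<open>1 / X\<^sup>2\<close> the moment in \<open>exp_moment_explore\<close> has an exponent of at
  least \<open>k * s\<^sup>2\<close> per vertex. While \<open>k * s\<^sup>2 * n\<close> is below 1
  the exponential is of constant order and \<open>tail_bound\<close> suffices.\<close>

lemma subcritical_tail:
  "\<exists>C c. 0 < C \<and> 0 < c \<and> (\<forall>n v p. 1 \<le> n \<longrightarrow> v \<in> V \<longrightarrow> pc - \<delta> \<le> p \<longrightarrow> p < pc \<longrightarrow>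
    tail E p n v \<le> C / sqrt n * exp (- c * (p - pc)\<^sup>2 * n))"
proof -
  obtain C0 where C0: "1 \<le> C0" "\<And>p v. pc - \<delta> \<le> p \<Longrightarrow> p < pc \<Longrightarrow> v \<in> V \<Longrightarrow> cexp E p real v \<le> C0 / (pc - p)"
    using chi_bound by blast
  obtain C1 where C1: "1 \<le> C1" "\<And>n v p. 1 \<le> n \<Longrightarrow> v \<in> V \<Longrightarrow> 0 \<le> p \<Longrightarrow> p \<le> pc + \<delta> / sqrt n \<Longrightarrow> tail E p n v \<le> C1 / sqrt n"
    using tail_bound by blast
  \<comment> \<open>Keeps \<open>a * D \<le> 1 / 2\<close>, so that at least half of
    \<open>l\<close> survives in \<open>l - l\<^sup>2 * X\<^sup>2 * D\<close>.\<close>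
  define a where "a = 1 / (2 * (real D + 1))"
  have a: "0 < a" "a \<le> 1" "a * D \<le> 1 / 2" unfolding a_def by (auto simp: field_simps)
  define k where "k = a / (2 * C0\<^sup>2)"
  have k: "0 < k" unfolding k_def using a C0 by simp
  define C where "C = (4 * a / C0) / sqrt k + C1 * exp 1"
  have "0 < C1 * exp 1" "0 < (4 * a / C0) / sqrt k" using C1 a C0 k by simp_all
  then have C: "0 < C" "C1 * exp 1 \<le> C" "(4 * a / C0) / sqrt k \<le> C" by (simp_all add: C_def)
  show ?thesis
  proof (rule exI[of _ C], rule exI[of _ "k / 2"], intro conjI allI impI)
    fix n v p assume n: "1 \<le> (n::nat)" and v: "v \<in> V" and p: "pc - \<delta> \<le> p" "p < pc"
    have w: "0 < p" "p < 1" using window[of p] p delta by auto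
    define s where "s = pc - p"
    have s: "0 < s" "s \<le> \<delta>" "s \<le> 1" using p delta by (auto simp: s_def)
    have s2: "(p - pc)\<^sup>2 = s\<^sup>2" by (simp add: s_def power2_commute)
    define X where "X = C0 / s"
    have X1: "1 \<le> X" using C0 s by (simp add: X_def field_simps)
    define y where "y = k * s\<^sup>2 * n"
    have y0: "0 < y" using k s n by (simp add: y_def)
    show "tail E p n v \<le> C / sqrt n * exp (- (k / 2) * (p - pc)\<^sup>2 * n)"
    proof (cases "y < 1")
      case True
      have "tail E p n v \<le> C1 / sqrt n" using n v w p scale[OF n] by (intro C1) linarith+
      also have "\<dots> \<le> (C1 * exp 1) / sqrt n * exp (- (y / 2))"
      proof -
        have "1 \<le> exp 1 * exp (- (y / 2))" unfolding exp_add[symmetric] using True y0 by simp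
        then have "C1 / sqrt n * 1 \<le> C1 / sqrt n * (exp 1 * exp (- (y / 2)))" using C1 n by (intro mult_left_mono) auto
        then show ?thesis by simp
      qed
      also have "\<dots> \<le> C / sqrt n * exp (- (y / 2))" using C by (intro mult_right_mono divide_right_mono) auto
      finally show ?thesis unfolding s2 y_def by simp
    next
      case False
      have "tail E p n v \<le> (4 * a / X) * exp (- y)"
      proof (rule tail_le)
        fix F assume F: "finite F" "F \<subseteq> E"
        define l where "l = a / X\<^sup>2"
        have X: "rexp F p {u} (\<lambda>K. real (card K)) \<le> X" for u
        proof (cases "u \<in> V")
          case True
          have "rexp F p {u} (\<lambda>K. real (card K)) \<le> cexp E p real u"
            using F w p True by (intro rexp_le_cexp subcritical) auto
          also have "\<dots> \<le> X" unfolding X_def s_def using p True by (intro C0) auto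
          finally show ?thesis .
        next
          case False
          have "rexp F p {u} (\<lambda>K. real (card K)) \<le> 1"
          proof (rule rexp_le_const)
            fix A assume "A \<subseteq> F"
            then have "reach A {u} = {u}" using False F EV by (intro reach_outside) auto
            then show "real (card (reach A {u})) \<le> 1" by simp
          qed (use F w in auto)
          then show ?thesis using X1 by simp
        qed
        have l: "0 \<le> l" "l * X \<le> 1" unfolding l_def using a X1 by (auto simp: power2_eq_square field_simps)
        have "rexp F p {v} (\<lambda>K. exp ((l - l\<^sup>2 * X\<^sup>2 * D) * card K)) \<le>
            exp (l * rexp F p {v} (\<lambda>K. real (card K)) - l\<^sup>2 * X\<^sup>2 * card ({} :: 'a set set))"
          using F w l X by (intro exp_moment_explore) auto
        also have "\<dots> \<le> exp (l * X)" using X[of v] l by (simp add: mult_left_mono)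
        also have "l * X = a / X" unfolding l_def using X1 by (simp add: power2_eq_square)
        finally have E1: "rexp F p {v} (\<lambda>K. exp ((l - l\<^sup>2 * X\<^sup>2 * D) * card K)) \<le> exp (a / X)" .
        have coef: "k * s\<^sup>2 \<le> l - l\<^sup>2 * X\<^sup>2 * D"
        proof -
          have "l - l\<^sup>2 * X\<^sup>2 * D = (1 - a * D) * (a / X\<^sup>2)"
            unfolding l_def using X1 by (simp add: power2_eq_square field_simps)
          moreover have "1 / 2 * (a / X\<^sup>2) \<le> (1 - a * D) * (a / X\<^sup>2)" using a by (intro mult_right_mono) auto
          moreover have "k * s\<^sup>2 = 1 / 2 * (a / X\<^sup>2)" unfolding k_def X_def using s C0 by (simp add: power_divide)
          ultimately show ?thesis by simp
        qed
        \<comment> \<open>After the subtraction of 1 the right-hand side is at most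
          \<open>exp (a / X) - 1\<close>, of order \<open>s\<close> instead of order 1. This is the
          prefactor that \<open>gaussian_absorb\<close> converts.\<close>
        have "(exp y - 1) * rexp F p {v} (\<lambda>K. of_bool (n \<le> card K)) = rexp F p {v} (\<lambda>K. (exp y - 1) * of_bool (n \<le> card K))"
          by (simp add: rexp_cmult)
        also have "\<dots> \<le> rexp F p {v} (\<lambda>K. exp ((l - l\<^sup>2 * X\<^sup>2 * D) * card K) - 1)"
        proof (rule rexp_mono)
          fix A
          define j where "j = card (reach A {v})"
          have ks: "0 \<le> k * s\<^sup>2" using k by simp
          have "k * s\<^sup>2 * j \<le> (l - l\<^sup>2 * X\<^sup>2 * D) * j" using coef by (intro mult_right_mono) auto
          moreover have "y \<le> k * s\<^sup>2 * j" if "n \<le> j" unfolding y_def using that ks by (intro mult_left_mono) auto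
          moreover have "0 \<le> k * s\<^sup>2 * j" using ks by simp
          ultimately show "(exp y - 1) * of_bool (n \<le> card (reach A {v})) \<le> exp ((l - l\<^sup>2 * X\<^sup>2 * D) * card (reach A {v})) - 1"
            unfolding j_def[symmetric] by (cases "n \<le> j") (auto intro: order_trans)
        qed (use F w in auto)
        also have "\<dots> = rexp F p {v} (\<lambda>K. exp ((l - l\<^sup>2 * X\<^sup>2 * D) * card K)) - 1"
          unfolding rexp_diff using F by simp
        also have "\<dots> \<le> exp (a / X) - 1" using E1 by simp
        also have "\<dots> \<le> 2 * (a / X)"
        proof -
          have t: "0 \<le> a / X" "a / X \<le> 1" using a X1 by (auto simp: field_simps)
          have "exp (a / X) \<le> 1 + a / X + (a / X)\<^sup>2" using t by (rule exp_bound)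
          also have "(a / X)\<^sup>2 \<le> a / X" unfolding power2_eq_square using mult_left_le[OF t(2,1)] .
          finally show ?thesis by simp
        qed
        finally have 1: "(exp y - 1) * rexp F p {v} (\<lambda>K. of_bool (n \<le> card K)) \<le> 2 * (a / X)" .
        have "2 \<le> exp y" using exp_ge_add_one_self[of y] False by linarith
        then have "exp y / 2 \<le> exp y - 1" by simp
        moreover have "0 \<le> rexp F p {v} (\<lambda>K. of_bool (n \<le> card K))" using F w by (intro rexp_nonneg) auto
        ultimately have "exp y / 2 * rexp F p {v} (\<lambda>K. of_bool (n \<le> card K)) \<le> 2 * (a / X)"
          using 1 by (meson mult_right_mono order_trans)
        then have "exp y * rexp F p {v} (\<lambda>K. of_bool (n \<le> card K)) \<le> 4 * a / X" by simp
        then have "exp (- y) * (exp y * rexp F p {v} (\<lambda>K. of_bool (n \<le> card K))) \<le> exp (- y) * (4 * a / X)"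
          by (intro mult_left_mono) auto
        then show "rexp F p {v} (\<lambda>K. of_bool (n \<le> card K)) \<le> (4 * a / X) * exp (- y)"
          unfolding mult.assoc[symmetric] exp_add[symmetric] by (simp add: mult.commute)
      qed
      also have "\<dots> = (4 * a / C0) * (s * exp (- k * s\<^sup>2 * n))" by (simp add: X_def y_def)
      also have "\<dots> \<le> (4 * a / C0) * ((1 / sqrt k) / sqrt n * exp (- (k / 2) * s\<^sup>2 * n))"
        using a C0 s k n by (intro mult_left_mono gaussian_absorb) auto
      also have "\<dots> = ((4 * a / C0) / sqrt k) / sqrt n * exp (- (k / 2) * s\<^sup>2 * n)" by simp
      also have "\<dots> \<le> C / sqrt n * exp (- (k / 2) * s\<^sup>2 * n)" using C by (intro mult_right_mono divide_right_mono) auto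
      finally show ?thesis unfolding s2 .
    qed
  qed (use C k in auto)
qed

text \<open>The bound is uniform in the finite set \<open>W\<close>; balls exhausting the graph then
  give the event of a finite cluster. Everything scales with \<open>s = p - pc\<close>:
  \<open>p1\<close> lies halfway to \<open>pc\<close>, the check probability \<open>r\<close> and
  the bound \<open>T\<close> on \<theta> are of order \<open>s\<close>, and \<open>n0\<close> is of
  order \<open>1 / s\<^sup>2\<close>.\<close>

lemma supercritical_tail:
  "\<exists>C c. 0 < C \<and> 0 < c \<and> (\<forall>n v p W. 1 \<le> n \<longrightarrow> v \<in> V \<longrightarrow> pc < p \<longrightarrow> p \<le> pc + \<delta> \<longrightarrow> finite W \<longrightarrow> W \<subseteq> V \<longrightarrow>
    rexp {e \<in> E. e \<inter> W \<noteq> {}} p {v} (\<lambda>K. of_bool (K \<subseteq> W \<and> n \<le> card K)) \<le> C / sqrt n * exp (- c * (p - pc)\<^sup>2 * n))"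
proof -
  obtain C1 where C1: "1 \<le> C1" "\<And>n v p. 1 \<le> n \<Longrightarrow> v \<in> V \<Longrightarrow> 0 \<le> p \<Longrightarrow> p \<le> pc + \<delta> / sqrt n \<Longrightarrow> tail E p n v \<le> C1 / sqrt n"
    using tail_bound by blast
  obtain C3 where C3: "1 \<le> C3" "\<And>v p. v \<in> V \<Longrightarrow> pc < p \<Longrightarrow> p \<le> pc + \<delta> \<Longrightarrow> theta E p v \<le> C3 * (p - pc)"
    using theta_upper_bound by blast
  obtain c4 where c4: "0 < c4" "\<And>v p. v \<in> V \<Longrightarrow> pc < p \<Longrightarrow> p \<le> pc + \<delta> \<Longrightarrow> c4 * (p - pc) \<le> theta E p v"
    using theta_lower_bound by blast
  define k where "k = (c4 / C3)\<^sup>2 * C3 / (4 * M\<^sup>2 * (real D + 1))"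
  have k: "0 < k" unfolding k_def using c4 C3 M by (intro divide_pos_pos mult_pos_pos) auto
  define a where "a = D * C3 * \<delta>\<^sup>2 / (4 * \<beta>)"
  define C where "C = exp a * (2 * C1 / \<delta>) / sqrt k + C1 * exp (k * \<delta>\<^sup>2)"
  have "0 < C1 * exp (k * \<delta>\<^sup>2)" "0 < exp a * (2 * C1 / \<delta>) / sqrt k" using C1 delta k by simp_all
  then have C: "0 < C" "C1 * exp (k * \<delta>\<^sup>2) \<le> C" "exp a * (2 * C1 / \<delta>) / sqrt k \<le> C" by (simp_all add: C_def)
  show ?thesis
  proof (rule exI[of _ C], rule exI[of _ "k / 2"], intro conjI allI impI)
    fix n v p W assume n: "1 \<le> (n::nat)" and v: "v \<in> V" and p: "pc < p" "p \<le> pc + \<delta>" and W: "finite W" "W \<subseteq> V"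
    have w: "0 < p" "p < 1" "\<beta> \<le> 1 - p" "p < ph" using window[of p] p delta by auto
    define s where "s = p - pc"
    have s: "0 < s" "s \<le> \<delta>" using p by (auto simp: s_def)
    define FW where "FW = {e \<in> E. e \<inter> W \<noteq> {}}"
    have FW: "finite FW" "FW \<subseteq> E" unfolding FW_def using finite_touching[OF W(1)] by auto
    show "rexp {e \<in> E. e \<inter> W \<noteq> {}} p {v} (\<lambda>K. of_bool (K \<subseteq> W \<and> n \<le> card K)) \<le> C / sqrt n * exp (- (k / 2) * (p - pc)\<^sup>2 * n)"
    proof (cases "real n \<le> (\<delta> / s)\<^sup>2")
      case True
      then have "sqrt n \<le> \<delta> / s" using s delta by (intro real_le_lsqrt) auto
      then have "p \<le> pc + \<delta> / sqrt n" using s n by (simp add: s_def field_simps)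
      then have "tail E p n v \<le> C1 / sqrt n" using n v w by (intro C1) auto
      moreover have "rexp FW p {v} (\<lambda>K. of_bool (K \<subseteq> W \<and> n \<le> card K)) \<le> rexp FW p {v} (\<lambda>K. of_bool (n \<le> card K))"
        using FW w by (intro rexp_mono) auto
      moreover have "\<dots> \<le> tail E p n v" using FW w by (intro rexp_le_tail) auto
      ultimately have "rexp FW p {v} (\<lambda>K. of_bool (K \<subseteq> W \<and> n \<le> card K)) \<le> C1 / sqrt n" by linarith
      also have "\<dots> \<le> (C1 * exp (k * \<delta>\<^sup>2)) / sqrt n * exp (- (k / 2) * s\<^sup>2 * n)"
      proof -
        have "s\<^sup>2 * n \<le> s\<^sup>2 * (\<delta> / s)\<^sup>2" using True by (intro mult_left_mono) auto
        also have "\<dots> = \<delta>\<^sup>2" using s by (simp add: power_divide)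
        finally have "(k / 2) * (s\<^sup>2 * n) \<le> (k / 2) * \<delta>\<^sup>2" using k by (intro mult_left_mono) auto
        moreover have "(k / 2) * \<delta>\<^sup>2 \<le> k * \<delta>\<^sup>2" using k by simp
        ultimately have "(k / 2) * (s\<^sup>2 * n) \<le> k * \<delta>\<^sup>2" by linarith
        then have "1 \<le> exp (k * \<delta>\<^sup>2) * exp (- (k / 2) * s\<^sup>2 * n)" unfolding exp_add[symmetric] by (simp add: mult.assoc)
        then have "C1 / sqrt n * 1 \<le> C1 / sqrt n * (exp (k * \<delta>\<^sup>2) * exp (- (k / 2) * s\<^sup>2 * n))"
          using C1 n by (intro mult_left_mono) auto
        then show ?thesis by simp
      qed
      also have "\<dots> \<le> C / sqrt n * exp (- (k / 2) * s\<^sup>2 * n)" using C by (intro mult_right_mono divide_right_mono) auto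
      finally show ?thesis unfolding FW_def s_def .
    next
      case False
      obtain n0 :: nat where n0: "1 \<le> n0" "sqrt n0 \<le> \<delta> / s" "1 / sqrt n0 \<le> 2 * s / \<delta>" "real n0 \<le> (\<delta> / s)\<^sup>2" "n0 \<le> n"
        using inverse_square_nat[OF s] False by (metis linorder_not_le)
      define p1 where "p1 = pc + s / 2"
      have "p1 = p - s / 2" by (simp add: p1_def s_def field_simps)
      then have p1: "pc < p1" "p1 \<le> pc + \<delta>" "p1 < p" "0 \<le> p1" "p1 < 1" "p1 \<le> ph"
        using s w p delta unfolding p1_def by linarith+
      \<comment> \<open>The conditional probability that an edge closed at \<open>p1\<close> is open
        at \<open>p\<close>.\<close>
      define r where "r = (s / 2) / (1 - p1)"
      have b1: "\<beta> \<le> 1 - p1" using p1 w by simp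
      have r: "s / 2 \<le> r" "r \<le> s / (2 * \<beta>)" "r \<le> 1" "0 \<le> r"
      proof -
        have "s / 2 * (1 - p1) \<le> s / 2 * 1" using s p1 by (intro mult_left_mono) auto
        then show "s / 2 \<le> r" unfolding r_def using p1 by (simp add: field_simps)
        have "(s / 2) / (1 - p1) \<le> (s / 2) / \<beta>" using s b1 beta by (intro divide_left_mono mult_pos_pos) auto
        then show "r \<le> s / (2 * \<beta>)" by (simp add: r_def)
        have "s / 2 \<le> 1 - p1" using w by (simp add: p1_def s_def field_simps)
        then show "r \<le> 1" unfolding r_def using p1 by simp
        show "0 \<le> r" unfolding r_def using s p1 by simp
      qed
      have p2: "p = p1 + (1 - p1) * r" using p1 by (simp add: r_def p1_def s_def field_simps)
      define T where "T = C3 * (s / 2)"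
      have T0: "0 < T" using C3 s by (simp add: T_def)
      have thT: "c4 / C3 * T \<le> theta E p1 u \<and> theta E p1 u \<le> T" if "u \<in> V" for u
        using C3(2)[OF that p1(1,2)] c4(2)[OF that p1(1,2)] C3(1) by (simp add: T_def p1_def)
      define \<mu> where "\<mu> = (c4 / C3)\<^sup>2 * T / (M\<^sup>2 * (real D + 1))"
      have M2: "0 < M\<^sup>2 * (real D + 1)" using M by (intro mult_pos_pos) auto
      have \<mu>0: "0 \<le> \<mu>" unfolding \<mu>_def using T0 M2 by simp
      let ?Q = "\<lambda>S u. theta (off E S) p1 u"
      have Qsum: "\<mu> * card S \<le> (\<Sum>(x, y)\<in>{(x, y). x \<in> S \<and> y \<notin> S \<and> {x, y} \<in> E}. ?Q S y)"
        if S: "finite S" "S \<subseteq> W" "S \<noteq> {}" for S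
      proof -
        define q where "q = (\<Sum>(x, y)\<in>{(x, y). x \<in> S \<and> y \<notin> S \<and> {x, y} \<in> E}. ?Q S y)"
        have q0: "0 \<le> q" unfolding q_def using p1 by (intro sum_nonneg) (auto intro!: theta_nonneg)
        have "(c4 / C3)\<^sup>2 * T * card S \<le> M\<^sup>2 * D * q"
          unfolding q_def using S W p1 T0 c4 C3 thT by (intro boundary_theta) auto
        also have "\<dots> \<le> M\<^sup>2 * (real D + 1) * q" using q0 by (intro mult_right_mono mult_left_mono) auto
        finally have 1: "(c4 / C3)\<^sup>2 * T * card S \<le> M\<^sup>2 * (real D + 1) * q" .
        have "\<mu> * card S = ((c4 / C3)\<^sup>2 * T * card S) / (M\<^sup>2 * (real D + 1))" by (simp add: \<mu>_def)
        also have "\<dots> \<le> q" using 1 M2 by (subst pos_divide_le_eq) (auto simp: mult.commute)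
        finally have "\<mu> * card S \<le> q" .
        then show ?thesis by (simp add: q_def)
      qed
      have Qmax: "?Q S u \<le> T" for S u
      proof (cases "u \<in> V")
        case True
        have "?Q S u \<le> theta E p1 u" using p1 by (intro theta_mono_set off_subset) auto
        then show ?thesis using thT[OF True] by simp
      next
        case False
        have "?Q S u \<le> tail (off E S) p1 2 u" using p1 by (intro theta_le_tail) auto
        also have "\<dots> \<le> 0"
        proof (rule tail_le)
          fix F assume F: "finite F" "F \<subseteq> off E S"
          show "rexp F p1 {u} (\<lambda>K. of_bool (2 \<le> card K)) \<le> 0"
          proof (rule rexp_le_const)
            fix A assume "A \<subseteq> F"
            then have "reach A {u} = {u}" using False F EV off_subset[of E S] by (intro reach_outside) auto
            then show "of_bool (2 \<le> card (reach A {u})) \<le> (0::real)" by simp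
          qed (use F p1 in auto)
        qed
        finally show ?thesis using T0 by simp
      qed
      have "rexp FW p {v} (\<lambda>K. of_bool (K \<subseteq> W \<and> n \<le> card K)) \<le>
        exp (r * (D * n0 * T) - r * \<mu> * n) * rexp FW p {v} (\<lambda>K. of_bool (n0 \<le> card K))"
        unfolding FW_def
      proof (rule hazard_prefix[where Q = ?Q, OF W(1) p1(4) _ r(4,3) p2 \<mu>0])
        show "0 \<le> ?Q S y \<and> ?Q S y \<le> 1" for S y using p1 by (auto intro: theta_nonneg theta_le_1)
        show "?Q T' y \<le> ?Q S y" if "S \<subseteq> T'" for S T' y
          using p1 off_antimono[OF that] by (intro theta_mono_set) auto
        show "?Q S y \<le> rexp {e \<in> E. e \<inter> W \<noteq> {} \<and> e \<inter> S = {}} p1 {y} (\<lambda>K. of_bool (\<not> K \<subseteq> W))" for S y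
          using p1 W by (intro theta_le_exit) auto
      qed (use p1 Qsum Qmax n0 in auto)
      also have "\<dots> \<le> exp (a - k * s\<^sup>2 * n) * (C1 * (2 * s / \<delta>))"
      proof (rule mult_mono)
        \<comment> \<open>The loss from the unchecked prefix stays bounded: \<open>r\<close> and
          \<open>T\<close> are of order \<open>s\<close>, and \<open>n0\<close> is at most
          \<open>(\<delta> / s)\<^sup>2\<close>.\<close>
        have "r * (D * n0 * T) \<le> s / (2 * \<beta>) * (D * (\<delta> / s)\<^sup>2 * T)"
        proof (intro mult_mono)
          show "real (D * n0) \<le> D * (\<delta> / s)\<^sup>2" unfolding of_nat_mult using n0 by (intro mult_left_mono) auto
        qed (use r T0 s beta in auto)
        also have "\<dots> = a" unfolding a_def T_def using s beta by (simp add: field_simps power2_eq_square)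
        finally have 1: "r * (D * n0 * T) \<le> a" .
        have "k * s\<^sup>2 = s / 2 * \<mu>" unfolding k_def \<mu>_def T_def by (simp add: power2_eq_square mult_ac)
        also have "\<dots> \<le> r * \<mu>" using r \<mu>0 by (intro mult_right_mono) auto
        finally have "k * s\<^sup>2 * n \<le> r * \<mu> * n" by (intro mult_right_mono) auto
        with 1 show "exp (r * (D * n0 * T) - r * \<mu> * n) \<le> exp (a - k * s\<^sup>2 * n)" by simp
        \<comment> \<open>At size \<open>n0\<close> the parameter is still inside the critical
          window, so the tail there is at most of order \<open>s\<close>; this is the prefactor for
          \<open>gaussian_absorb\<close>.\<close>
        have "p \<le> pc + \<delta> / sqrt n0" using n0 s by (simp add: s_def field_simps)
        then have "tail E p n0 v \<le> C1 / sqrt n0" using n0 v w by (intro C1) auto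
        also have "\<dots> = C1 * (1 / sqrt n0)" by simp
        also have "\<dots> \<le> C1 * (2 * s / \<delta>)" using n0 C1(1) by (intro mult_left_mono) auto
        finally have "tail E p n0 v \<le> C1 * (2 * s / \<delta>)" .
        moreover have "rexp FW p {v} (\<lambda>K. of_bool (n0 \<le> card K)) \<le> tail E p n0 v" using FW w by (intro rexp_le_tail) auto
        ultimately show "rexp FW p {v} (\<lambda>K. of_bool (n0 \<le> card K)) \<le> C1 * (2 * s / \<delta>)" by linarith
        show "0 \<le> rexp FW p {v} (\<lambda>K. of_bool (n0 \<le> card K))" using FW w by (intro rexp_nonneg) auto
      qed simp
      also have "\<dots> = exp a * (2 * C1 / \<delta>) * (s * exp (- k * s\<^sup>2 * n))"
        by (simp add: exp_diff exp_minus field_simps)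
      also have "\<dots> \<le> exp a * (2 * C1 / \<delta>) * ((1 / sqrt k) / sqrt n * exp (- (k / 2) * s\<^sup>2 * n))"
        using C1 delta s k n by (intro mult_left_mono gaussian_absorb) auto
      also have "\<dots> = (exp a * (2 * C1 / \<delta>) / sqrt k) / sqrt n * exp (- (k / 2) * s\<^sup>2 * n)" by simp
      also have "\<dots> \<le> C / sqrt n * exp (- (k / 2) * s\<^sup>2 * n)" using C by (intro mult_right_mono divide_right_mono) auto
      finally show ?thesis unfolding FW_def s_def .
    qed
  qed (use C k in auto)
qed

end

section \<open>The percolation measure\<close>

lemma prob_space_percolation: "prob_space (percolation E p)"
  unfolding percolation_def by (intro prob_space_PiM prob_space_measure_pmf)

text \<open>The event is a finite disjoint union of cylinders, each fixing the states of all edges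
  of \<open>F\<close>. Every passage from the product measure to finite sums goes through this
  identity.\<close>

lemma percolation_cylinder:
  assumes "finite F" "F \<subseteq> E" "0 \<le> p" "p \<le> 1"
  shows "{\<omega> \<in> space (percolation E p). P (open_edges E \<omega> \<inter> F)} \<in> sets (percolation E p)"
    and "measure (percolation E p) {\<omega> \<in> space (percolation E p). P (open_edges E \<omega> \<inter> F)} = pexp F (\<lambda>_. p) (\<lambda>A. of_bool (P A))"
proof -
  let ?M = "percolation E p"
  interpret prob_space ?M by (rule prob_space_percolation)
  interpret PP: product_prob_space "\<lambda>_. measure_pmf (bernoulli_pmf p)" E
    by (intro product_prob_spaceI prob_space_measure_pmf)
  define cyl where "cyl = (\<lambda>A. {\<omega> \<in> space ?M. \<forall>e\<in>F. \<omega> e \<in> {e \<in> A}})"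
  have meas: "cyl A \<in> sets ?M" for A
  proof -
    have "cyl A = prod_emb E (\<lambda>_. measure_pmf (bernoulli_pmf p)) F (Pi\<^sub>E F (\<lambda>e. {e \<in> A}))"
      unfolding cyl_def prod_emb_def percolation_def using assms by (auto simp: space_PiM Pi_iff)
    then show ?thesis unfolding percolation_def using assms by (auto intro!: sets_PiM_I)
  qed
  have prob: "measure ?M (cyl A) = (\<Prod>e\<in>A. p) * (\<Prod>e\<in>F - A. 1 - p)" if "A \<subseteq> F" for A
  proof -
    have "emeasure ?M (cyl A) = (\<Prod>e\<in>F. emeasure (measure_pmf (bernoulli_pmf p)) {e \<in> A})"
      unfolding cyl_def percolation_def using assms by (intro PP.emeasure_PiM_Collect) auto
    also have "\<dots> = (\<Prod>e\<in>F. ennreal (if e \<in> A then p else 1 - p))"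
      using assms by (intro prod.cong) (auto simp: emeasure_pmf_single)
    also have "\<dots> = ennreal (\<Prod>e\<in>F. if e \<in> A then p else 1 - p)"
      using assms by (intro prod_ennreal) auto
    finally have "measure ?M (cyl A) = (\<Prod>e\<in>F. if e \<in> A then p else 1 - p)"
      using assms by (simp add: measure_def prod_nonneg)
    also have "\<dots> = (\<Prod>e\<in>F \<inter> A. p) * (\<Prod>e\<in>F - A. 1 - p)"
      using assms by (subst prod.If_cases) (auto simp: Diff_eq)
    finally show ?thesis using that by (simp add: Int_absorb1)
  qed
  have eq: "{\<omega> \<in> space ?M. P (open_edges E \<omega> \<inter> F)} = (\<Union>A\<in>{A \<in> Pow F. P A}. cyl A)"
  proof (intro set_eqI iffI)
    fix \<omega> assume w: "\<omega> \<in> {\<omega> \<in> space ?M. P (open_edges E \<omega> \<inter> F)}"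
    have wo: "\<omega> e = (e \<in> open_edges E \<omega> \<inter> F)" if "e \<in> F" for e
      using that assms(2) unfolding open_edges_def by blast
    have "\<omega> \<in> cyl (open_edges E \<omega> \<inter> F)" using w wo unfolding cyl_def by simp
    moreover have "open_edges E \<omega> \<inter> F \<in> {A \<in> Pow F. P A}" using w by simp
    ultimately show "\<omega> \<in> (\<Union>A\<in>{A \<in> Pow F. P A}. cyl A)" by (rule UN_I[rotated])
  next
    fix \<omega> assume "\<omega> \<in> (\<Union>A\<in>{A \<in> Pow F. P A}. cyl A)"
    then obtain A where A: "A \<subseteq> F" "P A" "\<omega> \<in> cyl A" by auto
    have "\<omega> e = (e \<in> A)" if "e \<in> F" for e using A(3) that by (simp add: cyl_def)
    then have "open_edges E \<omega> \<inter> F = A" using A(1) assms(2) unfolding open_edges_def by blast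
    then show "\<omega> \<in> {\<omega> \<in> space ?M. P (open_edges E \<omega> \<inter> F)}" using A by (auto simp: cyl_def)
  qed
  have fin: "finite {A \<in> Pow F. P A}" using assms by auto
  show "{\<omega> \<in> space ?M. P (open_edges E \<omega> \<inter> F)} \<in> sets ?M"
    unfolding eq using fin meas by (intro sets.finite_UN) auto
  have disj: "disjoint_family_on cyl {A \<in> Pow F. P A}"
    unfolding disjoint_family_on_def cyl_def by fastforce
  have "measure ?M {\<omega> \<in> space ?M. P (open_edges E \<omega> \<inter> F)} = (\<Sum>A\<in>{A \<in> Pow F. P A}. measure ?M (cyl A))"
    unfolding eq using fin meas disj by (intro finite_measure_finite_Union) auto
  also have "\<dots> = (\<Sum>A\<in>{A \<in> Pow F. P A}. (\<Prod>e\<in>A. p) * (\<Prod>e\<in>F - A. 1 - p))"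
    using prob by (intro sum.cong) auto
  also have "\<dots> = (\<Sum>A\<in>Pow F. (\<Prod>e\<in>A. p) * (\<Prod>e\<in>F - A. 1 - p) * of_bool (P A))"
    using assms by (intro sum.mono_neutral_cong_left) auto
  finally show "measure ?M {\<omega> \<in> space ?M. P (open_edges E \<omega> \<inter> F)} = pexp F (\<lambda>_. p) (\<lambda>A. of_bool (P A))"
    by (simp add: pexp_def)
qed

lemma open_edges_subset: "open_edges E \<omega> \<subseteq> E"
  by (auto simp: open_edges_def)

context bounded_degree
begin

text \<open>An infinite set has \<open>card\<close> 0, hence the implication: infinite clusters
  count as large.\<close>

definition large :: "real \<Rightarrow> 'a \<Rightarrow> nat \<Rightarrow> ('a set \<Rightarrow> bool) set" where
  "large p v n = {\<omega> \<in> space (percolation E p). finite (cluster E \<omega> v) \<longrightarrow> n \<le> card (cluster E \<omega> v)}"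

definition local_edges :: "'a \<Rightarrow> nat \<Rightarrow> 'a set set" where
  "local_edges v n = {e \<in> E. e \<inter> nball {v} n \<noteq> {}}"

lemma local_edges: "finite (local_edges v n)" "local_edges v n \<subseteq> E"
  unfolding local_edges_def using finite_touching[OF finite_nball, of "{v}" n] by auto

lemma local_edges_mono: "m \<le> n \<Longrightarrow> local_edges v m \<subseteq> local_edges v n"
  unfolding local_edges_def using nball_mono[of m n "{v}"] by blast

lemma open_local: "open_edges E \<omega> \<inter> local_edges v n = open_edges E \<omega> \<inter> {e. e \<inter> nball {v} n \<noteq> {}}"
  using open_edges_subset[of E \<omega>] by (auto simp: local_edges_def)

lemma cluster_within_iff:
  "cluster E \<omega> v \<subseteq> nball {v} n \<longleftrightarrow> reach (open_edges E \<omega> \<inter> local_edges v n) {v} \<subseteq> nball {v} n"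
proof
  let ?R = "reach (open_edges E \<omega> \<inter> local_edges v n) {v}"
  have "?R \<subseteq> cluster E \<omega> v" unfolding cluster_eq_reach by (rule reach_mono) auto
  then show "cluster E \<omega> v \<subseteq> nball {v} n \<Longrightarrow> ?R \<subseteq> nball {v} n" by simp
  show "?R \<subseteq> nball {v} n \<Longrightarrow> cluster E \<omega> v \<subseteq> nball {v} n"
    unfolding cluster_eq_reach open_local using reach_within_local[of "open_edges E \<omega>" "nball {v} n" v] by simp
qed

lemma cluster_within_eq:
  "cluster E \<omega> v \<subseteq> nball {v} n \<Longrightarrow> cluster E \<omega> v = reach (open_edges E \<omega> \<inter> local_edges v n) {v}"
  unfolding cluster_within_iff unfolding cluster_eq_reach open_local by (rule reach_within_local)

lemma finite_local_cluster: "finite (reach (open_edges E \<omega> \<inter> local_edges v n) {v})"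
  using local_edges[of v n] by (intro finite_reach[of "local_edges v n"]) auto

lemma finite_cluster_within:
  assumes "finite (cluster E \<omega> v)"
  shows "\<exists>n. cluster E \<omega> v \<subseteq> nball {v} n"
proof (rule ccontr)
  assume no: "\<not> ?thesis"
  have "n + 1 \<le> card (cluster E \<omega> v)" for n
  proof -
    have "n + 1 \<le> card (reach (open_edges E \<omega>) {v} \<inter> nball {v} n)"
      using no open_edges_subset[of E \<omega>] unfolding cluster_eq_reach by (intro card_reach_exit_ball) auto
    also have "\<dots> \<le> card (cluster E \<omega> v)" unfolding cluster_eq_reach[symmetric] using assms by (intro card_mono) auto
    finally show ?thesis .
  qed
  from this[of "card (cluster E \<omega> v)"] show False by simp
qed

text \<open>A cluster that leaves the ball of radius \<open>n\<close> has more than \<open>n\<close>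
  vertices already inside it, so the comparison of its size with \<open>n\<close> is decided by the
  edges that meet the ball. Measurability and the identification with \<open>tail\<close> rest on
  this.\<close>

lemma large_iff:
  "(finite (cluster E \<omega> v) \<longrightarrow> n \<le> card (cluster E \<omega> v)) \<longleftrightarrow> n \<le> card (reach (open_edges E \<omega> \<inter> local_edges v n) {v})"
proof (cases "cluster E \<omega> v \<subseteq> nball {v} n")
  case True
  then show ?thesis using cluster_within_eq[OF True] finite_local_cluster[of \<omega> v n] by simp
next
  case False
  let ?R = "reach (open_edges E \<omega> \<inter> local_edges v n) {v}"
  have "\<not> ?R \<subseteq> nball {v} n" using False cluster_within_iff by blast
  then have "n + 1 \<le> card (?R \<inter> nball {v} n)"
    using open_edges_subset[of E \<omega>] by (intro card_reach_exit_ball) auto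
  also have "\<dots> \<le> card ?R" using finite_local_cluster by (intro card_mono) auto
  finally have R: "n \<le> card ?R" by simp
  have "?R \<subseteq> cluster E \<omega> v" unfolding cluster_eq_reach by (rule reach_mono) auto
  then have "finite (cluster E \<omega> v) \<Longrightarrow> card ?R \<le> card (cluster E \<omega> v)" by (intro card_mono)
  with R show ?thesis by auto
qed

lemma large_measurable:
  assumes "0 \<le> p" "p \<le> 1"
  shows "large p v n \<in> sets (percolation E p)"
  unfolding large_def large_iff using percolation_cylinder(1)[OF local_edges assms] .

lemma measure_large:
  assumes "0 \<le> p" "p \<le> 1"
  shows "measure (percolation E p) (large p v n) = tail E p n v"
proof (rule antisym)
  interpret prob_space "percolation E p" by (rule prob_space_percolation)
  have "measure (percolation E p) (large p v n) = rexp (local_edges v n) p {v} (\<lambda>K. of_bool (n \<le> card K))"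
    unfolding large_def large_iff rexp_def using percolation_cylinder(2)[OF local_edges assms] .
  also have "\<dots> \<le> tail E p n v" using assms local_edges by (intro rexp_le_tail)
  finally show "measure (percolation E p) (large p v n) \<le> tail E p n v" .
  show "tail E p n v \<le> measure (percolation E p) (large p v n)"
  proof (rule tail_le)
    fix F assume F: "finite F" "F \<subseteq> E"
    have "rexp F p {v} (\<lambda>K. of_bool (n \<le> card K)) =
        measure (percolation E p) {\<omega> \<in> space (percolation E p). n \<le> card (reach (open_edges E \<omega> \<inter> F) {v})}"
      unfolding rexp_def by (rule percolation_cylinder(2)[OF F assms, where P = "\<lambda>A. n \<le> card (reach A {v})", symmetric])
    also have "\<dots> \<le> measure (percolation E p) (large p v n)"
    proof (rule finite_measure_mono)
      show "{\<omega> \<in> space (percolation E p). n \<le> card (reach (open_edges E \<omega> \<inter> F) {v})} \<subseteq> large p v n"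
      proof clarify
        fix \<omega> assume w: "\<omega> \<in> space (percolation E p)" "n \<le> card (reach (open_edges E \<omega> \<inter> F) {v})"
        have "reach (open_edges E \<omega> \<inter> F) {v} \<subseteq> cluster E \<omega> v" unfolding cluster_eq_reach by (rule reach_mono) auto
        then have "n \<le> card (cluster E \<omega> v)" if "finite (cluster E \<omega> v)"
          using card_mono[OF that] w(2) by (metis order_trans)
        then show "\<omega> \<in> large p v n" using w by (auto simp: large_def)
      qed
    qed (rule large_measurable[OF assms])
    finally show "rexp F p {v} (\<lambda>K. of_bool (n \<le> card K)) \<le> measure (percolation E p) (large p v n)" .
  qed
qed

lemma infinite_event:
  "{\<omega> \<in> space (percolation E p). infinite (cluster E \<omega> v)} = (\<Inter>n. large p v n)"
proof (intro set_eqI iffI)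
  fix \<omega> assume "\<omega> \<in> (\<Inter>n. large p v n)"
  then have "\<omega> \<in> large p v (Suc (card (cluster E \<omega> v)))" by blast
  then show "\<omega> \<in> {\<omega> \<in> space (percolation E p). infinite (cluster E \<omega> v)}" by (auto simp: large_def)
qed (auto simp: large_def)

lemma infinite_measurable:
  assumes "0 \<le> p" "p \<le> 1"
  shows "{\<omega> \<in> space (percolation E p). infinite (cluster E \<omega> v)} \<in> sets (percolation E p)"
  unfolding infinite_event using large_measurable[OF assms] by auto

lemma measure_infinite:
  assumes "0 \<le> p" "p \<le> 1"
  shows "measure (percolation E p) {\<omega> \<in> space (percolation E p). infinite (cluster E \<omega> v)} = theta E p v"
proof -
  interpret prob_space "percolation E p" by (rule prob_space_percolation)
  have "(\<lambda>n. measure (percolation E p) (large p v n)) \<longlonglongrightarrow> measure (percolation E p) (\<Inter>n. large p v n)"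
    using large_measurable[OF assms] by (intro finite_Lim_measure_decseq) (auto simp: decseq_def large_def)
  moreover have "(\<lambda>n. measure (percolation E p) (large p v n)) \<longlonglongrightarrow> theta E p v"
    unfolding measure_large[OF assms] by (rule tail_tendsto_theta[OF assms])
  ultimately show ?thesis unfolding infinite_event by (rule LIMSEQ_unique)
qed

definition finite_large :: "real \<Rightarrow> 'a \<Rightarrow> nat \<Rightarrow> ('a set \<Rightarrow> bool) set" where
  "finite_large p v n = {\<omega> \<in> space (percolation E p). finite (cluster E \<omega> v) \<and> n \<le> card (cluster E \<omega> v)}"

lemma finite_large_measurable:
  assumes "0 \<le> p" "p \<le> 1"
  shows "finite_large p v n \<in> sets (percolation E p)"
proof -
  have "finite_large p v n = large p v n - {\<omega> \<in> space (percolation E p). infinite (cluster E \<omega> v)}"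
    by (auto simp: finite_large_def large_def)
  then show ?thesis using large_measurable[OF assms] infinite_measurable[OF assms] by auto
qed

lemma finite_large_le_tail:
  assumes "0 \<le> p" "p \<le> 1"
  shows "measure (percolation E p) (finite_large p v n) \<le> tail E p n v"
proof -
  interpret prob_space "percolation E p" by (rule prob_space_percolation)
  show ?thesis unfolding measure_large[OF assms, symmetric]
    by (intro finite_measure_mono large_measurable[OF assms]) (auto simp: finite_large_def large_def)
qed

lemma finite_large_ge:
  assumes "0 \<le> p" "p \<le> 1"
  shows "tail E p n v - tail E p N v \<le> measure (percolation E p) (finite_large p v n)"
proof -
  interpret prob_space "percolation E p" by (rule prob_space_percolation)
  have "measure (percolation E p) (large p v n) \<le> measure (percolation E p) (finite_large p v n \<union> large p v N)"
    using large_measurable[OF assms] finite_large_measurable[OF assms]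
    by (intro finite_measure_mono) (auto simp: finite_large_def large_def)
  also have "\<dots> \<le> measure (percolation E p) (finite_large p v n) + measure (percolation E p) (large p v N)"
    using large_measurable[OF assms] finite_large_measurable[OF assms] by (intro measure_Un_le)
  finally show ?thesis unfolding measure_large[OF assms] by simp
qed

text \<open>Every finite cluster lies in some ball, so the event is an increasing union over the
  radii, and a bound that is uniform in the radius passes to the limit.\<close>

lemma finite_large_le:
  assumes "0 \<le> p" "p \<le> 1"
    and b: "\<And>m. rexp (local_edges v m) p {v} (\<lambda>K. of_bool (K \<subseteq> nball {v} m \<and> n \<le> card K)) \<le> b"
  shows "measure (percolation E p) (finite_large p v n) \<le> b"
proof -
  interpret prob_space "percolation E p" by (rule prob_space_percolation)
  define B where "B = (\<lambda>m. {\<omega> \<in> space (percolation E p). cluster E \<omega> v \<subseteq> nball {v} m \<and> n \<le> card (cluster E \<omega> v)})"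
  have B: "B m = {\<omega> \<in> space (percolation E p). reach (open_edges E \<omega> \<inter> local_edges v m) {v} \<subseteq> nball {v} m \<and>
      n \<le> card (reach (open_edges E \<omega> \<inter> local_edges v m) {v})}" for m
    unfolding B_def using cluster_within_iff cluster_within_eq by (intro Collect_cong) metis
  have meas: "B m \<in> sets (percolation E p)" for m
    unfolding B using percolation_cylinder(1)[OF local_edges assms(1,2)] .
  have "finite_large p v n = (\<Union>m. B m)"
  proof (intro set_eqI iffI)
    fix \<omega> assume "\<omega> \<in> finite_large p v n"
    then show "\<omega> \<in> (\<Union>m. B m)" using finite_cluster_within[of \<omega> v] by (auto simp: finite_large_def B_def)
  next
    fix \<omega> assume "\<omega> \<in> (\<Union>m. B m)"
    then obtain m where "\<omega> \<in> B m" by blast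
    then show "\<omega> \<in> finite_large p v n"
      using finite_subset[OF _ finite_nball[of "{v}" m]] by (auto simp: finite_large_def B_def)
  qed
  moreover have "(\<lambda>m. measure (percolation E p) (B m)) \<longlonglongrightarrow> measure (percolation E p) (\<Union>m. B m)"
    using meas by (intro finite_Lim_measure_incseq) (auto simp: incseq_def B_def dest: nball_mono[of _ _ "{v}"])
  moreover have "measure (percolation E p) (B m) \<le> b" for m
    unfolding B using b[of m] percolation_cylinder(2)[OF local_edges assms(1,2),
      where P = "\<lambda>A. reach A {v} \<subseteq> nball {v} m \<and> n \<le> card (reach A {v})"] by (simp add: rexp_def)
  ultimately show ?thesis by (auto intro: LIMSEQ_le_const2)
qed

text \<open>A connection uses finitely many edges, so the event is an increasing union of events
  that depend on the edges near a ball.\<close>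

lemma two_point_limit:
  assumes "0 \<le> p" "p \<le> 1"
  shows "(\<lambda>m. rexp (local_edges u m) p {u} (\<lambda>K. of_bool (v \<in> K))) \<longlonglongrightarrow> two_point E p u v"
    and "{\<omega> \<in> space (percolation E p). v \<in> cluster E \<omega> u} \<in> sets (percolation E p)"
proof -
  interpret prob_space "percolation E p" by (rule prob_space_percolation)
  define B where "B = (\<lambda>m. {\<omega> \<in> space (percolation E p). v \<in> reach (open_edges E \<omega> \<inter> local_edges u m) {u}})"
  have meas: "B m \<in> sets (percolation E p)" for m
    unfolding B_def using percolation_cylinder(1)[OF local_edges assms] .
  have un: "{\<omega> \<in> space (percolation E p). v \<in> cluster E \<omega> u} = (\<Union>m. B m)"
  proof -
    have "\<exists>m. x \<in> nball {u} m \<and> x \<in> reach (open_edges E \<omega> \<inter> local_edges u m) {u}" if "linked (open_edges E \<omega>) u x" for \<omega> x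
      using that
    proof (induction rule: linked_induct)
      case refl
      show ?case by (intro exI[of _ 0]) auto
    next
      case (step x y)
      then obtain m where m: "x \<in> nball {u} m" "x \<in> reach (open_edges E \<omega> \<inter> local_edges u m) {u}" by blast
      have xyE: "{x, y} \<in> E" using step.hyps(2) by (simp add: open_edges_def)
      then have "{x, y} \<in> local_edges u m" using m(1) unfolding local_edges_def by simp
      then have "y \<in> reach (open_edges E \<omega> \<inter> local_edges u m) {u}"
        using reach_closed[OF m(2)] step.hyps(2) by simp
      moreover have "reach (open_edges E \<omega> \<inter> local_edges u m) {u} \<subseteq> reach (open_edges E \<omega> \<inter> local_edges u (Suc m)) {u}"
        using local_edges_mono[of m "Suc m" u] by (intro reach_mono) auto
      moreover have "y \<in> nball {u} (Suc m)" using m(1) xyE by auto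
      ultimately show ?case by blast
    qed
    moreover have "v \<in> cluster E \<omega> u" if "v \<in> reach (open_edges E \<omega> \<inter> local_edges u m) {u}" for \<omega> m
      using that reach_mono[of "open_edges E \<omega> \<inter> local_edges u m" "open_edges E \<omega>" "{u}" "{u}"] by (auto simp: cluster_eq_reach)
    ultimately show ?thesis unfolding B_def using cluster_def by fast
  qed
  show "{\<omega> \<in> space (percolation E p). v \<in> cluster E \<omega> u} \<in> sets (percolation E p)"
    unfolding un using meas by auto
  have inc: "incseq B"
    unfolding incseq_def
  proof (intro allI impI subsetI)
    fix m k \<omega> assume mk: "m \<le> k" and w: "\<omega> \<in> B m"
    have "reach (open_edges E \<omega> \<inter> local_edges u m) {u} \<subseteq> reach (open_edges E \<omega> \<inter> local_edges u k) {u}"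
      using local_edges_mono[OF mk, of u] by (intro reach_mono) auto
    then show "\<omega> \<in> B k" using w unfolding B_def by blast
  qed
  have "measure (percolation E p) (B m) = rexp (local_edges u m) p {u} (\<lambda>K. of_bool (v \<in> K))" for m
    unfolding B_def rexp_def using percolation_cylinder(2)[OF local_edges assms] .
  then show "(\<lambda>m. rexp (local_edges u m) p {u} (\<lambda>K. of_bool (v \<in> K))) \<longlonglongrightarrow> two_point E p u v"
    using finite_Lim_measure_incseq[of B] meas inc unfolding two_point_def un by auto
qed

lemma rexp_le_two_point:
  assumes "0 \<le> p" "p \<le> 1" "finite F" "F \<subseteq> E"
  shows "rexp F p {u} (\<lambda>K. of_bool (v \<in> K)) \<le> two_point E p u v"
proof -
  interpret prob_space "percolation E p" by (rule prob_space_percolation)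
  have "rexp F p {u} (\<lambda>K. of_bool (v \<in> K)) =
      measure (percolation E p) {\<omega> \<in> space (percolation E p). v \<in> reach (open_edges E \<omega> \<inter> F) {u}}"
    unfolding rexp_def by (rule percolation_cylinder(2)[OF assms(3,4,1,2), where P = "\<lambda>A. v \<in> reach A {u}", symmetric])
  also have "\<dots> \<le> two_point E p u v"
    unfolding two_point_def
  proof (rule finite_measure_mono[OF _ two_point_limit(2)[OF assms(1,2)]])
    show "{\<omega> \<in> space (percolation E p). v \<in> reach (open_edges E \<omega> \<inter> F) {u}} \<subseteq> {\<omega> \<in> space (percolation E p). v \<in> cluster E \<omega> u}"
      using reach_mono[of "open_edges E _ \<inter> F" "open_edges E _" "{u}" "{u}"] unfolding cluster_eq_reach by blast
  qed
  finally show ?thesis .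
qed

lemma two_point_zero: "two_point E 0 u v = of_bool (u = v)"
proof -
  have z: "finite F \<Longrightarrow> pexp F (\<lambda>_. 0) f = f {}" for F and f :: "'a set set \<Rightarrow> real"
    by (induction F rule: finite_induct) (auto simp: pexp_insert)
  have "reach {} {u} = {u}" by (rule reach_eq_self) auto
  then have "rexp (local_edges u m) 0 {u} (\<lambda>K. of_bool (v \<in> K)) = of_bool (u = v)" for m
    unfolding rexp_def using z[OF local_edges(1)] by simp
  with two_point_limit(1)[of 0 u v] show ?thesis by (simp add: LIMSEQ_const_iff)
qed

end

text \<open>The test function is \<open>a\<close> normalised on \<open>S\<close> and 0 elsewhere,
  which turns the infinite sums defining \<open>T f\<close> into finite ones; a further
  Cauchy--Schwarz inequality passes from the norm of \<open>T f\<close> to its sum over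
  \<open>S\<close>.\<close>

lemma l2_op_norm_bound:
  assumes fin: "l2_op_norm V T < \<infinity>" and T0: "\<And>x y. 0 \<le> T x y"
  shows "\<exists>M>0. \<forall>S a. finite S \<longrightarrow> S \<subseteq> V \<longrightarrow> (\<forall>y. 0 \<le> a y) \<longrightarrow>
    (\<Sum>x\<in>S. \<Sum>y\<in>S. T x y * a y) \<le> M * sqrt (card S) * sqrt (\<Sum>y\<in>S. (a y)\<^sup>2)"
proof -
  obtain M0 where M0: "0 \<le> M0" "l2_op_norm V T = ennreal M0" using fin by (cases "l2_op_norm V T") auto
  define M where "M = M0 + 1"
  show ?thesis
  proof (intro exI[of _ M] conjI allI impI)
    show "0 < M" using M0 by (simp add: M_def)
    fix S and a :: "'a \<Rightarrow> real" assume S: "finite S" "S \<subseteq> V" and a: "\<forall>y. 0 \<le> a y"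
    define N where "N = sqrt (\<Sum>y\<in>S. (a y)\<^sup>2)"
    have N0: "0 \<le> N" by (simp add: N_def sum_nonneg)
    show "(\<Sum>x\<in>S. \<Sum>y\<in>S. T x y * a y) \<le> M * sqrt (card S) * sqrt (\<Sum>y\<in>S. (a y)\<^sup>2)"
    proof (cases "N = 0")
      case True
      then have "(\<Sum>y\<in>S. (a y)\<^sup>2) = 0" by (simp add: N_def)
      then have "a y = 0" if "y \<in> S" for y using S that by (simp add: sum_nonneg_eq_0_iff)
      then show ?thesis using N0 M0 by (simp add: M_def sum_nonneg)
    next
      case False
      with N0 have Npos: "0 < N" by simp
      have N2: "N\<^sup>2 = (\<Sum>y\<in>S. (a y)\<^sup>2)" by (simp add: N_def sum_nonneg)
      define f where "f = (\<lambda>y. if y \<in> S then a y / N else 0)"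
      have sup: "g summable_on V" "infsum g V = sum g S" if "\<And>y. y \<in> V \<Longrightarrow> y \<notin> S \<Longrightarrow> g y = 0" for g :: "'a \<Rightarrow> real"
      proof -
        have "g summable_on S" using S by (intro summable_on_finite)
        then show "g summable_on V" by (rule summable_on_cong_neutral[THEN iffD1, rotated 3]) (use S that in auto)
        have "infsum g V = infsum g S" by (rule infsum_cong_neutral) (use S that in auto)
        then show "infsum g V = sum g S" using S by simp
      qed
      have "infsum (\<lambda>v. (f v)\<^sup>2) V = (\<Sum>y\<in>S. (f y)\<^sup>2)" by (rule sup) (auto simp: f_def)
      also have "\<dots> = (\<Sum>y\<in>S. (a y)\<^sup>2 / N\<^sup>2)" by (intro sum.cong) (auto simp: f_def power_divide)
      also have "\<dots> = 1" unfolding sum_divide_distrib[symmetric] N2[symmetric] using Npos by simp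
      finally have n1: "l2norm V f = 1"
        unfolding l2norm_def using sup(1)[of "\<lambda>v. (f v)\<^sup>2"] by (auto simp: f_def)
      define h where "h = (\<lambda>x. \<Sum>y\<in>S. T x y * f y)"
      have s: "(\<lambda>v. T u v * f v) summable_on V" "infsum (\<lambda>v. T u v * f v) V = h u" for u
        unfolding h_def by (rule sup; simp add: f_def)+
      have "l2norm V h \<le> l2_op_norm V T"
        unfolding l2_op_norm_def
        by (rule SUP_upper2[of f]) (use n1 s in auto)
      then have hM: "l2norm V h \<le> ennreal M0" using M0 by simp
      then have hs: "(\<lambda>v. (h v)\<^sup>2) summable_on V" "sqrt (infsum (\<lambda>v. (h v)\<^sup>2) V) \<le> M0"
        unfolding l2norm_def using M0 by (auto split: if_splits simp: top_unique)
      have "(\<Sum>x\<in>S. (h x)\<^sup>2) \<le> infsum (\<lambda>v. (h v)\<^sup>2) V"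
        using S by (intro finite_sum_le_infsum hs) auto
      then have "sqrt (\<Sum>x\<in>S. (h x)\<^sup>2) \<le> M0" using hs(2) by (meson order_trans real_sqrt_le_mono)
      have "(\<Sum>x\<in>S. h x) \<le> sqrt (card S) * sqrt (\<Sum>x\<in>S. (h x)\<^sup>2)"
      proof -
        have "(\<Sum>x\<in>S. h x * 1)\<^sup>2 \<le> (\<Sum>x\<in>S. (h x)\<^sup>2) * (\<Sum>x\<in>S. 1\<^sup>2)" by (rule Cauchy_Schwarz_ineq_sum)
        then have "(\<Sum>x\<in>S. h x)\<^sup>2 \<le> card S * (\<Sum>x\<in>S. (h x)\<^sup>2)" by (simp add: mult.commute)
        then have "(\<Sum>x\<in>S. h x) \<le> sqrt (card S * (\<Sum>x\<in>S. (h x)\<^sup>2))" by (rule real_le_rsqrt)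
        then show ?thesis by (simp add: real_sqrt_mult)
      qed
      also have "\<dots> \<le> sqrt (card S) * M" using \<open>sqrt (\<Sum>x\<in>S. (h x)\<^sup>2) \<le> M0\<close> unfolding M_def by (intro mult_left_mono) auto
      finally have "N * (\<Sum>x\<in>S. h x) \<le> N * (sqrt (card S) * M)" using Npos by (intro mult_left_mono) auto
      moreover have "N * (\<Sum>x\<in>S. h x) = (\<Sum>x\<in>S. \<Sum>y\<in>S. T x y * a y)"
        unfolding h_def sum_distrib_left using Npos by (intro sum.cong) (auto simp: f_def)
      ultimately show ?thesis by (simp add: N_def mult_ac)
    qed
  qed
qed

section \<open>Proof of the theorem\<close>

lemma id_automorphism: "id \<in> automorphisms V E"
  by (simp add: automorphisms_def)

lemma quasi_transitive_representatives:
  assumes "quasi_transitive V E"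
  shows "\<exists>R. finite R \<and> R \<subseteq> V \<and> (\<forall>v\<in>V. \<exists>x\<in>R. \<exists>\<phi>. bij_betw \<phi> V V \<and>
      (\<forall>u\<in>V. \<forall>w\<in>V. {\<phi> u, \<phi> w} \<in> E \<longleftrightarrow> {u, w} \<in> E) \<and> \<phi> x = v)"
proof -
  define orb where "orb = (\<lambda>v. {\<phi> v | \<phi>. \<phi> \<in> automorphisms V E})"
  have "{{\<phi> v | \<phi>. \<phi> \<in> automorphisms V E} | v. v \<in> V} = orb ` V" by (auto simp: orb_def)
  then have fin: "finite (orb ` V)" using assms unfolding quasi_transitive_def by simp
  then obtain R where R: "R \<subseteq> V" "finite R" "orb ` V = orb ` R"
    using finite_subset_image[OF fin order_refl] by blast
  have "\<exists>x\<in>R. \<exists>\<phi>\<in>automorphisms V E. \<phi> x = v" if "v \<in> V" for v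
  proof -
    have "orb v \<in> orb ` R" unfolding R(3)[symmetric] using that by (rule imageI)
    then obtain x where x: "x \<in> R" "orb v = orb x" by (elim imageE)
    have "v \<in> orb v" unfolding orb_def mem_Collect_eq by (rule exI[of _ id]) (simp add: id_automorphism)
    then have "v \<in> orb x" using x(2) by simp
    then obtain \<phi> where "\<phi> \<in> automorphisms V E" "v = \<phi> x" unfolding orb_def by blast
    then show ?thesis using x(1) by blast
  qed
  then show ?thesis using R(1,2) unfolding automorphisms_def by (intro exI[of _ R]) blast
qed

text \<open>Degrees are constant on orbits, so the representatives bound all of them.\<close>

lemma quasi_transitive_graphI:
  assumes "simple_graph V E" "connected_graph V E" "locally_finite_graph V E" "quasi_transitive V E"
  shows "\<exists>D. quasi_transitive_graph E D V"
proof -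
  obtain R where R: "finite R" "R \<subseteq> V" "\<And>v. v \<in> V \<Longrightarrow> \<exists>x\<in>R. \<exists>\<phi>. bij_betw \<phi> V V \<and>
      (\<forall>u\<in>V. \<forall>w\<in>V. {\<phi> u, \<phi> w} \<in> E \<longleftrightarrow> {u, w} \<in> E) \<and> \<phi> x = v"
    using quasi_transitive_representatives[OF assms(4)] by blast
  have EV: "\<And>e. e \<in> E \<Longrightarrow> e \<subseteq> V" and card2: "\<And>e. e \<in> E \<Longrightarrow> card e = 2"
    using assms(1) by (auto simp: simple_graph_def)
  have fin: "finite {e \<in> E. v \<in> e}" for v
  proof (cases "v \<in> V")
    case False
    then have "{e \<in> E. v \<in> e} = {}" using EV by auto
    then show ?thesis by (simp only: finite.emptyI)
  qed (use assms(3) in \<open>simp add: locally_finite_graph_def\<close>)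
  define D where "D = Max (insert 0 ((\<lambda>x. card {e \<in> E. x \<in> e}) ` R))"
  have "card {e \<in> E. v \<in> e} \<le> D" for v
  proof (cases "v \<in> V")
    case False
    then have "{e \<in> E. v \<in> e} = {}" using EV by auto
    then show ?thesis by (simp only: card.empty)
  next
    case True
    obtain x \<phi> where x: "x \<in> R" "bij_betw \<phi> V V" "\<And>u w. u \<in> V \<Longrightarrow> w \<in> V \<Longrightarrow> {\<phi> u, \<phi> w} \<in> E \<longleftrightarrow> {u, w} \<in> E" "\<phi> x = v"
      using R(3)[OF True] by blast
    have "{e \<in> E. v \<in> e} \<subseteq> (`) \<phi> ` {e \<in> E. x \<in> e}"
    proof
      fix e assume e: "e \<in> {e \<in> E. v \<in> e}"
      then obtain a b where ab: "e = {a, b}" using card2[of e] by (auto simp: card_2_iff)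
      then obtain w where w: "e = {v, w}" using e by (auto simp: insert_commute)
      have "w \<in> V" using EV[of e] e w by auto
      then obtain y where y: "y \<in> V" "w = \<phi> y" using x(2) by (auto simp: bij_betw_def)
      have "{x, y} \<in> E" using x(3)[of x y] x(1,4) y R(2) e w by auto
      moreover have "e = \<phi> ` {x, y}" using w y x(4) by auto
      ultimately show "e \<in> (`) \<phi> ` {e \<in> E. x \<in> e}" by blast
    qed
    then have "card {e \<in> E. v \<in> e} \<le> card {e \<in> E. x \<in> e}" using fin surj_card_le by blast
    also have "\<dots> \<le> D" unfolding D_def using R(1) x(1) by (intro Max_ge) auto
    finally show ?thesis .
  qed
  moreover have "linked E u v" if "u \<in> V" "v \<in> V" for u v
    using assms(2) that by (simp add: connected_graph_def)
  ultimately have "quasi_transitive_graph E D V"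
    using Union_least[of E V, OF EV] card2 fin quasi_transitive_representatives[OF assms(4)]
    by (intro quasi_transitive_graph.intro bounded_degree.intro quasi_transitive_graph_axioms.intro)
  then show ?thesis by blast
qed

context quasi_transitive_graph
begin

section \<open>The critical probability in terms of the susceptibility and the functional
  \<open>phi\<close>\<close>

definition bounded_susceptibility :: "real \<Rightarrow> bool" where
  "bounded_susceptibility p \<longleftrightarrow> (\<exists>X. \<forall>v\<in>V. \<forall>F. finite F \<longrightarrow> F \<subseteq> E \<longrightarrow> rexp F p {v} (\<lambda>K. real (card K)) \<le> X)"

lemma countable_V: "countable V"
proof (cases "V = {}")
  case False
  then obtain v where v: "v \<in> V" by blast
  have "V \<subseteq> (\<Union>n. nball {v} n)"
  proof
    fix u assume "u \<in> V"
    then have "linked E v u" using v linked_V by blast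
    then show "u \<in> (\<Union>n. nball {v} n)"
    proof (induction rule: linked_induct)
      case refl
      have "v \<in> nball {v} 0" by simp
      then show ?case by blast
    next
      case (step x y)
      then obtain n where "x \<in> nball {v} n" by blast
      then have "y \<in> nball {v} (Suc n)" using step.hyps by auto
      then show ?case by blast
    qed
  qed
  moreover have "countable (\<Union>n. nball {v} n)" by (intro countable_UN) (auto intro: countable_finite finite_nball)
  ultimately show ?thesis by (rule countable_subset)
qed simp

text \<open>\<open>V\<close> is countable, being covered by balls, so the almost sure statement
  about all vertices splits into one for each vertex.\<close>

lemma AE_finite_iff:
  assumes "0 \<le> p" "p \<le> 1"
  shows "(AE \<omega> in percolation E p. \<forall>v\<in>V. finite (cluster E \<omega> v)) \<longleftrightarrow> (\<forall>v\<in>V. theta E p v = 0)"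
proof -
  interpret prob_space "percolation E p" by (rule prob_space_percolation)
  have "(AE \<omega> in percolation E p. finite (cluster E \<omega> v)) \<longleftrightarrow> theta E p v = 0" for v
  proof -
    have "(AE \<omega> in percolation E p. finite (cluster E \<omega> v)) \<longleftrightarrow>
        emeasure (percolation E p) {\<omega> \<in> space (percolation E p). infinite (cluster E \<omega> v)} = 0"
      using infinite_measurable[OF assms, of v] by (subst AE_iff_measurable[OF _ refl]) auto
    then show ?thesis unfolding emeasure_eq_measure measure_infinite[OF assms] using theta_nonneg[OF assms, of E v] by (auto simp: ennreal_eq_0_iff)
  qed
  then show ?thesis by (simp add: AE_ball_countable[OF countable_V])
qed

lemma bounded_susceptibility_theta:
  assumes "0 \<le> p" "p \<le> 1" "bounded_susceptibility p" "v \<in> V"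
  shows "theta E p v = 0"
proof -
  obtain X where X: "\<And>F. finite F \<Longrightarrow> F \<subseteq> E \<Longrightarrow> rexp F p {v} (\<lambda>K. real (card K)) \<le> X"
    using assms by (auto simp: bounded_susceptibility_def)
  have le: "theta E p v \<le> X / real n" if "n \<ge> 1" for n
  proof -
    have "tail E p n v \<le> X / n"
    proof (rule tail_le)
      fix F assume F: "finite F" "F \<subseteq> E"
      have "n * rexp F p {v} (\<lambda>K. of_bool (n \<le> card K)) = rexp F p {v} (\<lambda>K. n * of_bool (n \<le> card K))" by (simp add: rexp_cmult)
      also have "\<dots> \<le> rexp F p {v} (\<lambda>K. real (card K))" using F assms by (intro rexp_mono) auto
      also have "\<dots> \<le> X" by (rule X[OF F])
      finally show "rexp F p {v} (\<lambda>K. of_bool (n \<le> card K)) \<le> X / n" using that by (simp add: field_simps)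
    qed
    then show ?thesis using theta_le_tail[OF assms(1,2), of E v n] by simp
  qed
  have "(\<lambda>n. X / real n) \<longlonglongrightarrow> 0" by (rule lim_const_over_n)
  then have "theta E p v \<le> 0" by (rule LIMSEQ_le_const) (use le in \<open>auto intro!: exI[of _ 1]\<close>)
  then show ?thesis using theta_nonneg[OF assms(1,2), of E v] by simp
qed

lemma bounded_susceptibilityI:
  assumes "0 \<le> p" "p \<le> 1" "\<And>v. v \<in> V \<Longrightarrow> \<exists>S. finite S \<and> S \<subseteq> V \<and> v \<in> S \<and> phi E p v S < 1"
  shows "bounded_susceptibility p"
  unfolding bounded_susceptibility_def by (rule susceptibility_bounded[OF assms])

lemma p_crit_bdd: "bdd_above {p\<in>{0..1}. AE \<omega> in percolation E p. \<forall>v\<in>V. finite (cluster E \<omega> v)}"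
  by (rule bdd_aboveI[of _ 1]) auto

lemma le_p_crit:
  assumes "0 \<le> p" "p \<le> 1" "bounded_susceptibility p"
  shows "p \<le> p_crit V E"
  unfolding p_crit_def
  using assms AE_finite_iff[OF assms(1,2)] bounded_susceptibility_theta[OF assms]
  by (intro cSup_upper p_crit_bdd) auto

text \<open>On \<open>{v}\<close> the functional is at most \<open>p * D\<close>. This makes the
  critical probability positive.\<close>

lemma bounded_susceptibility_small:
  fixes p :: real
  assumes "0 \<le> p" "p \<le> 1" "p * D < 1"
  shows "bounded_susceptibility p"
proof (rule bounded_susceptibilityI[OF assms(1,2)])
  fix v assume v: "v \<in> V"
  define I where "I = {(x, y). x \<in> {v} \<and> y \<notin> {v} \<and> {x, y} \<in> {e \<in> E. v \<in> e}}"
  have I: "I = {(x, y). x \<in> {v} \<and> y \<notin> {v} \<and> {x, y} \<in> E}" by (auto simp: I_def)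
  have cI: "card I \<le> D"
    using finite_crossing_pairs(2)[OF finite_incident, of "{v}" v] degree_le[of v] unfolding I_def by simp
  have finF: "finite {e \<in> E. e \<subseteq> {v}}" by (rule finite_subset[of _ "Pow {v}"]) auto
  have "phi E p v {v} \<le> p * (\<Sum>(x, y)\<in>I. 1)"
    unfolding phi_def I[symmetric] using assms finF
    by (intro mult_left_mono sum_mono) (auto intro!: rexp_le_const)
  also have "\<dots> = p * card I" by (simp add: case_prod_beta)
  also have "\<dots> \<le> p * D" using cI assms by (intro mult_left_mono) auto
  finally have "phi E p v {v} < 1" using assms by simp
  then show "\<exists>S. finite S \<and> S \<subseteq> V \<and> v \<in> S \<and> phi E p v S < 1" using v by (intro exI[of _ "{v}"]) auto
qed

lemma p_crit_pos: "0 < p_crit V E"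
proof -
  define p where "p = 1 / (real D + 1)"
  have "0 < p" "p \<le> 1" "p * D < 1" by (auto simp: p_def field_simps)
  then show ?thesis using le_p_crit[of p] bounded_susceptibility_small[of p] by simp
qed

text \<open>Without bounded susceptibility some vertex has functional at least 1 on all sets, hence
  \<theta> > 0 at every larger parameter below 1 and by monotonicity at \<open>q\<close>, where all
  clusters are finite.\<close>

lemma below_p_crit:
  assumes "0 < p" "p < p_crit V E"
  shows "bounded_susceptibility p"
proof (rule ccontr)
  assume nb: "\<not> bounded_susceptibility p"
  have ne: "{p\<in>{0..1}. AE \<omega> in percolation E p. \<forall>v\<in>V. finite (cluster E \<omega> v)} \<noteq> {}"
  proof -
    have "bounded_susceptibility 0" by (rule bounded_susceptibility_small) auto
    then show ?thesis using AE_finite_iff[of 0] bounded_susceptibility_theta[of 0] by (auto intro!: exI[of _ 0])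
  qed
  obtain q where q: "0 \<le> q" "q \<le> 1" "AE \<omega> in percolation E q. \<forall>v\<in>V. finite (cluster E \<omega> v)" "p < q"
    using less_cSupD[OF ne assms(2)[unfolded p_crit_def]] by auto
  have "\<not> (\<forall>v\<in>V. \<exists>S. finite S \<and> S \<subseteq> V \<and> v \<in> S \<and> phi E p v S < 1)"
    using nb bounded_susceptibilityI[of p] assms q by auto
  then obtain v where v: "v \<in> V" "\<And>S. finite S \<Longrightarrow> S \<subseteq> V \<Longrightarrow> v \<in> S \<Longrightarrow> 1 \<le> phi E p v S"
    unfolding linorder_not_less[symmetric] by blast
  define t where "t = (p + q) / 2"
  have t: "p < t" "t < q" "t < 1" "0 \<le> t" using q assms by (auto simp: t_def)
  have "1 - exp (- 4 * (t - p)) \<le> theta E t v" using v t assms by (intro theta_lower) auto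
  also have "\<dots> \<le> theta E q v" using t q by (intro theta_mono_p) auto
  also have "\<dots> = 0" using q AE_finite_iff[of q] v by auto
  finally show False using t by simp
qed

text \<open>Otherwise every vertex has a good set, the susceptibility is bounded at
  \<open>p\<close>, and \<open>p\<close> is at most the critical probability. The negation yields
  one exceptional vertex, which may depend on \<open>p\<close>.\<close>

lemma above_p_crit:
  assumes "p_crit V E < p" "p \<le> 1"
  shows "\<exists>v\<in>V. \<forall>S. finite S \<longrightarrow> S \<subseteq> V \<longrightarrow> v \<in> S \<longrightarrow> 1 \<le> phi E p v S"
proof (rule ccontr)
  assume "\<not> ?thesis"
  then have *: "\<exists>S. finite S \<and> S \<subseteq> V \<and> v \<in> S \<and> phi E p v S < 1" if "v \<in> V" for v
    using that unfolding linorder_not_less[symmetric] by blast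
  have p0: "0 \<le> p" using assms p_crit_pos by simp
  have "p \<le> p_crit V E" by (rule le_p_crit[OF p0 assms(2) bounded_susceptibilityI[OF p0 assms(2) *]])
  with assms show False by simp
qed

text \<open>
  Without this \<^const>\<open>p_2_2\<close> might be the supremum of the empty set, which is unspecified for reals.
\<close>

lemma l2_op_norm_zero: "l2_op_norm V (two_point E 0) < \<infinity>"
proof -
  have s: "(\<lambda>v. of_bool (u = v) * f v) summable_on V" "infsum (\<lambda>v. of_bool (u = v) * f v) V = f u"
    if "u \<in> V" for u and f :: "'a \<Rightarrow> real"
  proof -
    have "(\<lambda>v. of_bool (u = v) * f v) summable_on {u}" by simp
    then show "(\<lambda>v. of_bool (u = v) * f v) summable_on V"
      by (rule summable_on_cong_neutral[THEN iffD1, rotated 3]) (use that in auto)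
    have "infsum (\<lambda>v. of_bool (u = v) * f v) V = infsum (\<lambda>v. of_bool (u = v) * f v) {u}"
      by (rule infsum_cong_neutral) (use that in auto)
    then show "infsum (\<lambda>v. of_bool (u = v) * f v) V = f u" by simp
  qed
  have n: "l2norm V (\<lambda>u. infsum (\<lambda>v. of_bool (u = v) * f v) V) = l2norm V f" for f
  proof -
    have "(\<lambda>u. (infsum (\<lambda>v. of_bool (u = v) * f v) V)\<^sup>2) summable_on V \<longleftrightarrow> (\<lambda>u. (f u)\<^sup>2) summable_on V"
      using s by (intro summable_on_cong) simp
    moreover have "infsum (\<lambda>u. (infsum (\<lambda>v. of_bool (u = v) * f v) V)\<^sup>2) V = infsum (\<lambda>u. (f u)\<^sup>2) V"
      using s by (intro infsum_cong) simp
    ultimately show ?thesis unfolding l2norm_def by simp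
  qed
  have "l2_op_norm V (two_point E 0) \<le> 1"
    unfolding l2_op_norm_def two_point_zero using s(1) n by (intro SUP_least) auto
  also have "\<dots> < \<infinity>" by simp
  finally show ?thesis .
qed

end

theorem theorem1p1:
  fixes V :: "'a set" and E :: "'a set set"
  assumes "simple_graph V E"
    and "connected_graph V E"
    and "locally_finite_graph V E"
    and "quasi_transitive V E"
    and "p_crit V E < p_2_2 V E"
  shows "\<exists>\<delta> c\<^sub>1 c\<^sub>2 C\<^sub>1 C\<^sub>2 :: real. \<delta> > 0 \<and> c\<^sub>1 > 0 \<and> c\<^sub>2 > 0 \<and> C\<^sub>1 > 0 \<and> C\<^sub>2 > 0 \<and>
    (\<forall>n::nat. \<forall>v\<in>V. \<forall>p::real. n \<ge> 1 \<longrightarrow> p \<in> {p_crit V E - \<delta> <..< p_crit V E + \<delta>} \<longrightarrow>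
       c\<^sub>1 * real n powr (- 1 / 2) * exp (- C\<^sub>1 * \<bar>p - p_crit V E\<bar>\<^sup>2 * real n)
         \<le> measure (percolation E p) {\<omega> \<in> space (percolation E p).
              finite (cluster E \<omega> v) \<and> n \<le> card (cluster E \<omega> v)} \<and>
       measure (percolation E p) {\<omega> \<in> space (percolation E p).
              finite (cluster E \<omega> v) \<and> n \<le> card (cluster E \<omega> v)}
         \<le> C\<^sub>2 * real n powr (- 1 / 2) * exp (- c\<^sub>2 * \<bar>p - p_crit V E\<bar>\<^sup>2 * real n))"
proof -
  obtain D where "quasi_transitive_graph E D V" using quasi_transitive_graphI[OF assms(1-4)] by blast
  then interpret quasi_transitive_graph E D V .
  define pc where "pc = p_crit V E"
  define \<P> where "\<P> = {p\<in>{0..1}. l2_op_norm V (two_point E p) < \<infinity>}"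
  have "0 \<in> \<P>" using l2_op_norm_zero by (simp add: \<P>_def)
  \<comment> \<open>\<open>ph\<close> is chosen inside the set whose supremum is
    \<open>p_2_2\<close>, so the norm is finite at \<open>ph\<close> itself; smaller parameters are
    covered because their two-point functions are dominated by the one at \<open>ph\<close>.\<close>
  then obtain ph where ph: "ph \<in> \<P>" "pc < ph"
    using less_cSupD[of \<P> pc] assms(5) unfolding p_2_2_def \<P>_def[symmetric] pc_def[symmetric] by blast
  have pc0: "0 < pc" unfolding pc_def by (rule p_crit_pos)
  have ph1: "0 < ph" "ph \<le> 1" using ph pc0 by (auto simp: \<P>_def)
  obtain M where M: "0 < M" "\<And>S a. finite S \<Longrightarrow> S \<subseteq> V \<Longrightarrow> (\<forall>y. 0 \<le> a y) \<Longrightarrow>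
    (\<Sum>x\<in>S. \<Sum>y\<in>S. two_point E ph x y * a y) \<le> M * sqrt (card S) * sqrt (\<Sum>y\<in>S. (a y)\<^sup>2)"
    using l2_op_norm_bound[of V "two_point E ph"] ph by (auto simp: \<P>_def two_point_def)
  define \<delta> where "\<delta> = min (pc / 8) (min ((1 - pc) / 8) ((ph - pc) / 2))"
  have \<delta>: "0 < \<delta>" "8 * \<delta> \<le> pc" "8 * \<delta> \<le> 1 - pc" "pc + \<delta> < ph"
    using pc0 ph ph1 by (auto simp: \<delta>_def min_def field_simps)
  define \<beta> where "\<beta> = min (pc - \<delta>) (1 - (pc + \<delta>))"
  have \<beta>: "0 < \<beta>" "\<beta> \<le> pc - \<delta>" "\<beta> \<le> 1 - (pc + \<delta>)" using \<delta> pc0 by (auto simp: \<beta>_def)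
  interpret critical_window E D V "two_point E ph" M ph pc \<delta> \<beta>
  proof
    show "rexp F ph {x} (\<lambda>K. of_bool (y \<in> K)) \<le> two_point E ph x y" if "finite F" "F \<subseteq> E" for F x y
      using that ph1 by (intro rexp_le_two_point) auto
    show "cbdd E p real v" if h: "0 < p" "p < pc" "v \<in> V" for p v
    proof -
      obtain X where "\<forall>v\<in>V. \<forall>F. finite F \<longrightarrow> F \<subseteq> E \<longrightarrow> rexp F p {v} (\<lambda>K. real (card K)) \<le> X"
        using below_p_crit[OF h(1) h(2)[unfolded pc_def]] unfolding bounded_susceptibility_def by blast
      then show ?thesis using h(3) by (intro cbddI[of _ _ _ _ X]) auto
    qed
    show "\<exists>v\<in>V. \<forall>S. finite S \<longrightarrow> S \<subseteq> V \<longrightarrow> v \<in> S \<longrightarrow> 1 \<le> phi E p v S" if "pc < p" "p < ph" for p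
      using above_p_crit[of p] that ph1 unfolding pc_def by auto
  qed (use M ph1 \<delta> \<beta> in auto)
  obtain N :: nat and c1 C1 where low: "0 < c1" "0 < C1"
    "\<And>n v p. 1 \<le> n \<Longrightarrow> v \<in> V \<Longrightarrow> pc - \<delta> \<le> p \<Longrightarrow> p \<le> pc + \<delta> \<Longrightarrow>
      c1 / sqrt n * exp (- C1 * (p - pc)\<^sup>2 * n) \<le> tail E p n v - tail E p (N * n) v"
    using window_lower by blast
  obtain A a where sub: "0 < A" "0 < a" "\<And>n v p. 1 \<le> n \<Longrightarrow> v \<in> V \<Longrightarrow> pc - \<delta> \<le> p \<Longrightarrow> p < pc \<Longrightarrow>
      tail E p n v \<le> A / sqrt n * exp (- a * (p - pc)\<^sup>2 * n)"
    using subcritical_tail by blast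
  obtain B b where sup: "0 < B" "0 < b" "\<And>n v p W. 1 \<le> n \<Longrightarrow> v \<in> V \<Longrightarrow> pc < p \<Longrightarrow> p \<le> pc + \<delta> \<Longrightarrow> finite W \<Longrightarrow> W \<subseteq> V \<Longrightarrow>
      rexp {e \<in> E. e \<inter> W \<noteq> {}} p {v} (\<lambda>K. of_bool (K \<subseteq> W \<and> n \<le> card K)) \<le> B / sqrt n * exp (- b * (p - pc)\<^sup>2 * n)"
    using supercritical_tail by blast
  obtain C where crit: "1 \<le> C" "\<And>n v p. 1 \<le> n \<Longrightarrow> v \<in> V \<Longrightarrow> 0 \<le> p \<Longrightarrow> p \<le> pc + \<delta> / sqrt n \<Longrightarrow> tail E p n v \<le> C / sqrt n"
    using tail_bound by blast
  define C2 where "C2 = A + B + C"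
  define c2 where "c2 = min a b"
  have pos: "0 < C2" "0 < c2" using sub sup crit by (auto simp: C2_def c2_def)
  have weaken: "K / sqrt n * exp (- k * (p - pc)\<^sup>2 * n) \<le> C2 / sqrt n * exp (- c2 * (p - pc)\<^sup>2 * n)"
    if "0 \<le> K" "K \<le> C2" "c2 \<le> k" for K k p and n :: nat
  proof (rule mult_mono)
    show "K / sqrt n \<le> C2 / sqrt n" using that by (intro divide_right_mono) auto
    have "c2 * ((p - pc)\<^sup>2 * n) \<le> k * ((p - pc)\<^sup>2 * n)" using that by (intro mult_right_mono) auto
    then show "exp (- k * (p - pc)\<^sup>2 * n) \<le> exp (- c2 * (p - pc)\<^sup>2 * n)" by (simp add: mult.assoc)
  qed (use pos in auto)
  have main: "c1 / sqrt n * exp (- C1 * (p - pc)\<^sup>2 * n) \<le> measure (percolation E p) (finite_large p v n) \<and>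
      measure (percolation E p) (finite_large p v n) \<le> C2 / sqrt n * exp (- c2 * (p - pc)\<^sup>2 * n)"
    if n: "1 \<le> n" and v: "v \<in> V" and p: "pc - \<delta> < p" "p < pc + \<delta>" for n v p
  proof
    have p01: "0 \<le> p" "p \<le> 1" using window[of p] p by auto
    show "c1 / sqrt n * exp (- C1 * (p - pc)\<^sup>2 * n) \<le> measure (percolation E p) (finite_large p v n)"
      using low(3)[OF n v, of p] finite_large_ge[OF p01, of n v "N * n"] p by simp
    consider "p < pc" | "p = pc" | "pc < p" by linarith
    then show "measure (percolation E p) (finite_large p v n) \<le> C2 / sqrt n * exp (- c2 * (p - pc)\<^sup>2 * n)"
    proof cases
      case 1
      have "measure (percolation E p) (finite_large p v n) \<le> tail E p n v" by (rule finite_large_le_tail[OF p01])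
      also have "\<dots> \<le> A / sqrt n * exp (- a * (p - pc)\<^sup>2 * n)" using n v p 1 by (intro sub) auto
      also have "\<dots> \<le> C2 / sqrt n * exp (- c2 * (p - pc)\<^sup>2 * n)"
        using sub sup crit by (intro weaken) (auto simp: C2_def c2_def)
      finally show ?thesis .
    next
      case 2
      have "measure (percolation E p) (finite_large p v n) \<le> tail E p n v" by (rule finite_large_le_tail[OF p01])
      also have "\<dots> \<le> C / sqrt n" using n v p01 2 scale[OF n] by (intro crit) auto
      also have "\<dots> = C / sqrt n * exp (- c2 * (p - pc)\<^sup>2 * n)" using 2 by simp
      also have "\<dots> \<le> C2 / sqrt n * exp (- c2 * (p - pc)\<^sup>2 * n)"
        using sub sup crit by (intro weaken) (auto simp: C2_def c2_def)
      finally show ?thesis .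
    next
      case 3
      have "measure (percolation E p) (finite_large p v n) \<le> B / sqrt n * exp (- b * (p - pc)\<^sup>2 * n)"
      proof (rule finite_large_le[OF p01])
        fix m
        show "rexp (local_edges v m) p {v} (\<lambda>K. of_bool (K \<subseteq> nball {v} m \<and> n \<le> card K)) \<le> B / sqrt n * exp (- b * (p - pc)\<^sup>2 * n)"
          unfolding local_edges_def using n v p 3 finite_nball[of "{v}" m] nball_subset_V[of "{v}" V m] EV
          by (intro sup) auto
      qed
      also have "\<dots> \<le> C2 / sqrt n * exp (- c2 * (p - pc)\<^sup>2 * n)"
        using sub sup crit by (intro weaken) (auto simp: C2_def c2_def)
      finally show ?thesis .
    qed
  qed
  have powr: "real n powr (- 1 / 2) = 1 / sqrt n" for n :: nat
    by (simp add: powr_minus_divide powr_half_sqrt)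
  show ?thesis
    unfolding powr power2_abs pc_def[symmetric] finite_large_def[symmetric]
    by (rule exI[of _ \<delta>], rule exI[of _ c1], rule exI[of _ c2], rule exI[of _ C1], rule exI[of _ C2])
      (use main \<delta>(1) low(1,2) pos in auto)
qed
end
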